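(* Let $F$ be a finitely generated free group endowed with the pro-$\mathbf{Su}$ topology, where $\mathbf{Su}$ is the class of all finite supersolvable groups, and let $H$ be a finitely generated subgroup of $F$. Then the closure $Cl_{\mathbf{Su}}(H)$ of $H$ in $F$ is finitely generated.
   Context: A variety is a class of finite groups closed under taking subgroups, homomorphic images and (finite) direct products. A group $G$ is supersolvable if it has a series $1=H_0\le H_1\le\cdots\le H_n=G$ with each $H_i$ normal in $G$ and each $H_{i+1}/H_i$ cyclic; $\mathbf{Su}$ denotes the variety of all finite supersolvable groups. For a variety $\mathbf{V}$, the pro-$\mathbf{V}$ topology on a group $F$ is the topology having as a basis of open sets all cosets $Kx$, where $x\in F$ and $K$ ranges over the normal subgroups of $F$ with $F/K\in\mathbf{V}$. The closure of a subset $S\subseteq F$ in this topology is denoted $Cl_{\mathbf{V}}(S)$. *)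

theory Defs
  imports "HOL-Algebra.Elementary_Groups" "HOL-Analysis.Abstract_Topology"
begin

section \<open>Free groups\<close>

text \<open>A letter \<open>(x, True)\<close> stands for \<open>x\<close> and \<open>(x, False)\<close> for the inverse of \<open>x\<close>.\<close>

definition letter_val :: "('a, 'b) monoid_scheme \<Rightarrow> 'a \<times> bool \<Rightarrow> 'a" where
  "letter_val G l = (if snd l then fst l else inv\<^bsub>G\<^esub> (fst l))"

definition word_val :: "('a, 'b) monoid_scheme \<Rightarrow> ('a \<times> bool) list \<Rightarrow> 'a" where
  "word_val G w = foldr (\<lambda>l g. letter_val G l \<otimes>\<^bsub>G\<^esub> g) w \<one>\<^bsub>G\<^esub>"

definition reduced_words :: "'a set \<Rightarrow> ('a \<times> bool) list set" where
  "reduced_words X =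
     {w. fst ` set w \<subseteq> X \<and>
         successively (\<lambda>l m. \<not> (fst l = fst m \<and> snd l \<noteq> snd m)) w}"

text \<open>
  \<open>X\<close> is a basis of \<open>G\<close> if every element of \<open>G\<close> is the value of exactly one reduced word over
  \<open>X\<close> and its inverses.  The universal property is \<open>free_basis_universal\<close> below; it is not used
  as the definition because HOL cannot quantify over groups of arbitrary type inside a formula.
\<close>

definition free_basis :: "('a, 'b) monoid_scheme \<Rightarrow> 'a set \<Rightarrow> bool" where
  "free_basis G X \<longleftrightarrow>
     X \<subseteq> carrier G \<and> bij_betw (word_val G) (reduced_words X) (carrier G)"

definition free_group :: "('a, 'b) monoid_scheme \<Rightarrow> bool" where
  "free_group G \<longleftrightarrow> group G \<and> (\<exists>X. free_basis G X)"

lemma word_val_Nil [simp]: "word_val G [] = \<one>\<^bsub>G\<^esub>"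
  and word_val_Cons [simp]: "word_val G (l # w) = letter_val G l \<otimes>\<^bsub>G\<^esub> word_val G w"
  by (simp_all add: word_val_def)

context group
begin

lemma letter_val_closed: "fst l \<in> carrier G \<Longrightarrow> letter_val G l \<in> carrier G"
  by (simp add: letter_val_def)

lemma word_val_closed: "fst ` set w \<subseteq> carrier G \<Longrightarrow> word_val G w \<in> carrier G"
  by (induction w) (auto simp: letter_val_closed)

lemma word_val_append:
  "fst ` set v \<subseteq> carrier G \<Longrightarrow> fst ` set w \<subseteq> carrier G \<Longrightarrow>
    word_val G (v @ w) = word_val G v \<otimes> word_val G w"
  by (induction v) (auto simp: letter_val_closed word_val_closed m_assoc)

lemma letter_val_cancel:
  assumes "fst l \<in> carrier G" "fst m = fst l" "snd m \<noteq> snd l" "g \<in> carrier G"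
  shows "letter_val G l \<otimes> (letter_val G m \<otimes> g) = g"
  using assms by (auto simp: letter_val_def m_assoc[symmetric])

end

lemma ex_reduced_word:
  fixes G :: "('a, 'b) monoid_scheme" and K :: "('c, 'd) monoid_scheme"
  assumes "group G" "group K" "X \<subseteq> carrier G" "f ` X \<subseteq> carrier K" "fst ` set w \<subseteq> X"
  shows "\<exists>v \<in> reduced_words X. word_val G v = word_val G w \<and>
           word_val K (map (apfst f) v) = word_val K (map (apfst f) w)"
  using assms(5)
proof (induction w)
  case Nil
  show ?case by (rule bexI[of _ "[]"]) (auto simp: reduced_words_def)
next
  case (Cons l w)
  interpret G: group G by fact
  interpret K: group K by fact
  from Cons obtain v where v: "v \<in> reduced_words X" "word_val G v = word_val G w"
    "word_val K (map (apfst f) v) = word_val K (map (apfst f) w)" by auto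
  show ?case
  proof (cases "\<exists>m u. v = m # u \<and> fst l = fst m \<and> snd l \<noteq> snd m")
    case True
    then obtain m u where u: "v = m # u" "fst l = fst m" "snd l \<noteq> snd m" by blast
    have X: "fst l \<in> X" "fst ` set u \<subseteq> X" using Cons.prems v(1) u(1)
      by (auto simp: reduced_words_def)
    have "u \<in> reduced_words X"
      using v(1) u(1) by (cases u) (auto simp: reduced_words_def)
    moreover have "word_val G u = word_val G (l # w)"
    proof -
      have "word_val G (l # w) = letter_val G l \<otimes>\<^bsub>G\<^esub> (letter_val G m \<otimes>\<^bsub>G\<^esub> word_val G u)"
        using v(2) u(1) by simp
      also have "\<dots> = word_val G u"
        using X u assms(3) by (intro G.letter_val_cancel G.word_val_closed) auto
      finally show ?thesis by simp
    qed
    moreover have "word_val K (map (apfst f) u) = word_val K (map (apfst f) (l # w))"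
    proof -
      have "word_val K (map (apfst f) (l # w)) =
          letter_val K (apfst f l) \<otimes>\<^bsub>K\<^esub> (letter_val K (apfst f m) \<otimes>\<^bsub>K\<^esub> word_val K (map (apfst f) u))"
        using v(3) u(1) by simp
      also have "\<dots> = word_val K (map (apfst f) u)"
        using X u assms(4)
        by (intro K.letter_val_cancel K.word_val_closed) (fastforce simp: image_subset_iff)+
      finally show ?thesis by simp
    qed
    ultimately show ?thesis by blast
  next
    case False
    then have "l # v \<in> reduced_words X"
      using v(1) Cons.prems by (cases v) (auto simp: reduced_words_def)
    then show ?thesis using v by (intro bexI[of _ "l # v"]) auto
  qed
qed

lemma hom_word_val:
  assumes "group G" "group K" "\<phi> \<in> hom G K" "fst ` set w \<subseteq> carrier G"
  shows "\<phi> (word_val G w) = word_val K (map (apfst \<phi>) w)"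
proof -
  interpret group_hom G K \<phi> using assms by (simp add: group_hom_def group_hom_axioms_def)
  show ?thesis using assms(4)
    by (induction w) (auto simp: letter_val_def G.letter_val_closed G.word_val_closed)
qed

theorem free_basis_universal:
  fixes G :: "('a, 'b) monoid_scheme" and K :: "('c, 'd) monoid_scheme"
  assumes G: "group G" and K: "group K" and X: "free_basis G X" and f: "f ` X \<subseteq> carrier K"
  shows "\<exists>\<phi> \<in> hom G K. (\<forall>x \<in> X. \<phi> x = f x) \<and>
           (\<forall>\<psi> \<in> hom G K. (\<forall>x \<in> X. \<psi> x = f x) \<longrightarrow> (\<forall>g \<in> carrier G. \<psi> g = \<phi> g))"
proof -
  interpret G: group G by fact
  interpret K: group K by fact
  have XG: "X \<subseteq> carrier G" and bij: "bij_betw (word_val G) (reduced_words X) (carrier G)"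
    using X by (auto simp: free_basis_def)
  define nf where "nf = inv_into (reduced_words X) (word_val G)"
  define \<phi> where "\<phi> g = word_val K (map (apfst f) (nf g))" for g
  have nf: "nf g \<in> reduced_words X" "word_val G (nf g) = g" if "g \<in> carrier G" for g
    using bij that unfolding nf_def bij_betw_def
    by (auto intro: inv_into_into f_inv_into_f)
  have nfX: "fst ` set (nf g) \<subseteq> X" if "g \<in> carrier G" for g
    using nf(1)[OF that] by (auto simp: reduced_words_def)
  have nf_val: "nf (word_val G v) = v" if "v \<in> reduced_words X" for v
    using bij that unfolding nf_def bij_betw_def by auto
  have \<phi>: "\<phi> (word_val G w) = word_val K (map (apfst f) w)" if w: "fst ` set w \<subseteq> X" for w
  proof -
    obtain v where "v \<in> reduced_words X" "word_val G v = word_val G w"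
      "word_val K (map (apfst f) v) = word_val K (map (apfst f) w)"
      using ex_reduced_word[OF G K XG f w] by blast
    then show ?thesis unfolding \<phi>_def using nf_val by metis
  qed
  have fK: "fst ` set (map (apfst f) w) \<subseteq> carrier K" if "fst ` set w \<subseteq> X" for w
    using that f by (fastforce simp: image_subset_iff)
  have "\<phi> \<in> hom G K"
  proof (rule homI)
    fix g assume "g \<in> carrier G"
    then show "\<phi> g \<in> carrier K"
      unfolding \<phi>_def by (intro K.word_val_closed fK nfX)
  next
    fix g h assume g: "g \<in> carrier G" and h: "h \<in> carrier G"
    have "word_val G (nf g @ nf h) = g \<otimes>\<^bsub>G\<^esub> h"
      using nfX[OF g] nfX[OF h] XG nf(2)[OF g] nf(2)[OF h]
      by (subst G.word_val_append) auto
    then have "\<phi> (g \<otimes>\<^bsub>G\<^esub> h) = word_val K (map (apfst f) (nf g @ nf h))"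
      using \<phi>[of "nf g @ nf h"] nfX[OF g] nfX[OF h] by (simp add: image_Un)
    also have "\<dots> = \<phi> g \<otimes>\<^bsub>K\<^esub> \<phi> h"
      unfolding \<phi>_def map_append by (intro K.word_val_append fK nfX g h)
    finally show "\<phi> (g \<otimes>\<^bsub>G\<^esub> h) = \<phi> g \<otimes>\<^bsub>K\<^esub> \<phi> h" .
  qed
  moreover have "\<forall>x \<in> X. \<phi> x = f x"
  proof
    fix x assume x: "x \<in> X"
    have "word_val G [(x, True)] = x" "word_val K (map (apfst f) [(x, True)]) = f x"
      using x XG f by (auto simp: letter_val_def)
    then show "\<phi> x = f x" using \<phi>[of "[(x, True)]"] x by simp
  qed
  moreover have "\<psi> g = \<phi> g"
    if \<psi>: "\<psi> \<in> hom G K" "\<forall>x \<in> X. \<psi> x = f x" and g: "g \<in> carrier G" for \<psi> g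
  proof -
    have "\<psi> g = \<psi> (word_val G (nf g))" using nf(2)[OF g] by simp
    also have "\<dots> = word_val K (map (apfst \<psi>) (nf g))"
      using nfX[OF g] XG by (intro hom_word_val[OF G K \<psi>(1)]) auto
    also have "map (apfst \<psi>) (nf g) = map (apfst f) (nf g)"
      using nfX[OF g] \<psi>(2) by (auto simp: apfst_def map_prod_def)
    finally show ?thesis by (simp add: \<phi>_def)
  qed
  ultimately show ?thesis by blast
qed


section \<open>Finitely generated subgroups\<close>

definition fin_gen_subgroup :: "'a set \<Rightarrow> ('a, 'b) monoid_scheme \<Rightarrow> bool" where
  "fin_gen_subgroup H G \<longleftrightarrow>
     subgroup H G \<and> (\<exists>S. finite S \<and> S \<subseteq> H \<and> generate G S = H)"

definition fin_gen_group :: "('a, 'b) monoid_scheme \<Rightarrow> bool" where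
  "fin_gen_group G \<longleftrightarrow> group G \<and> fin_gen_subgroup (carrier G) G"


section \<open>Finite supersolvable groups and the pro-V topology\<close>

definition supersolvable :: "('a, 'b) monoid_scheme \<Rightarrow> bool" where
  "supersolvable G \<longleftrightarrow>
     group G \<and>
     (\<exists>(n::nat) (H::nat \<Rightarrow> 'a set).
        H 0 = {\<one>\<^bsub>G\<^esub>} \<and> H n = carrier G \<and>
        (\<forall>i\<le>n. H i \<lhd> G) \<and>
        (\<forall>i<n. H i \<subseteq> H (Suc i) \<and> cyclic_group ((G\<lparr>carrier := H (Suc i)\<rparr>) Mod H i)))"

definition Su :: "('a, 'b) monoid_scheme \<Rightarrow> bool" where
  "Su G \<longleftrightarrow> finite (carrier G) \<and> supersolvable G"

text \<open>
  A variety \<open>V\<close> enters only through its members among the quotients of \<open>F\<close>, hence the type of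
  the first argument.  \<^const>\<open>topology_generated_by\<close> takes a subbasis; for a variety \<open>V\<close>
  the cosets are already a basis, since \<open>F Mod (K \<inter> L)\<close> embeds into
  \<open>(F Mod K) \<times>\<times> (F Mod L)\<close>.
\<close>

definition pro_topology ::
  "('a set monoid \<Rightarrow> bool) \<Rightarrow> ('a, 'b) monoid_scheme \<Rightarrow> 'a topology" where
  "pro_topology V F =
     topology_generated_by {K #>\<^bsub>F\<^esub> x | K x. K \<lhd> F \<and> V (F Mod K) \<and> x \<in> carrier F}"

definition Cl :: "('a set monoid \<Rightarrow> bool) \<Rightarrow> ('a, 'b) monoid_scheme \<Rightarrow> 'a set \<Rightarrow> 'a set" where
  "Cl V F S = pro_topology V F closure_of S"

end

theory Submission
  imports Defs "HOL-Number_Theory.Number_Theory" "HOL-Algebra.SndIsomorphismGrp"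
begin

text \<open>
  For a prime \<open>p\<close> let \<open>N\<^sub>p\<close> be the subgroup of \<open>F\<close> generated by all \<open>(p - 1)\<close>-th powers and all
  commutators.  Let \<open>Cl\<^sub>p(H)\<close> be the intersection of the subgroups \<open>H T\<close>, where \<open>T\<close> runs through
  the normal subgroups of \<open>F\<close> contained in \<open>N\<^sub>p\<close> that are reached from \<open>N\<^sub>p\<close> by finitely many
  steps, each to the kernel of a homomorphism to the group of order \<open>p\<close>.  Such a \<open>T\<close> has a finite
  supersolvable quotient, because the abelian group \<open>F/N\<^sub>p\<close>, of exponent dividing \<open>p - 1\<close>, acts
  diagonalizably over the field with \<open>p\<close> elements (lemma \<open>p_open_normal_imp_su_open\<close>).

  Conversely, let \<open>F/K\<close> be finite and supersolvable.  For every \<open>p\<close> the group \<open>N\<^sub>pK/K\<close> acts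
  trivially on the chief factors of order \<open>p\<close>, so by transfer it has a normal \<open>p\<close>-complement
  (lemma \<open>su_open_prime_to_p_kernel\<close>).  If \<open>T\<^sub>p\<close> is the complement for \<open>p\<close>, then the index of \<open>H K\<close>
  in the intersection of all \<open>H T\<^sub>p K\<close> is prime to every \<open>p\<close>, hence it is \<open>1\<close>.  It follows that
  \<open>Cl\<^sub>S\<^sub>u(H)\<close> is the intersection of the subgroups \<open>Cl\<^sub>p(H)\<close> (lemma \<open>su_open_closure_from_primes\<close>).

  These subgroups are finitely generated and there are only finitely many of them.  Let \<open>P\<close> be a
  ball of the Cayley graph that contains generators of \<open>H\<close>, and let \<open>Q\<close> be the finite set of all
  \<open>a b\<inverse>\<close> with \<open>a\<close> and \<open>b\<close> in \<open>P\<close>.  For a suitable \<open>T\<close> the subgroup \<open>U = H T\<close> meets \<open>Q\<close> in the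
  same set as \<open>Cl\<^sub>p(H)\<close>.  Let \<open>A\<close> be generated by this set, so that \<open>H \<le> A \<le> Cl\<^sub>p(H) \<le> U = A T\<close>.
  Labelling the edges of the Schreier graph of \<open>U\<close> by elements of \<open>A\<close> gives a retraction \<open>r\<close> of
  \<open>U\<close> onto \<open>A\<close> that moves every element within its coset of \<open>T\<close> (lemma \<open>retraction_exists\<close>);
  this is where freeness enters.  As \<open>F\<close> is residually a finite \<open>p\<close>-group (lemma
  \<open>separate_by_p_open\<close>), the fixed points of \<open>r\<close> form a closed set, hence \<open>Cl\<^sub>p(H) = A\<close>
  (theorem \<open>prime_closure_eq_generate\<close>).  The set \<open>Q\<close> does not depend on \<open>p\<close> and has finitely many
  subsets, so \<open>Cl\<^sub>S\<^sub>u(H)\<close> is an intersection of finitely many finitely generated subgroups, and it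
  is finitely generated by Howson's theorem (theorem \<open>howson\<close>).

  Normal subgroups with quotient of order dividing \<open>q\<close> are written throughout as kernels of
  integer-valued functions that are additive modulo \<open>q\<close>.
\<close>

section \<open>Characters modulo a prime and the subgroups they cut out\<close>

context group
begin

lemma inv_cancel_left: "a \<in> carrier G \<Longrightarrow> b \<in> carrier G \<Longrightarrow> a \<otimes> (inv a \<otimes> b) = b"
  and inv_cancel_left': "a \<in> carrier G \<Longrightarrow> b \<in> carrier G \<Longrightarrow> inv a \<otimes> (a \<otimes> b) = b"
  by (simp_all add: m_assoc[symmetric])

lemmas group_normalize = m_assoc inv_mult_group inv_cancel_left inv_cancel_left'

text \<open>
  A homomorphism from \<open>L\<close> to the integers modulo \<open>q\<close>, given by integer representatives of its
  values, so that integer linear combinations of characters are again characters.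
\<close>
definition char_mod :: "nat \<Rightarrow> 'a set \<Rightarrow> ('a \<Rightarrow> int) \<Rightarrow> bool" where
  "char_mod q L \<xi> \<longleftrightarrow> (\<forall>a\<in>L. \<forall>b\<in>L. [\<xi> (a \<otimes> b) = \<xi> a + \<xi> b] (mod int q))"

lemma char_modD: "char_mod q L \<xi> \<Longrightarrow> a \<in> L \<Longrightarrow> b \<in> L \<Longrightarrow> [\<xi> (a \<otimes> b) = \<xi> a + \<xi> b] (mod int q)"
  by (simp add: char_mod_def)

lemma char_mod_mono: "char_mod q L \<xi> \<Longrightarrow> M \<subseteq> L \<Longrightarrow> char_mod q M \<xi>"
  by (auto simp: char_mod_def)

lemma char_mod_one:
  assumes "char_mod q L \<xi>" "subgroup L G"
  shows "[\<xi> \<one> = 0] (mod int q)"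
proof -
  have "[\<xi> (\<one> \<otimes> \<one>) = \<xi> \<one> + \<xi> \<one>] (mod int q)"
    using assms by (intro char_modD) (auto simp: subgroup.one_closed)
  then have "[\<xi> \<one> + 0 = \<xi> \<one> + \<xi> \<one>] (mod int q)" by simp
  then show ?thesis by (metis cong_add_lcancel cong_sym)
qed

lemma char_mod_inv:
  assumes "char_mod q L \<xi>" "subgroup L G" "a \<in> L"
  shows "[\<xi> (inv a) = - \<xi> a] (mod int q)"
proof -
  have "[\<xi> (a \<otimes> inv a) = \<xi> a + \<xi> (inv a)] (mod int q)"
    using assms by (intro char_modD) (auto simp: subgroup.m_inv_closed)
  moreover have "a \<otimes> inv a = \<one>"
    using assms subgroup.mem_carrier by fastforce
  ultimately have "[\<xi> a + \<xi> (inv a) = 0] (mod int q)"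
    using char_mod_one[OF assms(1,2)] by (metis cong_sym cong_trans)
  then have "[\<xi> a + \<xi> (inv a) = \<xi> a + (- \<xi> a)] (mod int q)" by simp
  then show ?thesis by (simp only: cong_add_lcancel)
qed

lemma subgroup_nat_pow_closed: "subgroup L G \<Longrightarrow> a \<in> L \<Longrightarrow> a [^] (n::nat) \<in> L"
  by (metis subgroup_int_pow_closed int_pow_int)

lemma char_mod_pow:
  assumes "char_mod q L \<xi>" "subgroup L G" "a \<in> L"
  shows "[\<xi> (a [^] (n::nat)) = int n * \<xi> a] (mod int q)"
proof (induction n)
  case 0
  show ?case using char_mod_one[OF assms(1,2)] by simp
next
  case (Suc n)
  have "a [^] n \<in> L" using assms by (metis subgroup_int_pow_closed int_pow_int)
  then have "[\<xi> (a [^] n \<otimes> a) = \<xi> (a [^] n) + \<xi> a] (mod int q)"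
    using assms by (intro char_modD)
  also have "[\<xi> (a [^] n) + \<xi> a = int n * \<xi> a + \<xi> a] (mod int q)"
    by (intro cong_add Suc cong_refl)
  finally show ?case by (simp add: algebra_simps)
qed

lemma subgroup_ker_mod:
  assumes "char_mod q L \<xi>" "subgroup L G"
  shows "subgroup {a\<in>L. int q dvd \<xi> a} G"
proof (rule subgroupI)
  show "{a \<in> L. int q dvd \<xi> a} \<subseteq> carrier G" using subgroup.subset[OF assms(2)] by auto
  show "{a \<in> L. int q dvd \<xi> a} \<noteq> {}"
    using char_mod_one[OF assms] subgroup.one_closed[OF assms(2)] by (auto simp: cong_0_iff)
  fix a assume a: "a \<in> {a \<in> L. int q dvd \<xi> a}"
  show "inv a \<in> {a \<in> L. int q dvd \<xi> a}"
    using a char_mod_inv[OF assms, of a] subgroup.m_inv_closed[OF assms(2)]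
    by (auto simp: cong_dvd_iff)
  fix b assume b: "b \<in> {a \<in> L. int q dvd \<xi> a}"
  show "a \<otimes> b \<in> {a \<in> L. int q dvd \<xi> a}"
    using a b char_modD[OF assms(1), of a b] subgroup.m_closed[OF assms(2)]
    by (auto simp: cong_dvd_iff)
qed

text \<open>
  The quotient of \<open>L\<close> by the kernel is generated by every element \<open>a\<close> outside the kernel.
\<close>
lemma char_mod_generator:
  assumes q: "prime q" and \<xi>: "char_mod q L \<xi>" and L: "subgroup L G"
    and a: "a \<in> L" "\<not> int q dvd \<xi> a"
  obtains u where "\<And>l. l \<in> L \<Longrightarrow>
    \<exists>k::nat. [int k = u * \<xi> l] (mod int q) \<and> l \<otimes> inv (a [^] k) \<in> {x\<in>L. int q dvd \<xi> x}"
proof -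
  interpret L: subgroup L G by fact
  have "coprime (\<xi> a) (int q)"
    using a(2) q prime_imp_coprime[of "int q" "\<xi> a"] by (simp add: coprime_commute)
  then obtain u where u: "[\<xi> a * u = 1] (mod int q)" using cong_solve_coprime_int by blast
  have "\<exists>k::nat. [int k = u * \<xi> l] (mod int q) \<and> l \<otimes> inv (a [^] k) \<in> {x\<in>L. int q dvd \<xi> x}"
    if l: "l \<in> L" for l
  proof -
    define k where "k = nat ((u * \<xi> l) mod int q)"
    have k: "[int k = u * \<xi> l] (mod int q)" using prime_gt_0_nat[OF q] by (simp add: k_def)
    have ak: "a [^] k \<in> L" by (rule subgroup_nat_pow_closed[OF L a(1)])
    have "[\<xi> (a [^] k) = int k * \<xi> a] (mod int q)" by (rule char_mod_pow[OF \<xi> L a(1)])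
    also have "[int k * \<xi> a = u * \<xi> l * \<xi> a] (mod int q)" by (intro cong_mult cong_refl k)
    also have "u * \<xi> l * \<xi> a = \<xi> a * u * \<xi> l" by simp
    also have "[\<xi> a * u * \<xi> l = 1 * \<xi> l] (mod int q)" by (intro cong_mult cong_refl u)
    finally have "[\<xi> l + (- \<xi> (a [^] k)) = \<xi> l + (- (1 * \<xi> l))] (mod int q)"
      by (intro cong_add cong_refl) (simp only: cong_minus_minus_iff)
    moreover have "[\<xi> (l \<otimes> inv (a [^] k)) = \<xi> l + (- \<xi> (a [^] k))] (mod int q)"
      using char_modD[OF \<xi> l, of "inv (a [^] k)"] char_mod_inv[OF \<xi> L ak] ak
      by (meson L.m_inv_closed cong_add cong_refl cong_trans)
    ultimately have "[\<xi> (l \<otimes> inv (a [^] k)) = \<xi> l + (- (1 * \<xi> l))] (mod int q)"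
      by (rule cong_trans[rotated])
    then have "int q dvd \<xi> (l \<otimes> inv (a [^] k))" by (simp add: cong_0_iff)
    then show ?thesis using k l ak by blast
  qed
  then show ?thesis by (rule that)
qed

text \<open>
  The subgroups reached from \<open>N\<close> by successive kernels of characters modulo \<open>p\<close>.  Trivial
  characters are allowed, so a step may leave the subgroup unchanged; therefore the notion is
  stable under intersections and preimages without any case distinction.
\<close>
inductive p_open :: "nat \<Rightarrow> 'a set \<Rightarrow> 'a set \<Rightarrow> bool" for p N where
  base: "p_open p N N"
| step: "p_open p N D \<Longrightarrow> char_mod p D \<xi> \<Longrightarrow> p_open p N {a\<in>D. int p dvd \<xi> a}"

lemma p_open_subset: "p_open p N D \<Longrightarrow> D \<subseteq> N"
  by (induction rule: p_open.induct) auto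

lemma p_open_subgroup: "p_open p N D \<Longrightarrow> subgroup N G \<Longrightarrow> subgroup D G"
  by (induction rule: p_open.induct) (auto intro: subgroup_ker_mod)

lemma p_open_trans: "p_open p D E \<Longrightarrow> p_open p N D \<Longrightarrow> p_open p N E"
  by (induction rule: p_open.induct) (auto intro: p_open.step)

lemma p_open_vimage:
  assumes "p_open p M E" "r ` D \<subseteq> M"
    and "\<And>a b. a \<in> D \<Longrightarrow> b \<in> D \<Longrightarrow> r (a \<otimes> b) = r a \<otimes> r b"
  shows "p_open p D {d\<in>D. r d \<in> E}"
  using assms(1)
proof (induction rule: p_open.induct)
  case base
  have "{d\<in>D. r d \<in> M} = D" using assms(2) by auto
  then show ?case by (simp add: p_open.base)
next
  case (step E \<xi>)
  have "char_mod p {d\<in>D. r d \<in> E} (\<lambda>d. \<xi> (r d))"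
    using step.hyps(2) assms(3) by (auto simp: char_mod_def)
  from p_open.step[OF step.IH this]
  show ?case by (rule back_subst[where P = "p_open p D"]) auto
qed

lemma p_open_restrict:
  assumes "p_open p N E" "D \<subseteq> N"
  shows "p_open p D (D \<inter> E)"
  using p_open_vimage[OF assms(1), where r = "\<lambda>x. x" and D = D] assms(2)
  by (simp add: Collect_conj_eq)

lemma p_open_Int:
  assumes "p_open p N D" "p_open p N E"
  shows "p_open p N (D \<inter> E)"
  using p_open_trans[OF p_open_restrict[OF assms(2) p_open_subset[OF assms(1)]] assms(1)] .

text \<open>
  Finite index, in terms of a finite set of representatives of right cosets.
\<close>
definition fin_index :: "'a set \<Rightarrow> bool" where
  "fin_index K \<longleftrightarrow> (\<exists>R. finite R \<and> R \<subseteq> carrier G \<and> (\<forall>g\<in>carrier G. \<exists>r\<in>R. g \<otimes> inv r \<in> K))"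

lemma fin_index_carrier: "fin_index (carrier G)"
  unfolding fin_index_def by (rule exI[of _ "{\<one>}"]) auto

lemma fin_index_ker_mod:
  assumes "fin_index L" "subgroup L G" "char_mod q L \<xi>" "q > 0"
  shows "fin_index {a\<in>L. int q dvd \<xi> a}"
proof -
  obtain R where R: "finite R" "R \<subseteq> carrier G" "\<forall>g\<in>carrier G. \<exists>r\<in>R. g \<otimes> inv r \<in> L"
    using assms(1) unfolding fin_index_def by blast
  define t where "t i = (SOME l. l \<in> L \<and> \<xi> l mod int q = i)" for i
  define R' where "R' = (\<lambda>(i,r). t i \<otimes> r) ` (((\<lambda>l. \<xi> l mod int q) ` L) \<times> R)"
  have t: "t i \<in> L \<and> \<xi> (t i) mod int q = i" if "i \<in> (\<lambda>l. \<xi> l mod int q) ` L" for i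
    unfolding t_def by (rule someI_ex) (use that in auto)
  have "finite ((\<lambda>l. \<xi> l mod int q) ` L)"
    by (rule finite_subset[of _ "{0..<int q}"]) (use assms(4) in auto)
  then have fin: "finite R'" unfolding R'_def using R(1) by blast
  have sub: "R' \<subseteq> carrier G"
  proof
    fix x assume "x \<in> R'"
    then obtain i r where x: "x = t i \<otimes> r" "i \<in> (\<lambda>l. \<xi> l mod int q) ` L" "r \<in> R"
      unfolding R'_def by (elim imageE SigmaE) simp
    then have "t i \<in> carrier G" "r \<in> carrier G"
      using t[OF x(2)] R(2) subgroup.subset[OF assms(2)] by blast+
    then show "x \<in> carrier G" using x(1) by simp
  qed
  have "\<exists>r\<in>R'. g \<otimes> inv r \<in> {a\<in>L. int q dvd \<xi> a}" if g: "g \<in> carrier G" for g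
  proof -
    obtain r where r: "r \<in> R" "g \<otimes> inv r \<in> L" using R(3) g by blast
    define l where "l = g \<otimes> inv r"
    define i where "i = \<xi> l mod int q"
    have i: "i \<in> (\<lambda>l. \<xi> l mod int q) ` L" using r by (auto simp: i_def l_def)
    have lL: "l \<in> L" "t i \<in> L" using r t[OF i] by (auto simp: l_def)
    have car: "l \<in> carrier G" "t i \<in> carrier G" "r \<in> carrier G"
      using lL subgroup.subset[OF assms(2)] r R(2) by auto
    have "[\<xi> (l \<otimes> inv (t i)) = \<xi> l + \<xi> (inv (t i))] (mod int q)"
      using lL assms(2,3) by (intro char_modD) (auto simp: subgroup.m_inv_closed)
    also have "[\<xi> l + \<xi> (inv (t i)) = \<xi> l + (- \<xi> (t i))] (mod int q)"
      by (intro cong_add cong_refl char_mod_inv[OF assms(3,2)] lL)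
    also have "[\<xi> l + (- \<xi> (t i)) = \<xi> l + (- \<xi> l)] (mod int q)"
    proof -
      have "[\<xi> (t i) = \<xi> l] (mod int q)" using t[OF i] by (simp add: cong_def i_def)
      then show ?thesis by (intro cong_add cong_refl) (simp add: cong_minus_minus_iff)
    qed
    finally have "int q dvd \<xi> (l \<otimes> inv (t i))" by (simp add: cong_0_iff)
    moreover have "l \<otimes> inv (t i) \<in> L"
      using lL assms(2) by (simp add: subgroup.m_closed subgroup.m_inv_closed)
    moreover have "g \<otimes> inv (t i \<otimes> r) = l \<otimes> inv (t i)"
      using car g by (simp add: l_def group_normalize)
    moreover have "t i \<otimes> r \<in> R'" unfolding R'_def using i r(1) by auto
    ultimately show ?thesis by (intro bexI[of _ "t i \<otimes> r"]) auto
  qed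
  then show ?thesis unfolding fin_index_def
    by (intro exI[of _ R'] conjI ballI fin sub)
qed

lemma fin_index_p_open:
  assumes "p_open p N D" "subgroup N G" "fin_index N" "p > 0"
  shows "fin_index D"
  using assms(1)
proof (induction rule: p_open.induct)
  case (step D \<xi>)
  then show ?case using assms p_open_subgroup by (intro fin_index_ker_mod) auto
qed (use assms in simp)

text \<open>
  The normal core of \<open>D\<close> is a finite intersection of conjugates of \<open>D\<close>.
\<close>
lemma p_open_core:
  assumes D: "p_open p N D" and N: "N \<lhd> G" and fin: "fin_index D"
  shows "\<exists>T. T \<lhd> G \<and> p_open p N T \<and> T \<subseteq> D"
proof -
  interpret N: normal N G by fact
  have sD: "subgroup D G" using p_open_subgroup[OF D N.is_subgroup] .
  interpret D: subgroup D G by fact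
  obtain R where R: "finite R" "R \<subseteq> carrier G" "\<forall>g\<in>carrier G. \<exists>r\<in>R. g \<otimes> inv r \<in> D"
    using fin unfolding fin_index_def by blast
  define T where "T = {x\<in>N. \<forall>g\<in>carrier G. g \<otimes> x \<otimes> inv g \<in> D}"
  have po: "p_open p N {x\<in>N. \<forall>r\<in>R'. r \<otimes> x \<otimes> inv r \<in> D}" if "finite R'" "R' \<subseteq> carrier G" for R'
    using that
  proof (induction rule: finite_induct)
    case empty
    show ?case by (simp add: p_open.base)
  next
    case (insert r R')
    have "p_open p N {x\<in>N. r \<otimes> x \<otimes> inv r \<in> D}"
    proof (rule p_open_vimage[OF D])
      show "(\<lambda>x. r \<otimes> x \<otimes> inv r) ` N \<subseteq> N" using insert.prems N.inv_op_closed2 by auto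
      fix a b assume "a \<in> N" "b \<in> N"
      then show "r \<otimes> (a \<otimes> b) \<otimes> inv r = r \<otimes> a \<otimes> inv r \<otimes> (r \<otimes> b \<otimes> inv r)"
        using insert.prems by (simp add: group_normalize)
    qed
    from p_open_Int[OF this insert.IH] insert.prems
    have "p_open p N ({x\<in>N. r \<otimes> x \<otimes> inv r \<in> D} \<inter> {x\<in>N. \<forall>r\<in>R'. r \<otimes> x \<otimes> inv r \<in> D})"
      by simp
    then show ?case by (rule back_subst[where P = "p_open p N"]) auto
  qed
  have "T = {x\<in>N. \<forall>r\<in>R. r \<otimes> x \<otimes> inv r \<in> D}"
  proof (intro equalityI subsetI)
    fix x assume x: "x \<in> {x\<in>N. \<forall>r\<in>R. r \<otimes> x \<otimes> inv r \<in> D}"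
    have "g \<otimes> x \<otimes> inv g \<in> D" if g: "g \<in> carrier G" for g
    proof -
      obtain r where r: "r \<in> R" "g \<otimes> inv r \<in> D" using R(3) g by blast
      have "(g \<otimes> inv r) \<otimes> (r \<otimes> x \<otimes> inv r) \<otimes> inv (g \<otimes> inv r) \<in> D"
        using r x by (simp only: mem_Collect_eq D.m_closed D.m_inv_closed)
      moreover have "(g \<otimes> inv r) \<otimes> (r \<otimes> x \<otimes> inv r) \<otimes> inv (g \<otimes> inv r) = g \<otimes> x \<otimes> inv g"
        using g r R(2) x by (auto simp: group_normalize subset_iff)
      ultimately show ?thesis by simp
    qed
    then show "x \<in> T" using x by (simp add: T_def)
  qed (use R(2) in \<open>auto simp: T_def\<close>)
  then have "p_open p N T" using po[OF R(1,2)] by simp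
  moreover have "T \<subseteq> D"
  proof
    fix x assume "x \<in> T"
    then have "\<one> \<otimes> x \<otimes> inv \<one> \<in> D" "x \<in> N" unfolding T_def by blast+
    then show "x \<in> D" by simp
  qed
  moreover have "T \<lhd> G"
  proof (subst normal_inv_iff, intro conjI ballI)
    show "subgroup T G" using p_open_subgroup[OF \<open>p_open p N T\<close> N.is_subgroup] .
    fix g x assume g: "g \<in> carrier G" and x: "x \<in> T"
    have "h \<otimes> (g \<otimes> x \<otimes> inv g) \<otimes> inv h \<in> D" if "h \<in> carrier G" for h
    proof -
      have "(h \<otimes> g) \<otimes> x \<otimes> inv (h \<otimes> g) \<in> D" using that g x by (auto simp: T_def)
      moreover have "(h \<otimes> g) \<otimes> x \<otimes> inv (h \<otimes> g) = h \<otimes> (g \<otimes> x \<otimes> inv g) \<otimes> inv h"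
        using that g x by (auto simp: T_def group_normalize)
      ultimately show ?thesis by simp
    qed
    then show "g \<otimes> x \<otimes> inv g \<in> T" using x g N.inv_op_closed2 by (auto simp: T_def)
  qed
  ultimately show ?thesis by blast
qed

text \<open>
  The normal subgroups with finite supersolvable quotient (lemma \<open>Su_Mod_iff\<close>), reached from
  the whole group by kernels of characters modulo varying primes that are normal in the whole
  group.
\<close>
inductive su_open :: "'a set \<Rightarrow> bool" where
  base: "su_open (carrier G)"
| step: "su_open L \<Longrightarrow> prime q \<Longrightarrow> char_mod q L \<xi> \<Longrightarrow> {a\<in>L. int q dvd \<xi> a} \<lhd> G \<Longrightarrow> su_open {a\<in>L. int q dvd \<xi> a}"

lemma su_open_normal: "su_open K \<Longrightarrow> K \<lhd> G"
  by (induction rule: su_open.induct) (auto simp: normal_self)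

lemma su_open_fin_index: "su_open K \<Longrightarrow> fin_index K"
proof (induction rule: su_open.induct)
  case (step L q \<xi>)
  then show ?case
    by (intro fin_index_ker_mod) (auto simp: prime_gt_0_nat normal_imp_subgroup su_open_normal)
qed (rule fin_index_carrier)

lemma su_open_Int:
  assumes "su_open K" "su_open M"
  shows "su_open (K \<inter> M)"
  using assms(1)
proof (induction rule: su_open.induct)
  case base
  have "carrier G \<inter> M = M" using normal_imp_subgroup[OF su_open_normal[OF assms(2)]] subgroup.subset by blast
  then show ?case using assms(2) by simp
next
  case (step L q \<xi>)
  have eq: "{a\<in>L. int q dvd \<xi> a} \<inter> M = {a\<in>L \<inter> M. int q dvd \<xi> a}" by auto
  have "{a\<in>L. int q dvd \<xi> a} \<inter> M \<lhd> G"
    using step su_open_normal[OF assms(2)] by (intro normal_subgroup_intersect)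
  then show ?case unfolding eq
    using step by (intro su_open.step) (auto intro: char_mod_mono)
qed

end

section \<open>Finite supersolvable quotients\<close>

context group
begin

lemma rcos_eq_iff:
  assumes "subgroup K G" "a \<in> carrier G" "b \<in> carrier G"
  shows "K #> a = K #> b \<longleftrightarrow> a \<otimes> inv b \<in> K"
  using assms subgroup.rcos_module[OF assms(1) is_group assms(3,2)]
  by (metis rcos_self repr_independence)

lemma rcos_eq_self_iff:
  assumes "subgroup K G" "a \<in> carrier G"
  shows "K #> a = K \<longleftrightarrow> a \<in> K"
  using rcos_eq_iff[OF assms, of \<one>] assms subgroup.subset by fastforce

text \<open>
  A finite cyclic factor is refined to factors of prime order.  The induction is on an exponent
  of \<open>g\<close> modulo \<open>K\<close>.
\<close>
lemma su_open_cyclic_step: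
  assumes "su_open L" "K \<lhd> G" "K \<subseteq> L" "g \<in> L" "0 < n" "g [^] (n::nat) \<in> K"
    and "\<And>h. h \<in> L \<Longrightarrow> \<exists>i::int. K #> h = K #> g [^] i"
  shows "su_open K"
  using assms
proof (induction n arbitrary: L g rule: less_induct)
  case (less n L g)
  interpret K: normal K G by fact
  interpret L: normal L G using less.prems(1) by (rule su_open_normal)
  interpret Q: group "G Mod K" by (rule K.factorgroup_is_group)
  have gG: "g \<in> carrier G" using less.prems(4) by simp
  define y where "y = K #> g"
  have y: "y \<in> carrier (G Mod K)" using gG by (auto simp: y_def carrier_FactGroup)
  have ypow: "y [^]\<^bsub>G Mod K\<^esub> (i::int) = K #> g [^] i" for i
    unfolding y_def by (rule K.FactGroup_int_pow[OF gG])
  define m where "m = Q.ord y"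
  have "y [^]\<^bsub>G Mod K\<^esub> n = \<one>\<^bsub>G Mod K\<^esub>"
    unfolding y_def using less.prems(6) gG by (simp add: K.FactGroup_pow rcos_eq_self_iff K.is_subgroup)
  then have mn: "m dvd n" using y Q.pow_eq_id unfolding m_def by blast
  then have mpos: "m > 0" using less.prems(5) by (auto intro: Nat.gr0I)
  have eqpow: "K #> g [^] (i::int) = K #> g [^] (j::int) \<longleftrightarrow> [i = j] (mod int m)" for i j
    using Q.int_pow_eq[OF y] by (simp add: ypow m_def cong_iff_dvd_diff dvd_diff_commute)
  show ?case
  proof (cases "m = 1")
    case True
    have "L \<subseteq> K"
    proof
      fix h assume h: "h \<in> L"
      obtain i :: int where "K #> h = K #> g [^] i" using less.prems(7)[OF h] by blast
      also have "\<dots> = K #> g [^] (0::int)" using eqpow[of i 0] True by simp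
      also have "\<dots> = K" using K.subset by simp
      finally show "h \<in> K" using h by (simp add: rcos_eq_self_iff K.is_subgroup)
    qed
    then show ?thesis using less.prems(1,3) by (metis subset_antisym)
  next
    case False
    then obtain q where q: "prime q" "q dvd m" using prime_factor_nat by blast
    \<comment> \<open>the discrete logarithm to the base \<open>g\<close>, well defined modulo \<open>m\<close> and so modulo \<open>q\<close>\<close>
    define \<xi> where "\<xi> h = (SOME i::int. K #> h = K #> g [^] i)" for h
    have \<xi>: "K #> h = K #> g [^] \<xi> h" if "h \<in> L" for h
      unfolding \<xi>_def by (rule someI_ex[OF less.prems(7)[OF that]])
    have \<xi>_eq: "[\<xi> h = i] (mod int q)" "[\<xi> h = i] (mod int m)"
      if "h \<in> L" "K #> h = K #> g [^] i" for h i
    proof -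
      show "[\<xi> h = i] (mod int m)" using \<xi>[OF that(1)] that(2) eqpow[of "\<xi> h" i] by simp
      then show "[\<xi> h = i] (mod int q)" by (rule cong_dvd_modulus) (use q in simp)
    qed
    have char: "char_mod q L \<xi>"
      unfolding char_mod_def
    proof (intro ballI \<xi>_eq)
      fix a b assume ab: "a \<in> L" "b \<in> L"
      then show "a \<otimes> b \<in> L" by simp
      have "K #> (a \<otimes> b) = (K #> a) <#> (K #> b)" using ab by (simp add: K.rcos_sum)
      also have "\<dots> = (K #> g [^] \<xi> a) <#> (K #> g [^] \<xi> b)" using \<xi> ab by simp
      also have "\<dots> = K #> g [^] (\<xi> a + \<xi> b)" using gG by (simp add: K.rcos_sum int_pow_mult)
      finally show "K #> (a \<otimes> b) = K #> g [^] (\<xi> a + \<xi> b)" .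
    qed
    define L' where "L' = {a\<in>L. int q dvd \<xi> a}"
    have norm: "L' \<lhd> G"
    proof (subst normal_inv_iff, intro conjI ballI)
      show "subgroup L' G" unfolding L'_def by (rule subgroup_ker_mod[OF char L.is_subgroup])
      fix c h assume c: "c \<in> carrier G" and h: "h \<in> L'"
      then have hL: "h \<in> L" "int q dvd \<xi> h" by (auto simp: L'_def)
      have conjL: "c \<otimes> h \<otimes> inv c \<in> L" "c \<otimes> g \<otimes> inv c \<in> L"
        using L.inv_op_closed2 c hL less.prems(4) by auto
      define j where "j = \<xi> (c \<otimes> g \<otimes> inv c)"
      define x where "x = K #> c"
      have x: "x \<in> carrier (G Mod K)" using c by (auto simp: x_def carrier_FactGroup)
      have xi: "inv\<^bsub>G Mod K\<^esub> x = K #> inv c" using c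
        by (metis K.rcos_inv K.inv_FactGroup x x_def)
      have conjpow: "x \<otimes>\<^bsub>G Mod K\<^esub> y [^]\<^bsub>G Mod K\<^esub> i \<otimes>\<^bsub>G Mod K\<^esub> inv\<^bsub>G Mod K\<^esub> x
          = (x \<otimes>\<^bsub>G Mod K\<^esub> y \<otimes>\<^bsub>G Mod K\<^esub> inv\<^bsub>G Mod K\<^esub> x) [^]\<^bsub>G Mod K\<^esub> i" for i :: int
      proof -
        have "(\<lambda>z. x \<otimes>\<^bsub>G Mod K\<^esub> z \<otimes>\<^bsub>G Mod K\<^esub> inv\<^bsub>G Mod K\<^esub> x) \<in> hom (G Mod K) (G Mod K)"
          using x by (intro homI) (simp_all only: Q.group_normalize Q.m_closed Q.inv_closed)
        from hom_int_pow[OF this y Q.is_group Q.is_group] show ?thesis .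
      qed
      have "x \<otimes>\<^bsub>G Mod K\<^esub> y \<otimes>\<^bsub>G Mod K\<^esub> inv\<^bsub>G Mod K\<^esub> x = K #> (c \<otimes> g \<otimes> inv c)"
        unfolding xi unfolding x_def y_def using c gG by (simp add: K.rcos_sum)
      also have "\<dots> = K #> g [^] j" using \<xi>[OF conjL(2)] by (simp add: j_def)
      finally have xyx: "x \<otimes>\<^bsub>G Mod K\<^esub> y \<otimes>\<^bsub>G Mod K\<^esub> inv\<^bsub>G Mod K\<^esub> x = y [^]\<^bsub>G Mod K\<^esub> j" by (simp add: ypow)
      have "K #> (c \<otimes> h \<otimes> inv c) = x \<otimes>\<^bsub>G Mod K\<^esub> (K #> h) \<otimes>\<^bsub>G Mod K\<^esub> inv\<^bsub>G Mod K\<^esub> x"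
        unfolding xi unfolding x_def using c hL by (simp add: K.rcos_sum)
      also have "K #> h = y [^]\<^bsub>G Mod K\<^esub> \<xi> h" using \<xi>[OF hL(1)] by (simp add: ypow)
      also have "x \<otimes>\<^bsub>G Mod K\<^esub> y [^]\<^bsub>G Mod K\<^esub> \<xi> h \<otimes>\<^bsub>G Mod K\<^esub> inv\<^bsub>G Mod K\<^esub> x = (y [^]\<^bsub>G Mod K\<^esub> j) [^]\<^bsub>G Mod K\<^esub> \<xi> h"
        by (simp only: conjpow xyx)
      also have "\<dots> = K #> g [^] (j * \<xi> h)" using Q.int_pow_pow[OF y] by (simp add: ypow)
      finally have "[\<xi> (c \<otimes> h \<otimes> inv c) = j * \<xi> h] (mod int q)" by (rule \<xi>_eq(1)[OF conjL(1)])
      then have "int q dvd \<xi> (c \<otimes> h \<otimes> inv c)" using hL(2) by (simp add: cong_dvd_iff)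
      then show "c \<otimes> h \<otimes> inv c \<in> L'" using conjL by (simp add: L'_def)
    qed
    have su_open': "su_open L'" unfolding L'_def
      using less.prems(1) q(1) char norm by (intro su_open.step) (auto simp: L'_def)
    show ?thesis
    proof (rule less.IH[OF _ su_open' K.normal_axioms])
      have "m div q < m" using q mpos prime_gt_1_nat by (intro div_less_dividend) auto
      also have "m \<le> n" using mn less.prems(5) by (intro dvd_imp_le)
      finally show "m div q < n" .
      show "0 < m div q" using q mpos by (metis dvd_mult_div_cancel gr0I less_irrefl mult_0_right)
      show "K \<subseteq> L'"
      proof
        fix h assume h: "h \<in> K"
        then have "K #> h = K #> g [^] (0::int)"
          using rcos_eq_self_iff[OF K.is_subgroup, of h] K.subset by auto
        from \<xi>_eq(1)[OF _ this] show "h \<in> L'"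
          using h less.prems(3) by (auto simp: L'_def cong_0_iff)
      qed
      have "[\<xi> (g [^] q) = int q] (mod int q)"
        by (rule \<xi>_eq) (use less.prems(4) in \<open>auto simp: int_pow_int subgroup_nat_pow_closed[OF L.is_subgroup]\<close>)
      then show "g [^] q \<in> L'"
        using less.prems(4) by (auto simp: L'_def cong_dvd_iff subgroup_nat_pow_closed[OF L.is_subgroup])
      have "K #> g [^] m = K"
        using eqpow[of "int m" 0] K.subset by (simp add: int_pow_int cong_0_iff)
      then have "g [^] m \<in> K" using rcos_eq_self_iff[OF K.is_subgroup] gG by simp
      then show "(g [^] q) [^] (m div q) \<in> K" using gG q(2) by (simp add: nat_pow_pow)
      fix h assume h: "h \<in> L'"
      then obtain k where k: "\<xi> h = int q * k" by (auto simp: L'_def)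
      have "K #> h = K #> g [^] (int q * k)" using h \<xi> k by (auto simp: L'_def)
      also have "g [^] (int q * k) = (g [^] q) [^] k"
        using gG by (simp add: int_pow_pow[symmetric] int_pow_int)
      finally show "\<exists>i::int. K #> h = K #> (g [^] q) [^] i" by blast
    qed
  qed
qed

lemma cyclic_factor_iff:
  assumes K: "K \<lhd> G" and M: "M \<lhd> G" and L: "subgroup L G" and KM: "K \<subseteq> M" and MsL: "M \<subseteq> L"
  shows "cyclic_group (((G Mod K)\<lparr>carrier := (#>) K ` L\<rparr>) Mod ((#>) K ` M)) \<longleftrightarrow>
    (\<exists>a\<in>L. \<forall>l\<in>L. \<exists>n::int. l \<otimes> inv (a [^] n) \<in> M)"
proof -
  interpret K: normal K G by fact
  interpret M: normal M G by fact
  interpret L: subgroup L G by fact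
  interpret Q: group "G Mod K" by (rule K.factorgroup_is_group)
  interpret \<pi>: group_hom G "G Mod K" "(#>) K"
    using K.r_coset_hom_Mod by (unfold_locales) 
  define A where "A = (G Mod K)\<lparr>carrier := (#>) K ` L\<rparr>"
  define B where "B = (#>) K ` M"
  have sL: "subgroup ((#>) K ` L) (G Mod K)" using \<pi>.subgroup_img_is_subgroup[OF L] .
  have BQ: "B \<lhd> (G Mod K)" unfolding B_def
    by (rule M.surj_hom_normal_subgroup[OF \<pi>.group_hom_axioms]) (simp add: carrier_FactGroup)
  have A: "group A" unfolding A_def by (rule Q.subgroup_imp_group[OF sL])
  have B: "B \<lhd> A" unfolding A_def
    using Q.normal_restrict_supergroup[OF sL BQ] MsL by (auto simp: B_def)
  interpret A: group A by fact
  interpret B: normal B A by fact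
  interpret C: group "A Mod B" by (rule B.factorgroup_is_group)
  have carA: "carrier A = (#>) K ` L" by (simp add: A_def)
  define \<phi> where "\<phi> l = B #>\<^bsub>A\<^esub> (K #> l)" for l
  have pow: "\<phi> (a [^] n) = \<phi> a [^]\<^bsub>A Mod B\<^esub> n" if a: "a \<in> L" for a and n :: int
  proof -
    have "K #> a [^] n = (K #> a) [^]\<^bsub>G Mod K\<^esub> n" using a by (simp add: K.FactGroup_int_pow)
    also have "\<dots> = (K #> a) [^]\<^bsub>A\<^esub> n"
      unfolding A_def by (rule Q.int_pow_consistent[OF sL]) (use a in auto)
    finally show ?thesis unfolding \<phi>_def using a by (simp add: B.FactGroup_int_pow carA)
  qed
  have car: "carrier (A Mod B) = \<phi> ` L" by (simp add: carrier_FactGroup carA \<phi>_def image_image)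
  have eq: "\<phi> l = \<phi> m \<longleftrightarrow> l \<otimes> inv m \<in> M" if lm: "l \<in> L" "m \<in> L" for l m
  proof -
    have "\<phi> l = \<phi> m \<longleftrightarrow> (K #> l) \<otimes>\<^bsub>A\<^esub> inv\<^bsub>A\<^esub> (K #> m) \<in> B"
      unfolding \<phi>_def by (rule A.rcos_eq_iff[OF B.is_subgroup]) (use lm carA in auto)
    also have "inv\<^bsub>A\<^esub> (K #> m) = inv\<^bsub>G Mod K\<^esub> (K #> m)"
      unfolding A_def by (rule Q.m_inv_consistent[OF sL]) (use lm in auto)
    also have "(K #> l) \<otimes>\<^bsub>A\<^esub> inv\<^bsub>G Mod K\<^esub> (K #> m) = K #> (l \<otimes> inv m)"
    proof -
      have "inv\<^bsub>G Mod K\<^esub> (K #> m) = K #> inv m" using lm by simp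
      then show ?thesis using lm by (simp add: A_def K.rcos_sum)
    qed
    also have "\<dots> \<in> B \<longleftrightarrow> l \<otimes> inv m \<in> M"
    proof
      assume "K #> (l \<otimes> inv m) \<in> B"
      then obtain x where x: "x \<in> M" "K #> (l \<otimes> inv m) = K #> x" by (auto simp: B_def)
      then have "l \<otimes> inv m \<otimes> inv x \<in> M"
        using rcos_eq_iff[OF K.is_subgroup, of "l \<otimes> inv m" x] lm KM by auto
      then have "l \<otimes> inv m \<otimes> inv x \<otimes> x \<in> M" using x(1) by (rule M.m_closed)
      then show "l \<otimes> inv m \<in> M" using lm x by (simp add: group_normalize)
    qed (simp add: B_def)
    finally show ?thesis .
  qed
  have "cyclic_group (A Mod B) \<longleftrightarrow> (\<exists>a\<in>L. \<forall>l\<in>L. \<exists>n::int. \<phi> l = \<phi> (a [^] n))"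
  proof -
    have "\<phi> (a [^] n) \<in> \<phi> ` L" if "a \<in> L" for n :: int and a
      using subgroup_int_pow_closed[OF L that] by blast
    then have "\<phi> ` L = range (\<lambda>n::int. \<phi> a [^]\<^bsub>A Mod B\<^esub> n) \<longleftrightarrow> (\<forall>l\<in>L. \<exists>n::int. \<phi> l = \<phi> (a [^] n))"
      if a: "a \<in> L" for a
    proof -
      have "\<phi> ` L = range (\<lambda>n::int. \<phi> (a [^] n)) \<longleftrightarrow> \<phi> ` L \<subseteq> range (\<lambda>n::int. \<phi> (a [^] n))"
        using \<open>\<And>n a. a \<in> L \<Longrightarrow> \<phi> (a [^] n) \<in> \<phi> ` L\<close>[OF a] by blast
      also have "\<dots> \<longleftrightarrow> (\<forall>l\<in>L. \<exists>n::int. \<phi> l = \<phi> (a [^] n))" by blast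
      finally show ?thesis by (simp add: pow[OF a])
    qed
    then show ?thesis unfolding C.cyclic_group car by (auto simp: Bex_def)
  qed
  also have "\<dots> \<longleftrightarrow> (\<exists>a\<in>L. \<forall>l\<in>L. \<exists>n::int. l \<otimes> inv (a [^] n) \<in> M)"
    using eq subgroup_int_pow_closed[OF L] by (intro bex_cong ball_cong ex_cong1 refl) auto
  finally show ?thesis by (simp add: A_def B_def)
qed

lemma finite_factor:
  assumes "K \<lhd> G"
  shows "fin_index K \<Longrightarrow> finite (carrier (G Mod K))"
proof -
  assume "fin_index K"
  then obtain R where R: "finite R" "R \<subseteq> carrier G" "\<forall>g\<in>carrier G. \<exists>r\<in>R. g \<otimes> inv r \<in> K"
    unfolding fin_index_def by blast
  have "(#>) K ` carrier G \<subseteq> (#>) K ` R"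
  proof
    fix c assume "c \<in> (#>) K ` carrier G"
    then obtain g where g: "g \<in> carrier G" "c = K #> g" by blast
    then obtain r where r: "r \<in> R" "g \<otimes> inv r \<in> K" using R(3) by blast
    then have "K #> g = K #> r"
      using g R(2) rcos_eq_iff[OF normal_imp_subgroup[OF assms]] by auto
    then show "c \<in> (#>) K ` R" using g r by auto
  qed
  then show ?thesis using R(1) by (metis carrier_FactGroup finite_imageI finite_subset)
qed

lemma su_open_imp_chain:
  assumes "su_open K"
  shows "\<exists>(n::nat) C. C 0 = K \<and> C n = carrier G \<and> (\<forall>i\<le>n. C i \<lhd> G) \<and>
    (\<forall>i<n. C i \<subseteq> C (Suc i) \<and> (\<exists>a\<in>C (Suc i). \<forall>l\<in>C (Suc i). \<exists>k::int. l \<otimes> inv (a [^] k) \<in> C i))"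
  using assms
proof (induction rule: su_open.induct)
  case base
  show ?case by (rule exI[of _ 0], rule exI[of _ "\<lambda>_. carrier G"]) (auto simp: normal_self)
next
  case (step L q \<xi>)
  from step.IH obtain n C where C: "C 0 = L" "C n = carrier G" "\<forall>i\<le>n. C i \<lhd> G"
    "\<forall>i<n. C i \<subseteq> C (Suc i) \<and> (\<exists>a\<in>C (Suc i). \<forall>l\<in>C (Suc i). \<exists>k::int. l \<otimes> inv (a [^] k) \<in> C i)"
    by blast
  have sL: "subgroup L G" using step.hyps(1) su_open_normal normal_imp_subgroup by blast
  interpret L: subgroup L G by fact
  define M where "M = {a\<in>L. int q dvd \<xi> a}"
  have cyc: "\<exists>a\<in>L. \<forall>l\<in>L. \<exists>k::int. l \<otimes> inv (a [^] k) \<in> M"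
  proof (cases "L \<subseteq> M")
    case True
    then show ?thesis by (intro bexI[of _ "\<one>"] ballI exI[of _ 0]) auto
  next
    case False
    then obtain a where a: "a \<in> L" "\<not> int q dvd \<xi> a" by (auto simp: M_def)
    from char_mod_generator[OF step.hyps(2,3) sL a]
    have "\<exists>k::nat. l \<otimes> inv (a [^] k) \<in> M" if "l \<in> L" for l
      unfolding M_def using that by metis
    then have "\<exists>k::int. l \<otimes> inv (a [^] k) \<in> M" if "l \<in> L" for l
      using that by (metis int_pow_int)
    then show ?thesis using a(1) by blast
  qed
  define C' where "C' i = (case i of 0 \<Rightarrow> M | Suc j \<Rightarrow> C j)" for i
  have "C' 0 = M" "C' (Suc n) = carrier G" using C by (auto simp: C'_def)
  moreover have "\<forall>i\<le>Suc n. C' i \<lhd> G" using C(3) step.hyps(4) by (auto simp: C'_def M_def split: nat.split)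
  moreover have "\<forall>i<Suc n. C' i \<subseteq> C' (Suc i) \<and> (\<exists>a\<in>C' (Suc i). \<forall>l\<in>C' (Suc i). \<exists>k::int. l \<otimes> inv (a [^] k) \<in> C' i)"
  proof (intro allI impI)
    fix i assume i: "i < Suc n"
    show "C' i \<subseteq> C' (Suc i) \<and> (\<exists>a\<in>C' (Suc i). \<forall>l\<in>C' (Suc i). \<exists>k::int. l \<otimes> inv (a [^] k) \<in> C' i)"
    proof (cases i)
      case 0
      then show ?thesis using cyc C(1) by (auto simp: C'_def M_def)
    next
      case (Suc j)
      then have "j < n" using i by simp
      then show ?thesis using C(4) Suc by (simp add: C'_def)
    qed
  qed
  ultimately show ?case unfolding M_def[symmetric] by blast
qed

lemma Su_Mod_iff:
  assumes K: "K \<lhd> G"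
  shows "Su (G Mod K) \<longleftrightarrow> su_open K"
proof
  interpret K: normal K G by fact
  interpret Q: group "G Mod K" by (rule K.factorgroup_is_group)
  interpret \<pi>: group_hom G "G Mod K" "(#>) K"
    using K.r_coset_hom_Mod by (unfold_locales) 
  {
    assume su_open: "su_open K"
    obtain n C where C: "C 0 = K" "C n = carrier G" "\<forall>i\<le>n. C i \<lhd> G"
      and C': "\<forall>i<n. C i \<subseteq> C (Suc i) \<and> (\<exists>a\<in>C (Suc i). \<forall>l\<in>C (Suc i). \<exists>k::int. l \<otimes> inv (a [^] k) \<in> C i)"
      using su_open_imp_chain[OF su_open] by blast
    have KC: "K \<subseteq> C i" if "i \<le> n" for i
      using that
    proof (induction i)
      case (Suc i)
      then have "C i \<subseteq> C (Suc i)" "K \<subseteq> C i" using C' by auto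
      then show ?case by blast
    qed (use C(1) in simp)
    have "supersolvable (G Mod K)"
      unfolding supersolvable_def
    proof (intro conjI exI[of _ n] exI[of _ "\<lambda>i. (#>) K ` C i"] allI impI)
      show "group (G Mod K)" by (rule Q.is_group)
      show "(#>) K ` C 0 = {\<one>\<^bsub>G Mod K\<^esub>}"
      proof -
        have "K #> x = K" if "x \<in> K" for x
          using rcos_eq_self_iff[OF K.is_subgroup, of x] that by simp
        then have "(#>) K ` K = {K}" using K.one_closed by blast
        then show ?thesis using C(1) by simp
      qed
      show "(#>) K ` C n = carrier (G Mod K)" using C(2) by (simp add: carrier_FactGroup)
      show "(#>) K ` C i \<lhd> (G Mod K)" if "i \<le> n" for i
        by (rule normal.surj_hom_normal_subgroup[OF _ \<pi>.group_hom_axioms])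
          (use that C(3) in \<open>auto simp: carrier_FactGroup\<close>)
      fix i assume i: "i < n"
      show "(#>) K ` C i \<subseteq> (#>) K ` C (Suc i)" using C' i by blast
      show "cyclic_group ((G Mod K)\<lparr>carrier := (#>) K ` C (Suc i)\<rparr> Mod (#>) K ` C i)"
      proof (subst cyclic_factor_iff[OF K])
        show "C i \<lhd> G" "subgroup (C (Suc i)) G"
          using i C(3) normal_imp_subgroup[of "C (Suc i)" G] by auto
      qed (use i C' KC[of i] in auto)
    qed
    then show "Su (G Mod K)"
      unfolding Su_def using finite_factor[OF K su_open_fin_index[OF su_open]] by simp
  }
  assume Su: "Su (G Mod K)"
  then have fin: "finite (carrier (G Mod K))" by (simp add: Su_def)
  obtain n and H :: "nat \<Rightarrow> 'a set set" where H: "H 0 = {\<one>\<^bsub>G Mod K\<^esub>}" "H n = carrier (G Mod K)"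
    and H': "\<forall>i\<le>n. H i \<lhd> (G Mod K)" "\<forall>i<n. H i \<subseteq> H (Suc i) \<and>
      cyclic_group (((G Mod K)\<lparr>carrier := H (Suc i)\<rparr>) Mod H i)"
    using Su unfolding Su_def supersolvable_def by (elim conjE exE) rule
  have H: "H 0 = {\<one>\<^bsub>G Mod K\<^esub>}" "H n = carrier (G Mod K)"
    "\<And>i. i \<le> n \<Longrightarrow> H i \<lhd> (G Mod K)" "\<And>i. i < n \<Longrightarrow> H i \<subseteq> H (Suc i)"
    "\<And>i. i < n \<Longrightarrow> cyclic_group (((G Mod K)\<lparr>carrier := H (Suc i)\<rparr>) Mod H i)"
    using H H' by simp_all
  define C where "C i = {x \<in> carrier G. K #> x \<in> H i}" for i
  have HC: "(#>) K ` C i = H i" if "i \<le> n" for i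
    using subgroup.subset[OF normal_imp_subgroup[OF H(3)[OF that]]]
    by (auto simp: C_def carrier_FactGroup)
  have Cn: "C i \<lhd> G" if "i \<le> n" for i
    using K.factgroup_subgroup_union_normal[OF H(3)[OF that]]
      K.factgroup_subgroup_union_char[OF normal_imp_subgroup[OF H(3)[OF that]]]
    by (simp add: C_def)
  have KC: "K \<subseteq> C i" if "i \<le> n" for i
  proof
    fix x assume x: "x \<in> K"
    then have "K #> x = K" using rcos_eq_self_iff[OF K.is_subgroup, of x] by simp
    then show "x \<in> C i"
      using x subgroup.one_closed[OF normal_imp_subgroup[OF H(3)[OF that]]] by (simp add: C_def)
  qed
  have "su_open (C (n - j))" if "j \<le> n" for j
    using that
  proof (induction j)
    case 0
    have "C n = carrier G" using H(2) by (auto simp: C_def carrier_FactGroup)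
    then show ?case by (simp add: su_open.base)
  next
    case (Suc j)
    define i where "i = n - Suc j"
    have i: "i < n" "Suc i = n - j" using Suc.prems by (auto simp: i_def)
    have CC: "C i \<subseteq> C (Suc i)" using H(4)[OF i(1)] by (auto simp: C_def)
    have "cyclic_group (((G Mod K)\<lparr>carrier := (#>) K ` C (Suc i)\<rparr>) Mod ((#>) K ` C i))"
      using H(5)[OF i(1)] HC[of i] HC[of "Suc i"] i(1) by simp
    then obtain a where a: "a \<in> C (Suc i)" "\<forall>l\<in>C (Suc i). \<exists>k::int. l \<otimes> inv (a [^] k) \<in> C i"
      using cyclic_factor_iff[OF K Cn[of i] normal_imp_subgroup[OF Cn[of "Suc i"]] KC[of i] CC] i(1)
      by auto
    have aG: "a \<in> carrier G" using a(1) by (simp add: C_def)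
    have sCi: "subgroup (C i) G" using Cn[of i] i(1) normal_imp_subgroup by auto
    show ?case unfolding i_def[symmetric]
    proof (rule su_open_cyclic_step[of "C (Suc i)" _ a "order (G Mod K)"])
      show "su_open (C (Suc i))" using Suc.IH Suc.prems i(2) by simp
      show "C i \<lhd> G" using Cn i by simp
      show "C i \<subseteq> C (Suc i)" by (rule CC)
      show "a \<in> C (Suc i)" by (rule a)
      show "0 < order (G Mod K)" using fin Q.order_gt_0_iff_finite by blast
      have "K #> a [^] order (G Mod K) = (K #> a) [^]\<^bsub>G Mod K\<^esub> order (G Mod K)"
        using aG by (simp add: K.FactGroup_pow)
      also have "\<dots> = \<one>\<^bsub>G Mod K\<^esub>" using aG by (intro Q.pow_order_eq_1) (auto simp: carrier_FactGroup)
      finally have "a [^] order (G Mod K) \<in> K"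
        using aG rcos_eq_self_iff[OF K.is_subgroup] by simp
      then show "a [^] order (G Mod K) \<in> C i" using KC[of i] i(1) by auto
      fix h assume h: "h \<in> C (Suc i)"
      then obtain k :: int where "h \<otimes> inv (a [^] k) \<in> C i" using a(2) by blast
      then have "C i #> h = C i #> a [^] k"
        using rcos_eq_iff[OF sCi] h aG by (simp add: C_def)
      then show "\<exists>k::int. C i #> h = C i #> a [^] k" by blast
    qed
  qed
  from this[of n] have "su_open (C 0)" by simp
  moreover have "C 0 = K" using H(1) rcos_eq_self_iff[OF K.is_subgroup] K.subset by (auto simp: C_def)
  ultimately show "su_open K" by simp
qed

end

section \<open>Quotients that are p-groups by abelian groups of exponent dividing p - 1\<close>

text \<open>
  The induction step of Newton's forward difference formula.
\<close>
lemma newton_forward: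
  fixes a :: "nat \<Rightarrow> int"
  shows "(\<Sum>j\<le>n. int (n choose j) * (a (Suc j) + a j)) = (\<Sum>j\<le>Suc n. int (Suc n choose j) * a j)"
proof -
  have "(\<Sum>j\<le>Suc n. int (Suc n choose j) * a j)
      = a 0 + (\<Sum>j\<le>n. int (Suc n choose Suc j) * a (Suc j))"
    by (subst sum.atMost_Suc_shift) simp
  also have "(\<Sum>j\<le>n. int (Suc n choose Suc j) * a (Suc j))
      = (\<Sum>j\<le>n. int (n choose j) * a (Suc j)) + (\<Sum>j\<le>n. int (n choose Suc j) * a (Suc j))"
    by (simp add: sum.distrib algebra_simps)
  also have "a 0 + ((\<Sum>j\<le>n. int (n choose j) * a (Suc j)) + (\<Sum>j\<le>n. int (n choose Suc j) * a (Suc j)))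
      = (\<Sum>j\<le>n. int (n choose j) * a (Suc j)) + (\<Sum>j\<le>Suc n. int (n choose j) * a j)"
    by (simp add: sum.atMost_Suc_shift del: sum.atMost_Suc)
  also have "(\<Sum>j\<le>Suc n. int (n choose j) * a j) = (\<Sum>j\<le>n. int (n choose j) * a j)" by simp
  finally show ?thesis by (simp add: sum.distrib distrib_left)
qed

lemma prime_power_sum_cong_0:
  assumes p: "prime (p::nat)" and i: "0 < i" "i < p - 1"
  shows "[(\<Sum>x\<in>{1..<p}. int x ^ i) = 0] (mod int p)"
proof -
  have p1: "p > 1" using prime_gt_1_nat[OF p] .
  obtain g where g: "residue_primroot p g" using prime_primitive_root_exists p p1 by blast
  then have cop: "coprime p g" and ord: "ord p g = p - 1"
    using p by (auto simp: residue_primroot_def totient_prime)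
  have ng: "\<not> [g ^ i = 1] (mod p)"
    using ord_divides[of g i p] ord i by (auto dest: dvd_imp_le)
  have cop': "coprime (int g) (int p)" using cop by (simp add: coprime_commute)
  \<comment> \<open>multiplication by a primitive root permutes the nonzero residues\<close>
  let ?f = "\<lambda>x. (g * x) mod p"
  have inj: "inj_on ?f {1..<p}"
  proof (rule inj_onI)
    fix x y assume xy: "x \<in> {1..<p}" "y \<in> {1..<p}" "?f x = ?f y"
    then have "[g * x = g * y] (mod p)" by (simp add: cong_def)
    then have "[x = y] (mod p)" using cop by (simp add: cong_mult_lcancel_nat coprime_commute)
    then show "x = y" using xy by (simp add: cong_def)
  qed
  have "?f ` {1..<p} \<subseteq> {1..<p}"
  proof
    fix y assume "y \<in> ?f ` {1..<p}"
    then obtain x where x: "x \<in> {1..<p}" "y = ?f x" by blast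
    have "\<not> p dvd g * x"
      using x(1) cop p by (auto simp: prime_dvd_mult_iff dvd_imp_le nat_dvd_not_less)
    then show "y \<in> {1..<p}" using x p1 by (auto simp: dvd_eq_mod_eq_0)
  qed
  then have im: "?f ` {1..<p} = {1..<p}" by (intro endo_inj_surj inj) auto
  have "(\<Sum>x\<in>{1..<p}. int x ^ i) = (\<Sum>x\<in>{1..<p}. int (?f x) ^ i)"
    using sum.reindex[OF inj, of "\<lambda>x. int x ^ i"] im by (simp add: comp_def)
  also have "[(\<Sum>x\<in>{1..<p}. int (?f x) ^ i) = (\<Sum>x\<in>{1..<p}. int g ^ i * int x ^ i)] (mod int p)"
  proof (rule cong_sum)
    fix x
    have "[int (?f x) = int g * int x] (mod int p)" by (simp add: zmod_int)
    then have "[int (?f x) ^ i = (int g * int x) ^ i] (mod int p)" by (rule cong_pow)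
    then show "[int (?f x) ^ i = int g ^ i * int x ^ i] (mod int p)" by (simp add: power_mult_distrib)
  qed
  also have "(\<Sum>x\<in>{1..<p}. int g ^ i * int x ^ i) = int g ^ i * (\<Sum>x\<in>{1..<p}. int x ^ i)"
    by (simp only: sum_distrib_left)
  finally have "int p dvd (1 - int g ^ i) * (\<Sum>x\<in>{1..<p}. int x ^ i)"
    by (simp add: cong_iff_dvd_diff left_diff_distrib)
  moreover have "\<not> int p dvd 1 - int g ^ i"
  proof
    assume "int p dvd 1 - int g ^ i"
    then have "[1 = int g ^ i] (mod int p)" by (simp add: cong_iff_dvd_diff)
    then have "[int g ^ i = 1] (mod int p)" by (rule cong_sym)
    then have "[int (g ^ i) = int 1] (mod int p)" by simp
    then show False using ng by (simp only: cong_int_iff)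
  qed
  ultimately have "int p dvd (\<Sum>x\<in>{1..<p}. int x ^ i)" using p by (auto simp: prime_dvd_mult_iff)
  then show ?thesis by (simp add: cong_0_iff)
qed

context group
begin

text \<open>
  Conjugation of \<open>x\<close> by \<open>g\<close>.
\<close>
definition conj_by :: "'a \<Rightarrow> 'a \<Rightarrow> 'a" where "conj_by g x = g \<otimes> x \<otimes> inv g"

lemma conj_by_closed [simp]: "g \<in> carrier G \<Longrightarrow> x \<in> carrier G \<Longrightarrow> conj_by g x \<in> carrier G"
  by (simp add: conj_by_def)

lemma conj_by_mult: "g \<in> carrier G \<Longrightarrow> x \<in> carrier G \<Longrightarrow> y \<in> carrier G \<Longrightarrow> conj_by g (x \<otimes> y) = conj_by g x \<otimes> conj_by g y"
  by (simp add: conj_by_def group_normalize)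

lemma conj_by_conj_by: "g \<in> carrier G \<Longrightarrow> h \<in> carrier G \<Longrightarrow> x \<in> carrier G \<Longrightarrow> conj_by g (conj_by h x) = conj_by (g \<otimes> h) x"
  by (simp add: conj_by_def group_normalize)

lemma conj_by_one: "x \<in> carrier G \<Longrightarrow> conj_by \<one> x = x"
  by (simp add: conj_by_def)

lemma conj_by_normal: "L \<lhd> G \<Longrightarrow> g \<in> carrier G \<Longrightarrow> x \<in> L \<Longrightarrow> conj_by g x \<in> L"
  unfolding conj_by_def by (rule normal.inv_op_closed2)

lemma normal_conj_byI:
  assumes "subgroup L G" "\<And>g x. g \<in> carrier G \<Longrightarrow> x \<in> L \<Longrightarrow> conj_by g x \<in> L"
  shows "L \<lhd> G"
  using assms by (auto simp: normal_inv_iff conj_by_def)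

text \<open>
  The smallest normal subgroup whose quotient is abelian of exponent dividing \<open>n\<close>.
\<close>
definition pow_comm :: "nat \<Rightarrow> 'a set" where
  "pow_comm n = generate G ({x [^] n | x. x \<in> carrier G} \<union>
     {a \<otimes> b \<otimes> inv a \<otimes> inv b | a b. a \<in> carrier G \<and> b \<in> carrier G})"

lemma pow_comm_subgroup: "subgroup (pow_comm n) G"
  unfolding pow_comm_def by (rule generate_is_subgroup) auto

lemma pow_in_pow_comm: "x \<in> carrier G \<Longrightarrow> x [^] n \<in> pow_comm n"
  unfolding pow_comm_def by (rule generate.incl) blast

lemma commutator_in_pow_comm:
  "a \<in> carrier G \<Longrightarrow> b \<in> carrier G \<Longrightarrow> a \<otimes> b \<otimes> inv a \<otimes> inv b \<in> pow_comm n"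
  unfolding pow_comm_def by (rule generate.incl) blast

lemma normal_above_pow_comm:
  assumes "subgroup M G" "pow_comm n \<subseteq> M"
  shows "M \<lhd> G"
proof (rule normal_conj_byI[OF assms(1)])
  fix g x assume g: "g \<in> carrier G" and x: "x \<in> M"
  then have xG: "x \<in> carrier G" using assms(1) subgroup.mem_carrier by fast
  have "(g \<otimes> x \<otimes> inv g \<otimes> inv x) \<otimes> x \<in> M"
    using commutator_in_pow_comm[OF g xG] assms x by (blast intro: subgroup.m_closed)
  then show "conj_by g x \<in> M" using g xG by (simp add: conj_by_def group_normalize)
qed

lemma pow_comm_normal: "pow_comm n \<lhd> G"
  by (rule normal_above_pow_comm[OF pow_comm_subgroup order_refl])

lemma generate_insert_normal:
  assumes M: "M \<lhd> G" and s: "s \<in> carrier G" and h: "h \<in> generate G (insert s M)"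
  shows "\<exists>i::int. M #> h = M #> s [^] i"
proof -
  interpret M: normal M G by fact
  interpret Q: group "G Mod M" by (rule M.factorgroup_is_group)
  have sQ: "M #> s \<in> carrier (G Mod M)" using s by (auto simp: carrier_FactGroup)
  have "h \<in> carrier G \<and> (\<exists>i::int. M #> h = (M #> s) [^]\<^bsub>G Mod M\<^esub> i)"
    using h
  proof (induction rule: generate.induct)
    case one
    show ?case by (intro conjI exI[of _ 0]) (use M.subset in auto)
  next
    case (incl h)
    show ?case
    proof (cases "h = s")
      case True
      then show ?thesis using s sQ by (intro conjI exI[of _ 1]) auto
    next
      case False
      then have "h \<in> M" using incl by simp
      then show ?thesis using rcos_eq_self_iff[OF M.is_subgroup, of h]
        by (intro conjI exI[of _ 0]) auto
    qed
  next
    case (inv h)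
    show ?case
    proof (cases "h = s")
      case True
      then show ?thesis using s sQ
        by (intro conjI exI[of _ "- 1"]) (simp_all add: Q.int_pow_neg M.inv_FactGroup M.rcos_inv)
    next
      case False
      then have "inv h \<in> M" using inv by simp
      then show ?thesis using rcos_eq_self_iff[OF M.is_subgroup, of "inv h"]
        by (intro conjI exI[of _ 0]) auto
    qed
  next
    case (eng h1 h2)
    then obtain i j :: int where ij: "M #> h1 = (M #> s) [^]\<^bsub>G Mod M\<^esub> i" "M #> h2 = (M #> s) [^]\<^bsub>G Mod M\<^esub> j"
      and car: "h1 \<in> carrier G" "h2 \<in> carrier G" by blast
    have "M #> (h1 \<otimes> h2) = (M #> h1) \<otimes>\<^bsub>G Mod M\<^esub> (M #> h2)" using car by (simp add: M.rcos_sum)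
    also have "\<dots> = (M #> s) [^]\<^bsub>G Mod M\<^esub> (i + j)" using sQ by (simp only: ij Q.int_pow_mult)
    finally show ?case using car by blast
  qed
  then show ?thesis using s by (simp add: M.FactGroup_int_pow)
qed

lemma su_open_pow_comm:
  assumes S: "finite S" "S \<subseteq> carrier G" "generate G S = carrier G" and n: "n > 0"
  shows "su_open (pow_comm n)"
proof -
  let ?N = "pow_comm n"
  have N: "?N \<subseteq> carrier G" using pow_comm_subgroup by (rule subgroup.subset)
  have "su_open (generate G (?N \<union> (S' \<union> T))) \<longrightarrow> su_open (generate G (?N \<union> S'))"
    if "finite T" "S' \<subseteq> carrier G" "T \<subseteq> carrier G" for S' T
    using that
  proof (induction T arbitrary: S' rule: finite_induct)
    case (insert s T)
    define M where "M = generate G (?N \<union> (S' \<union> T))"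
    have sub: "?N \<union> (S' \<union> T) \<subseteq> carrier G" "s \<in> carrier G" using N insert.prems by auto
    have sM: "subgroup M G" unfolding M_def by (rule generate_is_subgroup[OF sub(1)])
    have NM: "?N \<subseteq> M" unfolding M_def by (auto intro: generate.incl)
    have Mn: "M \<lhd> G" by (rule normal_above_pow_comm[OF sM NM])
    let ?L = "generate G (?N \<union> (S' \<union> insert s T))"
    have sL: "subgroup ?L G" by (rule generate_is_subgroup) (use sub in auto)
    have "su_open M" if su_open: "su_open ?L"
    proof (rule su_open_cyclic_step[OF su_open Mn _ _ n])
      show "M \<subseteq> ?L" unfolding M_def using sub by (intro mono_generate) auto
      show "s \<in> ?L" by (rule generate.incl) simp
      show "s [^] n \<in> M" using pow_in_pow_comm[OF sub(2)] NM by blast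
      fix h assume "h \<in> ?L"
      moreover have "?L \<subseteq> generate G (insert s M)"
      proof (rule generate_subgroup_incl)
        have "?N \<union> (S' \<union> T) \<subseteq> M" unfolding M_def by (auto intro: generate.incl)
        then show "?N \<union> (S' \<union> insert s T) \<subseteq> generate G (insert s M)"
          by (auto intro: generate.incl)
        show "subgroup (generate G (insert s M)) G"
          by (rule generate_is_subgroup) (use sM sub subgroup.subset in auto)
      qed
      ultimately show "\<exists>i::int. M #> h = M #> s [^] i"
        using generate_insert_normal[OF Mn sub(2)] by blast
    qed
    then show ?case using insert.IH[of S'] insert.prems unfolding M_def by auto
  qed simp
  from this[of S "{}"] S have "su_open (generate G (?N \<union> S)) \<longrightarrow> su_open (generate G ?N)" by auto
  moreover have "generate G (?N \<union> S) = carrier G"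
    using mono_generate[of S "?N \<union> S"] S generate_incl[of "?N \<union> S"] N by auto
  moreover have "generate G ?N = ?N"
    using generate_subgroup_incl[OF order_refl pow_comm_subgroup] generate.incl by fast
  ultimately show ?thesis by (simp add: su_open.base)
qed

text \<open>
  A character of \<open>L\<close> modulo \<open>p\<close> that is trivial on \<open>K\<close> but not on \<open>L\<close>.
\<close>
definition nontrivial_char :: "nat \<Rightarrow> 'a set \<Rightarrow> 'a set \<Rightarrow> ('a \<Rightarrow> int) \<Rightarrow> bool" where
  "nontrivial_char p L K \<chi> \<longleftrightarrow> char_mod p L \<chi> \<and> (\<forall>k\<in>K. int p dvd \<chi> k) \<and> (\<exists>l\<in>L. \<not> int p dvd \<chi> l)"

text \<open>
  Conjugation by elements of \<open>M\<close> fixes the character \<open>\<chi>\<close> of \<open>L\<close>.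
\<close>
definition fixed_by :: "nat \<Rightarrow> 'a set \<Rightarrow> 'a set \<Rightarrow> ('a \<Rightarrow> int) \<Rightarrow> bool" where
  "fixed_by p L M \<chi> \<longleftrightarrow> (\<forall>m\<in>M. \<forall>l\<in>L. [\<chi> (conj_by m l) = \<chi> l] (mod int p))"

lemma char_mod_conj_by:
  assumes "char_mod p L \<chi>" "L \<lhd> G" "g \<in> carrier G"
  shows "char_mod p L (\<lambda>l. \<chi> (conj_by g l))"
proof -
  interpret L: normal L G by fact
  show ?thesis using assms conj_by_normal[OF assms(2,3)] by (simp add: char_mod_def conj_by_mult)
qed

lemma char_mod_sum:
  assumes "\<And>i. i \<in> I \<Longrightarrow> char_mod p L (\<chi> i)"
  shows "char_mod p L (\<lambda>l. \<Sum>i\<in>I. c i * \<chi> i l)"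
  unfolding char_mod_def
proof (intro ballI)
  fix a b assume ab: "a \<in> L" "b \<in> L"
  have "[(\<Sum>i\<in>I. c i * \<chi> i (a \<otimes> b)) = (\<Sum>i\<in>I. c i * (\<chi> i a + \<chi> i b))] (mod int p)"
    by (intro cong_sum cong_mult cong_refl char_modD[OF assms] ab)
  then show "[(\<Sum>i\<in>I. c i * \<chi> i (a \<otimes> b)) = (\<Sum>i\<in>I. c i * \<chi> i a) + (\<Sum>i\<in>I. c i * \<chi> i b)] (mod int p)"
    by (simp add: distrib_left sum.distrib)
qed

lemma char_mod_diff:
  assumes "char_mod p L \<chi>" "char_mod p L \<psi>"
  shows "char_mod p L (\<lambda>l. \<chi> l - \<psi> l)"
  unfolding char_mod_def
proof (intro ballI)
  fix a b assume ab: "a \<in> L" "b \<in> L"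
  have "[\<chi> (a \<otimes> b) - \<psi> (a \<otimes> b) = (\<chi> a + \<chi> b) - (\<psi> a + \<psi> b)] (mod int p)"
    by (intro cong_diff char_modD[OF assms(1)] char_modD[OF assms(2)] ab)
  then show "[\<chi> (a \<otimes> b) - \<psi> (a \<otimes> b) = \<chi> a - \<psi> a + (\<chi> b - \<psi> b)] (mod int p)"
    by (simp add: algebra_simps)
qed

text \<open>
  A group of order \<open>p\<close> has a nonzero fixed vector in every nonzero representation over
  the field with \<open>p\<close> elements: for a generator \<open>\<sigma>\<close> the operator \<open>\<sigma> - 1\<close> is nilpotent, and the last nonzero term among
  \<open>(\<sigma> - 1)\<^sup>j \<chi>\<close> is fixed.
\<close>
lemma fixed_char_step:
  assumes p: "prime p" and L: "L \<lhd> G" and K: "K \<lhd> G" and KL: "K \<subseteq> L"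
    and D: "subgroup D G" and \<xi>: "char_mod p D \<xi>"
    and \<chi>: "nontrivial_char p L K \<chi>" and fix_E: "fixed_by p L {a\<in>D. int p dvd \<xi> a} \<chi>"
  shows "\<exists>\<chi>'. nontrivial_char p L K \<chi>' \<and> fixed_by p L D \<chi>'"
proof (cases "\<forall>d\<in>D. int p dvd \<xi> d")
  case True
  then have "{a\<in>D. int p dvd \<xi> a} = D" by blast
  then show ?thesis using \<chi> fix_E by auto
next
  case False
  then obtain \<sigma> where \<sigma>: "\<sigma> \<in> D" "\<not> int p dvd \<xi> \<sigma>" by blast
  interpret D: subgroup D G by fact
  interpret L: normal L G by fact
  let ?E = "{a\<in>D. int p dvd \<xi> a}"
  have \<sigma>G: "\<sigma> \<in> carrier G" using \<sigma>(1) by simp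
  have \<sigma>L: "conj_by \<sigma> l \<in> L" if "l \<in> L" for l using conj_by_normal[OF L \<sigma>G that] .
  have \<sigma>K: "conj_by \<sigma> l \<in> K" if "l \<in> K" for l using conj_by_normal[OF K \<sigma>G that] .
  \<comment> \<open>\<open>a j\<close> is \<open>(\<sigma> - 1)\<^sup>j \<chi>\<close>\<close>
  define a where "a = rec_nat \<chi> (\<lambda>_ f l. f (conj_by \<sigma> l) - f l)"
  have a0: "a 0 l = \<chi> l" and aS: "a (Suc j) l = a j (conj_by \<sigma> l) - a j l" for j l
    by (simp_all add: a_def)
  have a_char: "char_mod p L (a j) \<and> (\<forall>k\<in>K. int p dvd a j k) \<and> fixed_by p L ?E (a j)" for j
  proof (induction j)
    case 0
    have "a 0 = \<chi>" using a0 by blast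
    then show ?case using \<chi> fix_E by (auto simp: nontrivial_char_def)
  next
    case (Suc j)
    have eq: "a (Suc j) = (\<lambda>l. a j (conj_by \<sigma> l) - a j l)" using aS by blast
    have "char_mod p L (a (Suc j))" unfolding eq
      using Suc by (intro char_mod_diff char_mod_conj_by L \<sigma>G) auto
    moreover have "\<forall>k\<in>K. int p dvd a (Suc j) k" using Suc \<sigma>K by (auto simp: aS)
    moreover have "fixed_by p L ?E (a (Suc j))"
      unfolding fixed_by_def
    proof (intro ballI)
      fix e l assume e: "e \<in> ?E" and l: "l \<in> L"
      have eD: "e \<in> D" "e \<in> carrier G" using e by auto
      define e' where "e' = conj_by \<sigma> e"
      have e'D: "e' \<in> D" using \<sigma> eD by (simp add: e'_def conj_by_def)
      have "[\<xi> (e' \<otimes> \<sigma>) = \<xi> e' + \<xi> \<sigma>] (mod int p)" by (rule char_modD[OF \<xi> e'D \<sigma>(1)])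
      moreover have "e' \<otimes> \<sigma> = \<sigma> \<otimes> e" using eD \<sigma>G by (simp add: e'_def conj_by_def group_normalize)
      moreover have "[\<xi> (\<sigma> \<otimes> e) = \<xi> \<sigma> + \<xi> e] (mod int p)" by (rule char_modD[OF \<xi> \<sigma>(1) eD(1)])
      ultimately have "[\<xi> \<sigma> + \<xi> e' = \<xi> \<sigma> + \<xi> e] (mod int p)" by (metis add.commute cong_sym cong_trans)
      then have "[\<xi> e' = \<xi> e] (mod int p)" by (simp only: cong_add_lcancel)
      then have e'E: "e' \<in> ?E" using e e'D by (simp add: cong_dvd_iff)
      have "conj_by \<sigma> (conj_by e l) = conj_by e' (conj_by \<sigma> l)"
        using \<sigma>G eD l by (simp add: e'_def conj_by_def group_normalize)
      moreover have "[a j (conj_by e' (conj_by \<sigma> l)) = a j (conj_by \<sigma> l)] (mod int p)"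
        using Suc e'E \<sigma>L[OF l] unfolding fixed_by_def by blast
      moreover have "[a j (conj_by e l) = a j l] (mod int p)"
        using Suc e l unfolding fixed_by_def by blast
      ultimately show "[a (Suc j) (conj_by e l) = a (Suc j) l] (mod int p)"
        unfolding aS by (simp add: cong_diff)
    qed
    ultimately show ?case by blast
  qed
  \<comment> \<open>Newton's formula for the powers of the conjugation by \<open>\<sigma>\<close>\<close>
  have newton: "\<chi> (conj_by (\<sigma> [^] n) l) = (\<Sum>j\<le>n. int (n choose j) * a j l)" if "l \<in> L" for n l
    using that
  proof (induction n arbitrary: l)
    case 0
    then show ?case by (simp add: a0 conj_by_one)
  next
    case (Suc n)
    have "\<chi> (conj_by (\<sigma> [^] Suc n) l) = \<chi> (conj_by (\<sigma> [^] n) (conj_by \<sigma> l))"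
      using Suc.prems \<sigma>G by (simp add: conj_by_conj_by)
    also have "\<dots> = (\<Sum>j\<le>n. int (n choose j) * a j (conj_by \<sigma> l))"
      by (rule Suc.IH[OF \<sigma>L[OF Suc.prems]])
    also have "\<dots> = (\<Sum>j\<le>n. int (n choose j) * (a (Suc j) l + a j l))" by (simp add: aS)
    also have "\<dots> = (\<Sum>j\<le>Suc n. int (Suc n choose j) * a j l)" by (rule newton_forward)
    finally show ?case .
  qed
  have \<sigma>p: "\<sigma> [^] p \<in> ?E"
    using char_mod_pow[OF \<xi> D \<sigma>(1), of p] subgroup_nat_pow_closed[OF D \<sigma>(1), of p]
    by (simp add: cong_dvd_iff)
  have ap: "int p dvd a p l" if l: "l \<in> L" for l
  proof -
    have p0: "p > 0" using p prime_gt_0_nat by blast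
    have "[\<chi> l = \<chi> (conj_by (\<sigma> [^] p) l)] (mod int p)"
      using fix_E \<sigma>p l unfolding fixed_by_def by (blast intro: cong_sym)
    also have "\<chi> (conj_by (\<sigma> [^] p) l) = (\<Sum>j\<le>p. int (p choose j) * a j l)" by (rule newton[OF l])
    also have "\<dots> = \<chi> l + (\<Sum>j\<in>{1..<p}. int (p choose j) * a j l) + a p l"
    proof -
      have "{..p} = insert 0 (insert p {1..<p})" using p0 by auto
      then show ?thesis using p0 by (simp add: a0)
    qed
    also have "[\<chi> l + (\<Sum>j\<in>{1..<p}. int (p choose j) * a j l) + a p l = \<chi> l + 0 + a p l] (mod int p)"
    proof (intro cong_add cong_refl)
      have "int p dvd (\<Sum>j\<in>{1..<p}. int (p choose j) * a j l)"
      proof (rule dvd_sum)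
        fix j assume "j \<in> {1..<p}"
        then have "p dvd p choose j" using p by (intro dvd_choose_prime) auto
        then show "int p dvd int (p choose j) * a j l" by simp
      qed
      then show "[(\<Sum>j\<in>{1..<p}. int (p choose j) * a j l) = 0] (mod int p)" by (simp add: cong_0_iff)
    qed
    finally have "[\<chi> l + 0 = \<chi> l + a p l] (mod int p)" by simp
    then have "[0 = a p l] (mod int p)" by (simp only: cong_add_lcancel)
    then show ?thesis by (meson cong_0_iff cong_sym)
  qed
  define n where "n = (LEAST n. \<forall>l\<in>L. int p dvd a n l)"
  have n: "\<forall>l\<in>L. int p dvd a n l"
    unfolding n_def by (rule LeastI[of _ p]) (use ap in blast)
  have "n \<noteq> 0"
  proof
    assume "n = 0"
    then show False using n \<chi> by (auto simp: a0 nontrivial_char_def)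
  qed
  then obtain m where m: "n = Suc m" by (cases n) auto
  have nz: "\<exists>l\<in>L. \<not> int p dvd a m l"
    using not_less_Least[of m "\<lambda>n. \<forall>l\<in>L. int p dvd a n l"] m n_def by auto
  have fix_\<sigma>: "[a m (conj_by (\<sigma> [^] (i::nat)) l) = a m l] (mod int p)" if "l \<in> L" for l i
    using that
  proof (induction i arbitrary: l)
    case 0
    then show ?case by (simp add: conj_by_one)
  next
    case (Suc i)
    have "conj_by (\<sigma> [^] Suc i) l = conj_by (\<sigma> [^] i) (conj_by \<sigma> l)" using Suc.prems \<sigma>G by (simp add: conj_by_conj_by)
    moreover have "[a m (conj_by (\<sigma> [^] i) (conj_by \<sigma> l)) = a m (conj_by \<sigma> l)] (mod int p)"
      by (rule Suc.IH[OF \<sigma>L[OF Suc.prems]])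
    moreover have "[a m (conj_by \<sigma> l) = a m l] (mod int p)"
      using n Suc.prems by (auto simp: m aS cong_iff_dvd_diff)
    ultimately show ?case by (metis cong_trans)
  qed
  have "fixed_by p L D (a m)"
    unfolding fixed_by_def
  proof (intro ballI)
    fix d l assume d: "d \<in> D" and l: "l \<in> L"
    obtain k where k: "d \<otimes> inv (\<sigma> [^] (k::nat)) \<in> ?E"
      using char_mod_generator[OF p \<xi> D \<sigma>] d by metis
    have sk: "\<sigma> [^] k \<in> D" by (rule subgroup_nat_pow_closed[OF D \<sigma>(1)])
    define e where "e = d \<otimes> inv (\<sigma> [^] k)"
    have eE: "e \<in> ?E" and eD: "e \<in> D" using k by (auto simp: e_def)
    have de: "d = e \<otimes> \<sigma> [^] k" using d sk by (simp add: e_def group_normalize)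
    have \<sigma>kG: "\<sigma> [^] k \<in> carrier G" using \<sigma>G by simp
    have "conj_by d l = conj_by e (conj_by (\<sigma> [^] k) l)" using eD l \<sigma>kG by (simp add: de conj_by_conj_by)
    moreover have "[a m (conj_by e (conj_by (\<sigma> [^] k) l)) = a m (conj_by (\<sigma> [^] k) l)] (mod int p)"
      using a_char[of m] eE conj_by_normal[OF L \<sigma>kG l] unfolding fixed_by_def by blast
    ultimately show "[a m (conj_by d l) = a m l] (mod int p)"
      using fix_\<sigma>[OF l] by (metis cong_trans)
  qed
  then show ?thesis using a_char[of m] nz unfolding nontrivial_char_def by blast
qed

lemma fixed_char_p_open:
  assumes p: "prime p" and L: "L \<lhd> G" and K: "K \<lhd> G" and KL: "K \<subseteq> L" and N: "subgroup N G"
    and M: "p_open p N M" and \<chi>: "nontrivial_char p L K \<chi>" "fixed_by p L M \<chi>"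
  shows "\<exists>\<chi>'. nontrivial_char p L K \<chi>' \<and> fixed_by p L N \<chi>'"
  using M \<chi>
proof (induction arbitrary: \<chi> rule: p_open.induct)
  case (step D \<xi>)
  then show ?case
    using fixed_char_step[OF p L K KL p_open_subgroup[OF step.hyps(1) N] step.hyps(2)] by blast
qed blast

text \<open>
  The character \<open>\<chi>\<close> is an eigenvector for conjugation by \<open>g\<close>.
\<close>
definition eigen :: "nat \<Rightarrow> 'a set \<Rightarrow> ('a \<Rightarrow> int) \<Rightarrow> 'a \<Rightarrow> bool" where
  "eigen p L \<chi> g \<longleftrightarrow> (\<exists>\<mu>::int. \<forall>l\<in>L. [\<chi> (conj_by g l) = \<mu> * \<chi> l] (mod int p))"

text \<open>
  The operator \<open>x\<close> acts on the characters fixed by \<open>pow_comm (p - 1)\<close> with \<open>x\<^sup>p\<^sup>-\<^sup>1 = 1\<close>.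
  The sum \<open>e k\<close> of all \<open>k\<^sup>i x\<^sup>i \<chi>\<close> with \<open>i < p - 1\<close> is therefore zero or an eigenvector, and the
  sum of \<open>e k\<close> over all nonzero residues \<open>k\<close> is \<open>- \<chi>\<close>, so some \<open>e k\<close> is not zero.
\<close>
lemma eigen_step:
  assumes p: "prime p" and L: "L \<lhd> G" and K: "K \<lhd> G" and KL: "K \<subseteq> L"
    and x: "x \<in> carrier G" and Y: "Y \<subseteq> carrier G"
    and \<chi>: "nontrivial_char p L K \<chi>" "fixed_by p L (pow_comm (p - 1)) \<chi>" "\<forall>y\<in>Y. eigen p L \<chi> y"
  shows "\<exists>\<chi>'. nontrivial_char p L K \<chi>' \<and> fixed_by p L (pow_comm (p - 1)) \<chi>' \<and> (\<forall>y\<in>insert x Y. eigen p L \<chi>' y)"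
proof -
  interpret L: normal L G by fact
  let ?N = "pow_comm (p - 1)"
  interpret N: normal ?N G by (rule pow_comm_normal)
  have p1: "p > 1" using prime_gt_1_nat[OF p] .
  define c where "c i l = \<chi> (conj_by (x [^] (i::nat)) l)" for i l
  define e where "e k l = (\<Sum>i<p - 1. int k ^ i * c i l)" for k :: nat and l
  have xi: "x [^] i \<in> carrier G" for i :: nat using x by simp
  have c_char: "char_mod p L (c i)" for i
    unfolding c_def using \<chi>(1) by (intro char_mod_conj_by L xi) (simp add: nontrivial_char_def)
  have c_N: "[c i (conj_by n l) = c i l] (mod int p)" if n: "n \<in> ?N" and l: "l \<in> L" for i n l
  proof -
    have n': "conj_by (x [^] i) n \<in> ?N" by (rule conj_by_normal[OF pow_comm_normal xi n])
    have "conj_by (x [^] i) (conj_by n l) = conj_by (conj_by (x [^] i) n) (conj_by (x [^] i) l)"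
      using xi[of i] n l by (simp add: conj_by_def group_normalize)
    then show ?thesis unfolding c_def
      using \<chi>(2) n' conj_by_normal[OF L xi l] unfolding fixed_by_def by metis
  qed
  have c_Y: "\<exists>\<mu>. \<forall>l\<in>L. \<forall>i. [c i (conj_by y l) = \<mu> * c i l] (mod int p)" if y: "y \<in> Y" for y
  proof -
    obtain \<mu> where \<mu>: "\<And>l. l \<in> L \<Longrightarrow> [\<chi> (conj_by y l) = \<mu> * \<chi> l] (mod int p)"
      using \<chi>(3) y unfolding eigen_def by blast
    have yG: "y \<in> carrier G" using y Y by blast
    have "[c i (conj_by y l) = \<mu> * c i l] (mod int p)" if l: "l \<in> L" for l i
    proof -
      define n where "n = x [^] i \<otimes> y \<otimes> inv (x [^] i) \<otimes> inv y"
      have n: "n \<in> ?N" unfolding n_def by (rule commutator_in_pow_comm[OF xi yG])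
      have "conj_by (x [^] i) (conj_by y l) = conj_by n (conj_by y (conj_by (x [^] i) l))"
        using xi[of i] yG l by (simp add: n_def conj_by_def group_normalize)
      moreover have "[\<chi> (conj_by n (conj_by y (conj_by (x [^] i) l))) = \<chi> (conj_by y (conj_by (x [^] i) l))] (mod int p)"
        using \<chi>(2) n conj_by_normal[OF L yG conj_by_normal[OF L xi l]] unfolding fixed_by_def by blast
      moreover have "[\<chi> (conj_by y (conj_by (x [^] i) l)) = \<mu> * \<chi> (conj_by (x [^] i) l)] (mod int p)"
        by (rule \<mu>[OF conj_by_normal[OF L xi l]])
      ultimately show ?thesis unfolding c_def by (metis cong_trans)
    qed
    then show ?thesis by blast
  qed
  have e_char: "char_mod p L (e k)" for k
    unfolding e_def by (rule char_mod_sum[OF c_char])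
  have e_K: "\<forall>l\<in>K. int p dvd e k l" for k
    unfolding e_def c_def using \<chi>(1) conj_by_normal[OF K xi] by (intro ballI dvd_sum dvd_mult) (auto simp: nontrivial_char_def)
  have e_N: "fixed_by p L ?N (e k)" for k
    unfolding fixed_by_def e_def by (intro ballI cong_sum cong_mult cong_refl c_N)
  have e_Y: "eigen p L (e k) y" if y: "y \<in> Y" for k y
  proof -
    obtain \<mu> where \<mu>: "\<And>l i. l \<in> L \<Longrightarrow> [c i (conj_by y l) = \<mu> * c i l] (mod int p)"
      using c_Y[OF y] by blast
    have "[e k (conj_by y l) = \<mu> * e k l] (mod int p)" if l: "l \<in> L" for l
    proof -
      have "[e k (conj_by y l) = (\<Sum>i<p - 1. int k ^ i * (\<mu> * c i l))] (mod int p)"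
        unfolding e_def by (intro cong_sum cong_mult cong_refl \<mu> l)
      then show ?thesis unfolding e_def by (simp add: sum_distrib_left ac_simps)
    qed
    then show ?thesis unfolding eigen_def by blast
  qed
  have e_x: "eigen p L (e k) x" if k: "k \<in> {1..<p}" for k
  proof -
    have "\<not> p dvd k" using k by (auto dest: dvd_imp_le)
    then have "coprime (int k) (int p)"
      using p by (metis coprime_commute coprime_int_iff prime_imp_coprime_nat)
    then obtain u where u: "[int k * u = 1] (mod int p)" using cong_solve_coprime_int by blast
    have fermat: "[int k ^ (p - 1) = 1] (mod int p)"
      using fermat_theorem[OF p \<open>\<not> p dvd k\<close>] by (metis cong_int_iff of_nat_1 of_nat_power)
    have "[e k (conj_by x l) = u * e k l] (mod int p)" if l: "l \<in> L" for l
    proof -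
      have "c i (conj_by x l) = c (Suc i) l" for i
        unfolding c_def using x l xi by (simp add: conj_by_conj_by)
      then have "int k * e k (conj_by x l) = (\<Sum>i<p - 1. int k ^ Suc i * c (Suc i) l)"
        unfolding e_def by (simp add: sum_distrib_left ac_simps)
      also have "\<dots> + c 0 l = (\<Sum>i<Suc (p - 1). int k ^ i * c i l)"
        by (subst sum.lessThan_Suc_shift) simp
      also have "\<dots> = e k l + int k ^ (p - 1) * c (p - 1) l" by (simp add: e_def)
      also have "[\<dots> = e k l + 1 * c 0 l] (mod int p)"
      proof (intro cong_add cong_refl cong_mult fermat)
        have "[c (p - 1) l = \<chi> l] (mod int p)" unfolding c_def
          using \<chi>(2) pow_in_pow_comm[OF x, of "p - 1"] l unfolding fixed_by_def by blast
        then show "[c (p - 1) l = c 0 l] (mod int p)" using l by (simp add: c_def conj_by_one)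
      qed
      finally have ke: "[int k * e k (conj_by x l) = e k l] (mod int p)"
        by (simp add: cong_add_rcancel)
      have "[1 * e k (conj_by x l) = int k * u * e k (conj_by x l)] (mod int p)"
        by (intro cong_mult cong_refl cong_sym[OF u])
      also have "int k * u * e k (conj_by x l) = u * (int k * e k (conj_by x l))" by simp
      also have "[u * (int k * e k (conj_by x l)) = u * e k l] (mod int p)"
        by (intro cong_mult cong_refl ke)
      finally show ?thesis by simp
    qed
    then show ?thesis unfolding eigen_def by blast
  qed
  have "\<exists>k\<in>{1..<p}. \<exists>l\<in>L. \<not> int p dvd e k l"
  proof (rule ccontr)
    assume "\<not> ?thesis"
    then have all: "int p dvd e k l" if "k \<in> {1..<p}" "l \<in> L" for k l using that by blast
    obtain l where l: "l \<in> L" "\<not> int p dvd \<chi> l" using \<chi>(1) by (auto simp: nontrivial_char_def)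
    have "[0 = (\<Sum>k\<in>{1..<p}. e k l)] (mod int p)"
      using dvd_sum[of "{1..<p}" "int p" "\<lambda>k. e k l"] all l by (metis cong_0_iff cong_sym)
    also have "(\<Sum>k\<in>{1..<p}. e k l) = (\<Sum>i<p - 1. (\<Sum>k\<in>{1..<p}. int k ^ i) * c i l)"
      unfolding e_def by (subst sum.swap) (simp add: sum_distrib_right)
    also have "[\<dots> = (\<Sum>i<p - 1. (if i = 0 then - 1 else 0) * c i l)] (mod int p)"
    proof (intro cong_sum cong_mult cong_refl)
      fix i assume i: "i \<in> {..<p - 1}"
      show "[(\<Sum>k\<in>{1..<p}. int k ^ i) = (if i = 0 then - 1 else 0)] (mod int p)"
      proof (cases "i = 0")
        case True
        then show ?thesis using p1 by (simp add: cong_iff_dvd_diff of_nat_diff)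
      next
        case False
        then show ?thesis using prime_power_sum_cong_0[OF p, of i] i by simp
      qed
    qed
    also have "(\<Sum>i<p - 1. (if i = 0 then - 1 else 0) * c i l) = (\<Sum>i<p - 1. if i = 0 then - c i l else 0)"
      by (intro sum.cong) auto
    also have "\<dots> = - c 0 l" using p1 by (simp add: sum.delta)
    finally have "[0 = - \<chi> l] (mod int p)" using l by (simp add: c_def conj_by_one)
    then have "int p dvd - \<chi> l" by (meson cong_0_iff cong_sym)
    then show False using l(2) by simp
  qed
  then obtain k where k: "k \<in> {1..<p}" "\<exists>l\<in>L. \<not> int p dvd e k l" by blast
  show ?thesis
    by (intro exI[of _ "e k"] conjI) (use k e_char e_K e_N e_Y e_x in \<open>auto simp: nontrivial_char_def\<close>)
qed

lemma eigen_exists: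
  assumes p: "prime p" and L: "L \<lhd> G" and K: "K \<lhd> G" and KL: "K \<subseteq> L"
    and S: "finite S" "S \<subseteq> carrier G"
    and \<chi>: "nontrivial_char p L K \<chi>" "fixed_by p L (pow_comm (p - 1)) \<chi>"
  shows "\<exists>\<chi>'. nontrivial_char p L K \<chi>' \<and> (\<forall>y\<in>S. eigen p L \<chi>' y)"
proof -
  have "\<exists>\<chi>'. nontrivial_char p L K \<chi>' \<and> fixed_by p L (pow_comm (p - 1)) \<chi>' \<and> (\<forall>y\<in>S. eigen p L \<chi>' y)"
    using S
  proof (induction S rule: finite_induct)
    case empty
    then show ?case using \<chi> by auto
  next
    case (insert x Y)
    then show ?case using eigen_step[OF p L K KL, of x Y] by auto
  qed
  then show ?thesis by blast
qed

lemma eigen_generate: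
  assumes p: "prime p" and L: "L \<lhd> G" and \<chi>: "nontrivial_char p L K \<chi>"
    and S: "S \<subseteq> carrier G" "\<forall>y\<in>S. eigen p L \<chi> y" and g: "g \<in> generate G S"
  shows "eigen p L \<chi> g"
proof -
  interpret L: normal L G by fact
  show ?thesis using g
  proof (induction rule: generate.induct)
    case one
    show ?case unfolding eigen_def by (rule exI[of _ 1]) (auto simp: conj_by_one)
  next
    case (incl h)
    then show ?case using S by blast
  next
    case (inv h)
    have h: "h \<in> carrier G" using inv S by blast
    obtain \<mu> where \<mu>: "\<And>l. l \<in> L \<Longrightarrow> [\<chi> (conj_by h l) = \<mu> * \<chi> l] (mod int p)"
      using S(2) inv unfolding eigen_def by blast
    have \<mu>': "[\<chi> l = \<mu> * \<chi> (conj_by (inv h) l)] (mod int p)" if l: "l \<in> L" for l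
      using \<mu>[OF conj_by_normal[OF L inv_closed[OF h] l]] h l by (simp add: conj_by_conj_by conj_by_one)
    obtain l where l: "l \<in> L" "\<not> int p dvd \<chi> l" using \<chi> by (auto simp: nontrivial_char_def)
    have "\<not> int p dvd \<mu>" using \<mu>'[OF l(1)] l(2) by (auto simp: cong_dvd_iff)
    then have "coprime \<mu> (int p)"
      using p prime_imp_coprime[of "int p" \<mu>] by (simp add: coprime_commute)
    then obtain u where u: "[\<mu> * u = 1] (mod int p)" using cong_solve_coprime_int by blast
    have "[\<chi> (conj_by (inv h) l) = u * \<chi> l] (mod int p)" if l: "l \<in> L" for l
    proof -
      have "[1 * \<chi> (conj_by (inv h) l) = \<mu> * u * \<chi> (conj_by (inv h) l)] (mod int p)"
        by (intro cong_mult cong_refl cong_sym[OF u])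
      also have "\<mu> * u * \<chi> (conj_by (inv h) l) = u * (\<mu> * \<chi> (conj_by (inv h) l))" by simp
      also have "[\<dots> = u * \<chi> l] (mod int p)" by (intro cong_mult cong_refl cong_sym[OF \<mu>'[OF l]])
      finally show ?thesis by simp
    qed
    then show ?case unfolding eigen_def by blast
  next
    case (eng g h)
    have gh: "g \<in> carrier G" "h \<in> carrier G" using eng.hyps S(1) generate_in_carrier by auto
    obtain \<mu> \<nu> where \<mu>: "\<And>l. l \<in> L \<Longrightarrow> [\<chi> (conj_by g l) = \<mu> * \<chi> l] (mod int p)"
      and \<nu>: "\<And>l. l \<in> L \<Longrightarrow> [\<chi> (conj_by h l) = \<nu> * \<chi> l] (mod int p)"
      using eng.IH unfolding eigen_def by blast
    have "[\<chi> (conj_by (g \<otimes> h) l) = \<mu> * \<nu> * \<chi> l] (mod int p)" if l: "l \<in> L" for l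
    proof -
      have "[\<chi> (conj_by g (conj_by h l)) = \<mu> * \<chi> (conj_by h l)] (mod int p)"
        by (rule \<mu>[OF conj_by_normal[OF L gh(2) l]])
      also have "[\<mu> * \<chi> (conj_by h l) = \<mu> * (\<nu> * \<chi> l)] (mod int p)"
        by (intro cong_mult cong_refl \<nu> l)
      finally show ?thesis using gh l by (simp add: conj_by_conj_by mult.assoc)
    qed
    then show ?case unfolding eigen_def by blast
  qed
qed

lemma nontrivial_char_exists:
  assumes "p_open p N K'" "K \<subseteq> K'" "L \<subseteq> N" "\<not> L \<subseteq> K'"
  shows "\<exists>\<chi>. nontrivial_char p L K \<chi>"
  using assms
proof (induction rule: p_open.induct)
  case (step D \<xi>)
  show ?case
  proof (cases "L \<subseteq> D")
    case True
    then have "nontrivial_char p L K \<xi>"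
      using step.prems char_mod_mono[OF step.hyps(2) True] by (auto simp: nontrivial_char_def)
    then show ?thesis by blast
  next
    case False
    then show ?thesis using step.IH step.prems by auto
  qed
qed simp

text \<open>
  Starting with \<open>L = pow_comm (p - 1)\<close>, as long as \<open>L\<close> is larger than \<open>K\<close> there is a character
  of \<open>L/K\<close> that is an eigenvector for the whole group.  Its kernel is normal and replaces \<open>L\<close>.
\<close>
lemma p_open_normal_imp_su_open:
  assumes p: "prime p" and K: "K \<lhd> G" and po: "p_open p (pow_comm (p - 1)) K"
    and S: "finite S" "S \<subseteq> carrier G" "generate G S = carrier G"
  shows "su_open K"
proof -
  interpret K: normal K G by fact
  let ?N = "pow_comm (p - 1)"
  have p1: "p > 1" using prime_gt_1_nat[OF p] .
  have su_openN: "su_open ?N" using su_open_pow_comm[OF S, of "p - 1"] p1 by simp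
  have "fin_index K"
    by (rule fin_index_p_open[OF po pow_comm_subgroup su_open_fin_index[OF su_openN]]) (use p1 in simp)
  then have fin: "finite ((#>) K ` carrier G)"
    using finite_factor[OF K] by (simp add: carrier_FactGroup)
  have "su_open K" if "su_open L" "p_open p ?N L" "K \<subseteq> L" for L
    using that
  proof (induction "card ((#>) K ` L)" arbitrary: L rule: less_induct)
    case less
    show ?case
    proof (cases "L \<subseteq> K")
      case True
      then show ?thesis using less.prems by (metis subset_antisym)
    next
      case False
      have L: "L \<lhd> G" by (rule su_open_normal[OF less.prems(1)])
      interpret L: normal L G by fact
      obtain \<chi>0 where \<chi>0: "nontrivial_char p L K \<chi>0"
        using nontrivial_char_exists[OF po order_refl p_open_subset[OF less.prems(2)] False] by blast
      have "fixed_by p L L \<chi>0"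
        unfolding fixed_by_def
      proof (intro ballI)
        fix m l assume ml: "m \<in> L" "l \<in> L"
        have ch: "char_mod p L \<chi>0" using \<chi>0 by (simp add: nontrivial_char_def)
        have "[\<chi>0 (m \<otimes> l \<otimes> inv m) = \<chi>0 (m \<otimes> l) + \<chi>0 (inv m)] (mod int p)"
          using ml by (intro char_modD[OF ch]) auto
        also have "[\<chi>0 (m \<otimes> l) + \<chi>0 (inv m) = (\<chi>0 m + \<chi>0 l) + (- \<chi>0 m)] (mod int p)"
          by (intro cong_add char_modD[OF ch] char_mod_inv[OF ch L.is_subgroup] ml)
        finally show "[\<chi>0 (conj_by m l) = \<chi>0 l] (mod int p)" by (simp add: conj_by_def)
      qed
      from fixed_char_p_open[OF p L K less.prems(3) pow_comm_subgroup less.prems(2) \<chi>0 this]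
      obtain \<chi>1 where "nontrivial_char p L K \<chi>1" "fixed_by p L ?N \<chi>1" by blast
      from eigen_exists[OF p L K less.prems(3) S(1,2) this]
      obtain \<chi> where \<chi>: "nontrivial_char p L K \<chi>" "\<forall>y\<in>S. eigen p L \<chi> y" by blast
      have eig: "eigen p L \<chi> g" if "g \<in> carrier G" for g
        using eigen_generate[OF p L \<chi>(1) S(2) \<chi>(2)] that S(3) by blast
      have ch: "char_mod p L \<chi>" using \<chi>(1) by (simp add: nontrivial_char_def)
      define L1 where "L1 = {a\<in>L. int p dvd \<chi> a}"
      have sL1: "subgroup L1 G" unfolding L1_def by (rule subgroup_ker_mod[OF ch L.is_subgroup])
      have L1n: "L1 \<lhd> G"
      proof (rule normal_conj_byI[OF sL1])
        fix g x assume g: "g \<in> carrier G" and x: "x \<in> L1"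
        then obtain \<mu> where "[\<chi> (conj_by g x) = \<mu> * \<chi> x] (mod int p)"
          using eig[OF g] unfolding eigen_def L1_def by blast
        then show "conj_by g x \<in> L1" using x conj_by_normal[OF L g] by (auto simp: L1_def cong_dvd_iff)
      qed
      have sub: "K \<subseteq> L1" "L1 \<subset> L"
        using \<chi>(1) less.prems(3) by (auto simp: L1_def nontrivial_char_def)
      have "(#>) K ` L1 \<subset> (#>) K ` L"
      proof -
        obtain l where l: "l \<in> L" "l \<notin> L1" using sub(2) by blast
        have "K #> l \<notin> (#>) K ` L1"
        proof
          assume "K #> l \<in> (#>) K ` L1"
          then obtain m where m: "m \<in> L1" "K #> l = K #> m" by blast
          have mG: "m \<in> carrier G" using m(1) sL1 subgroup.mem_carrier by fast
          have "l \<otimes> inv m \<in> L1"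
            using rcos_eq_iff[OF K.is_subgroup, of l m] l(1) mG m(2) sub(1) by auto
          then have "l \<otimes> inv m \<otimes> m \<in> L1" using m(1) sL1 by (simp add: subgroup.m_closed)
          then show False using l mG by (simp add: group_normalize)
        qed
        then show ?thesis using sub(2) l(1) by blast
      qed
      moreover have "finite ((#>) K ` L)"
        by (rule finite_subset[OF image_mono[OF L.subset] fin])
      ultimately have "card ((#>) K ` L1) < card ((#>) K ` L)" by (simp add: psubset_card_mono)
      moreover have "su_open L1" unfolding L1_def
        using less.prems(1) p ch L1n by (intro su_open.step) (auto simp: L1_def)
      moreover have "p_open p ?N L1" unfolding L1_def by (rule p_open.step[OF less.prems(2) ch])
      ultimately show ?thesis using less.hyps sub(1) by blast
    qed
  qed
  from this[OF su_openN p_open.base p_open_subset[OF po]] show ?thesis .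
qed

end

section \<open>Normal p-complements in supersolvable quotients\<close>

lemma card_image_same_kernel:
  assumes "\<And>a b. a \<in> A \<Longrightarrow> b \<in> A \<Longrightarrow> f a = f b \<longleftrightarrow> g a = g b"
  shows "card (f ` A) = card (g ` A)"
proof (rule bij_betw_same_card)
  show "bij_betw (\<lambda>y. g (inv_into A f y)) (f ` A) (g ` A)"
  proof (rule bij_betwI')
    fix x y assume "x \<in> f ` A" "y \<in> f ` A"
    then show "(g (inv_into A f x) = g (inv_into A f y)) = (x = y)"
      using assms by (metis f_inv_into_f inv_into_into)
  next
    fix x assume "x \<in> f ` A"
    then show "g (inv_into A f x) \<in> g ` A" by (simp add: inv_into_into)
  next
    fix y assume "y \<in> g ` A"
    then obtain a where "a \<in> A" "y = g a" by blast
    then show "\<exists>x\<in>f ` A. y = g (inv_into A f x)"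
      using assms by (metis f_inv_into_f image_eqI inv_into_into)
  qed
qed

context group
begin

lemma card_cosets_mult:
  assumes A: "subgroup A G" and B: "subgroup B G" and AB: "A \<subseteq> B" and fin: "finite B"
  shows "card ((#>) A ` B) * card A = card B"
proof -
  interpret B: group "G\<lparr>carrier := B\<rparr>" by (rule subgroup_imp_group[OF B])
  have "subgroup A (G\<lparr>carrier := B\<rparr>)" by (rule subgroup_incl[OF A B AB])
  moreover have "rcosets\<^bsub>G\<lparr>carrier := B\<rparr>\<^esub> A = (#>) A ` B" by (auto simp: RCOSETS_def)
  ultimately show ?thesis using B.lagrange[of A] by (simp add: order_def)
qed

lemma card_coset_image_dvd:
  assumes L: "L \<lhd> G" and S: "subgroup S G" and T: "subgroup T G" and ST: "S \<subseteq> T"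
    and fin: "finite ((#>) L ` T)"
  shows "card ((#>) L ` S) dvd card ((#>) L ` T)"
proof -
  interpret L: normal L G by fact
  interpret Q: group "G Mod L" by (rule L.factorgroup_is_group)
  interpret \<pi>: group_hom G "G Mod L" "(#>) L"
    using L.r_coset_hom_Mod by unfold_locales
  show ?thesis
    using Q.card_cosets_mult[OF \<pi>.subgroup_img_is_subgroup[OF S] \<pi>.subgroup_img_is_subgroup[OF T]
        image_mono[OF ST] fin] by (metis dvd_triv_right)
qed

text \<open>
  The order of the image of \<open>T\<close> in the quotient by \<open>K\<close>, computed through the quotient by \<open>L\<close>.
\<close>
lemma card_coset_image_mult:
  assumes K: "K \<lhd> G" and L: "L \<lhd> G" and KL: "K \<subseteq> L" and T: "subgroup T G"
  shows "card ((#>) K ` T) = card ((#>) L ` T) * card ((#>) K ` (T \<inter> L))"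
proof -
  interpret K: normal K G by fact
  interpret L: normal L G by fact
  interpret T: subgroup T G by fact
  define r where "r c = (SOME t. t \<in> T \<and> L #> t = c)" for c
  have r: "r c \<in> T \<and> L #> r c = c" if "c \<in> (#>) L ` T" for c
    unfolding r_def by (rule someI_ex) (use that in auto)
  have Keq: "K #> a = K #> b \<longleftrightarrow> a \<otimes> inv b \<in> K" if "a \<in> T" "b \<in> T" for a b
    using rcos_eq_iff[OF K.is_subgroup, of a b] that by auto
  have Leq: "L #> a = L #> b \<longleftrightarrow> a \<otimes> inv b \<in> L" if "a \<in> T" "b \<in> T" for a b
    using rcos_eq_iff[OF L.is_subgroup, of a b] that by auto
  define f where "f = (\<lambda>(c, d). d #> r c)"
  have f: "f (c, K #> u) = K #> (u \<otimes> r c)" if "c \<in> (#>) L ` T" "u \<in> T" for c u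
    using r[OF that(1)] that by (simp add: f_def coset_mult_assoc K.subset)
  have "bij_betw f ((#>) L ` T \<times> (#>) K ` (T \<inter> L)) ((#>) K ` T)"
  proof (rule bij_betw_imageI)
    show "inj_on f ((#>) L ` T \<times> (#>) K ` (T \<inter> L))"
    proof (rule inj_onI)
      fix x y assume "x \<in> (#>) L ` T \<times> (#>) K ` (T \<inter> L)" "y \<in> (#>) L ` T \<times> (#>) K ` (T \<inter> L)"
        and eq: "f x = f y"
      then obtain c u d v where xy: "x = (c, K #> u)" "y = (d, K #> v)"
        and c: "c \<in> (#>) L ` T" "d \<in> (#>) L ` T" and uv: "u \<in> T" "u \<in> L" "v \<in> T" "v \<in> L"
        by (elim SigmaE imageE) auto
      note rc = r[OF c(1)] r[OF c(2)]
      have car: "u \<in> carrier G" "v \<in> carrier G" "r c \<in> carrier G" "r d \<in> carrier G"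
        using uv rc by auto
      have "K #> (u \<otimes> r c) = K #> (v \<otimes> r d)" using eq f c uv by (simp add: xy)
      then have k: "u \<otimes> r c \<otimes> inv (v \<otimes> r d) \<in> K" using uv rc by (subst (asm) Keq) auto
      then have "inv u \<otimes> (u \<otimes> r c \<otimes> inv (v \<otimes> r d)) \<otimes> v \<in> L" using uv KL by blast
      moreover have "inv u \<otimes> (u \<otimes> r c \<otimes> inv (v \<otimes> r d)) \<otimes> v = r c \<otimes> inv (r d) \<otimes> inv v \<otimes> v"
        using car by (simp add: group_normalize)
      ultimately have "r c \<otimes> inv (r d) \<in> L" using car by (simp add: group_normalize)
      then have cd: "c = d" using Leq[of "r c" "r d"] rc by simp
      have "u \<otimes> r c \<otimes> inv (v \<otimes> r d) = u \<otimes> inv v" using car cd by (simp add: group_normalize)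
      then have "K #> u = K #> v" using k Keq[of u v] uv by simp
      then show "x = y" by (simp add: xy cd)
    qed
    show "f ` ((#>) L ` T \<times> (#>) K ` (T \<inter> L)) = (#>) K ` T"
    proof (intro equalityI subsetI)
      fix y assume "y \<in> f ` ((#>) L ` T \<times> (#>) K ` (T \<inter> L))"
      then obtain c u where y: "y = f (c, K #> u)" "c \<in> (#>) L ` T" "u \<in> T"
        by (elim imageE SigmaE) auto
      then show "y \<in> (#>) K ` T" using f r[OF y(2)] by auto
    next
      fix y assume "y \<in> (#>) K ` T"
      then obtain t where t: "t \<in> T" "y = K #> t" by blast
      define c where "c = L #> t"
      have c: "c \<in> (#>) L ` T" using t by (simp add: c_def)
      define u where "u = t \<otimes> inv (r c)"
      have u: "u \<in> T" "u \<in> L" "t = u \<otimes> r c"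
        using r[OF c] t Leq[of t "r c"] by (auto simp: u_def c_def group_normalize)
      have "y = f (c, K #> u)" using f[OF c u(1)] u(3) t by simp
      then show "y \<in> f ` ((#>) L ` T \<times> (#>) K ` (T \<inter> L))" using c u by blast
    qed
  qed
  then show ?thesis by (simp add: bij_betw_same_card[symmetric] card_cartesian_product)
qed

lemma card_coset_image_char_mod:
  assumes q: "prime q" and M: "subgroup M G" and \<xi>: "char_mod q M \<xi>" and K: "subgroup K G"
    and KM: "K \<inter> M = {a\<in>M. int q dvd \<xi> a}"
  shows "card ((#>) K ` M) \<in> {1, q}"
proof -
  interpret M: subgroup M G by fact
  have q0: "q > 0" using prime_gt_0_nat[OF q] .
  have eq: "K #> a = K #> b \<longleftrightarrow> \<xi> a mod int q = \<xi> b mod int q" if ab: "a \<in> M" "b \<in> M" for a b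
  proof -
    have "K #> a = K #> b \<longleftrightarrow> a \<otimes> inv b \<in> K" using rcos_eq_iff[OF K, of a b] ab by simp
    also have "\<dots> \<longleftrightarrow> a \<otimes> inv b \<in> K \<inter> M" using ab by simp
    also have "\<dots> \<longleftrightarrow> int q dvd \<xi> (a \<otimes> inv b)" unfolding KM using ab by simp
    also have "[\<xi> (a \<otimes> inv b) = \<xi> a + (- \<xi> b)] (mod int q)"
      using char_modD[OF \<xi>, of a "inv b"] char_mod_inv[OF \<xi> M ab(2)] ab
      by (meson M.m_inv_closed cong_add cong_refl cong_trans)
    then have "int q dvd \<xi> (a \<otimes> inv b) \<longleftrightarrow> int q dvd \<xi> a - \<xi> b" by (simp add: cong_dvd_iff)
    also have "\<dots> \<longleftrightarrow> \<xi> a mod int q = \<xi> b mod int q" by (simp add: mod_eq_dvd_iff)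
    finally show ?thesis .
  qed
  have card: "card ((#>) K ` M) = card ((\<lambda>a. \<xi> a mod int q) ` M)"
    by (rule card_image_same_kernel) (rule eq)
  show ?thesis
  proof (cases "\<forall>a\<in>M. int q dvd \<xi> a")
    case True
    then have "(\<lambda>a. \<xi> a mod int q) ` M = (\<lambda>a. 0) ` M" by (intro image_cong) auto
    also have "\<dots> = {0}" using M.one_closed by blast
    finally have "(\<lambda>a. \<xi> a mod int q) ` M = {0}" .
    then show ?thesis using card by simp
  next
    case False
    then obtain a where a: "a \<in> M" "\<not> int q dvd \<xi> a" by blast
    have "coprime (\<xi> a) (int q)"
      using a(2) q prime_imp_coprime[of "int q" "\<xi> a"] by (simp add: coprime_commute)
    then obtain u where u: "[\<xi> a * u = 1] (mod int q)" using cong_solve_coprime_int by blast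
    have "(\<lambda>a. \<xi> a mod int q) ` M = {0..<int q}"
    proof (intro equalityI subsetI)
      fix i assume i: "i \<in> {0..<int q}"
      define k where "k = nat ((u * i) mod int q)"
      have kk: "[int k = u * i] (mod int q)" using q0 by (simp add: k_def)
      have "[\<xi> (a [^] k) = int k * \<xi> a] (mod int q)" by (rule char_mod_pow[OF \<xi> M a(1)])
      also have "[int k * \<xi> a = u * i * \<xi> a] (mod int q)" by (intro cong_mult cong_refl kk)
      also have "u * i * \<xi> a = (\<xi> a * u) * i" by simp
      also have "[(\<xi> a * u) * i = 1 * i] (mod int q)" by (intro cong_mult cong_refl u)
      finally have "\<xi> (a [^] k) mod int q = i" using i by (simp add: cong_def)
      then show "i \<in> (\<lambda>a. \<xi> a mod int q) ` M"
        using subgroup_nat_pow_closed[OF M a(1), of k] by force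
    qed (use q0 in auto)
    then show ?thesis using card by simp
  qed
qed

text \<open>
  The transfer of \<open>T\<close> into the section \<open>Z/ker \<xi>\<close>, which is central in \<open>T\<close> modulo \<open>ker \<xi>\<close>.  On
  \<open>Z\<close> it is \<open>\<xi>\<close> times the index of \<open>Z\<close> in \<open>T\<close>, which is prime to \<open>p\<close>, so \<open>\<tau>\<close> and \<open>\<xi>\<close> have the
  same kernel on \<open>Z\<close>.  The last clause describes the kernel of \<open>\<tau>\<close> without reference to the
  chosen coset representatives.
\<close>
lemma transfer:
  assumes p: "prime p" and Z: "Z \<lhd> G" and T: "subgroup T G" and ZT: "Z \<subseteq> T"
    and \<xi>: "char_mod p Z \<xi>" and inv_\<xi>: "\<And>t z. t \<in> T \<Longrightarrow> z \<in> Z \<Longrightarrow> [\<xi> (conj_by t z) = \<xi> z] (mod int p)"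
    and fin: "finite ((#>) Z ` T)" and cop: "\<not> p dvd card ((#>) Z ` T)"
  shows "\<exists>\<tau>. char_mod p T \<tau> \<and>
    (\<forall>z\<in>Z. int p dvd \<tau> z \<longleftrightarrow> int p dvd \<xi> z) \<and>
    (\<forall>t\<in>T. int p dvd \<tau> t \<longleftrightarrow> t [^] card ((#>) Z ` T) \<in> {z\<in>Z. int p dvd \<xi> z})"
proof -
  interpret Z: normal Z G by fact
  interpret T: subgroup T G by fact
  define C where "C = (#>) Z ` T"
  define m where "m = card C"
  define s where "s c = (SOME t. t \<in> T \<and> Z #> t = c)" for c
  have s: "s c \<in> T" "Z #> s c = c" if "c \<in> C" for c
  proof -
    have "s c \<in> T \<and> Z #> s c = c"
      unfolding s_def by (rule someI_ex) (use that in \<open>auto simp: C_def\<close>)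
    then show "s c \<in> T" "Z #> s c = c" by auto
  qed
  have sG: "s c \<in> carrier G" if "c \<in> C" for c using s(1)[OF that] by simp
  have Zeq: "Z #> a = Z #> b \<longleftrightarrow> a \<otimes> inv b \<in> Z" if "a \<in> T" "b \<in> T" for a b
    using rcos_eq_iff[OF Z.is_subgroup, of a b] that by auto
  have act: "c #> t \<in> C" if c: "c \<in> C" and t: "t \<in> T" for c t
  proof -
    have "c #> t = Z #> (s c \<otimes> t)" using s[OF c] t coset_mult_assoc[OF Z.subset, of "s c" t] by simp
    then show ?thesis using s[OF c] t by (auto simp: C_def)
  qed
  have CG: "c \<subseteq> carrier G" if "c \<in> C" for c
    using s(2)[OF that] r_coset_subset_G[OF Z.subset sG[OF that]] by simp
  define w where "w c t = s c \<otimes> t \<otimes> inv (s (c #> t))" for c t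
  have w: "w c t \<in> Z" if c: "c \<in> C" and t: "t \<in> T" for c t
  proof -
    have "Z #> (s c \<otimes> t) = c #> t" using s[OF c] t coset_mult_assoc[OF Z.subset, of "s c" t] by simp
    also have "\<dots> = Z #> s (c #> t)" using s[OF act[OF c t]] by simp
    finally show ?thesis unfolding w_def
      using Zeq[of "s c \<otimes> t" "s (c #> t)"] s[OF c] s[OF act[OF c t]] t by simp
  qed
  define \<tau> where "\<tau> t = (\<Sum>c\<in>C. \<xi> (w c t))" for t
  have \<tau>: "char_mod p T \<tau>"
    unfolding char_mod_def
  proof (intro ballI)
    fix a b assume a: "a \<in> T" and b: "b \<in> T"
    have "[\<tau> (a \<otimes> b) = (\<Sum>c\<in>C. \<xi> (w c a) + \<xi> (w (c #> a) b))] (mod int p)"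
      unfolding \<tau>_def
    proof (rule cong_sum)
      fix c assume c: "c \<in> C"
      have "w c (a \<otimes> b) = w c a \<otimes> w (c #> a) b"
        using a b sG[OF c] sG[OF act[OF c a]] sG[OF act[OF act[OF c a] b]] sG[OF act[OF c, of "a \<otimes> b"]]
          coset_mult_assoc[OF CG[OF c], of a b]
        by (simp add: w_def group_normalize)
      then show "[\<xi> (w c (a \<otimes> b)) = \<xi> (w c a) + \<xi> (w (c #> a) b)] (mod int p)"
        using char_modD[OF \<xi> w[OF c a] w[OF act[OF c a] b]] by simp
    qed
    also have "(\<Sum>c\<in>C. \<xi> (w c a) + \<xi> (w (c #> a) b)) = \<tau> a + (\<Sum>c\<in>C. \<xi> (w (c #> a) b))"
      by (simp add: \<tau>_def sum.distrib)
    also have "(\<Sum>c\<in>C. \<xi> (w (c #> a) b)) = \<tau> b"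
      unfolding \<tau>_def
    proof (rule sum.reindex_bij_witness[of _ "\<lambda>c. c #> inv a" "\<lambda>c. c #> a"])
      fix c assume c: "c \<in> C"
      show "c #> a #> inv a = c" "c #> inv a #> a = c"
        using coset_mult_assoc[OF CG[OF c]] a CG[OF c] by auto
      show "c #> a \<in> C" "c #> inv a \<in> C" using act c a by auto
    qed auto
    finally show "[\<tau> (a \<otimes> b) = \<tau> a + \<tau> b] (mod int p)" .
  qed
  have \<tau>Z: "[\<tau> z = int m * \<xi> z] (mod int p)" if z: "z \<in> Z" for z
  proof -
    have zT: "z \<in> T" using z ZT by blast
    have "[\<tau> z = (\<Sum>c\<in>C. \<xi> z)] (mod int p)"
      unfolding \<tau>_def
    proof (rule cong_sum)
      fix c assume c: "c \<in> C"
      have "conj_by (s c) z \<in> Z" by (rule conj_by_normal[OF Z sG[OF c] z])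
      then have "Z #> (s c \<otimes> z) = Z #> s c"
        using rcos_eq_iff[OF Z.is_subgroup, of "s c \<otimes> z" "s c"] sG[OF c] z by (simp add: conj_by_def)
      then have "c #> z = c"
        using coset_mult_assoc[OF Z.subset, of "s c" z] s[OF c] z by simp
      then have "w c z = conj_by (s c) z" by (simp add: w_def conj_by_def)
      then show "[\<xi> (w c z) = \<xi> z] (mod int p)" using inv_\<xi>[OF s(1)[OF c] z] by simp
    qed
    then show ?thesis by (simp add: m_def)
  qed
  have pm: "\<not> int p dvd int m" using cop by (simp add: m_def C_def)
  have pZ: "int p dvd \<tau> z \<longleftrightarrow> int p dvd \<xi> z" if "z \<in> Z" for z
    using \<tau>Z[OF that] pm p by (simp add: cong_dvd_iff prime_dvd_mult_iff)
  have tm: "t [^] m \<in> Z" if t: "t \<in> T" for t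
  proof -
    interpret A: group "G\<lparr>carrier := T\<rparr>" by (rule subgroup_imp_group[OF T])
    have ZA: "Z \<lhd> G\<lparr>carrier := T\<rparr>" by (rule normal_restrict_supergroup[OF T Z ZT])
    interpret ZA: normal Z "G\<lparr>carrier := T\<rparr>" by (rule ZA)
    interpret Q: group "(G\<lparr>carrier := T\<rparr>) Mod Z" by (rule ZA.factorgroup_is_group)
    have car: "carrier ((G\<lparr>carrier := T\<rparr>) Mod Z) = C" by (simp add: carrier_FactGroup C_def)
    have "(Z #> t) [^]\<^bsub>(G\<lparr>carrier := T\<rparr>) Mod Z\<^esub> order ((G\<lparr>carrier := T\<rparr>) Mod Z) = Z"
      using Q.pow_order_eq_1[of "Z #> t"] t by (simp add: car C_def)
    then have "(Z #> t) [^]\<^bsub>(G\<lparr>carrier := T\<rparr>) Mod Z\<^esub> m = Z" by (simp add: order_def car m_def)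
    moreover have "(Z #> t) [^]\<^bsub>(G\<lparr>carrier := T\<rparr>) Mod Z\<^esub> m = Z #> t [^] m"
      using ZA.FactGroup_pow[of t m] t by (simp add: nat_pow_consistent[symmetric])
    ultimately show ?thesis using rcos_eq_self_iff[OF Z.is_subgroup] t by simp
  qed
  have "int p dvd \<tau> t \<longleftrightarrow> t [^] m \<in> {z\<in>Z. int p dvd \<xi> z}" if t: "t \<in> T" for t
  proof -
    have "int p dvd \<tau> t \<longleftrightarrow> int p dvd int m * \<tau> t" using pm p by (simp add: prime_dvd_mult_iff)
    also have "\<dots> \<longleftrightarrow> int p dvd \<tau> (t [^] m)"
      using char_mod_pow[OF \<tau> T t, of m] by (simp add: cong_dvd_iff)
    also have "\<dots> \<longleftrightarrow> int p dvd \<xi> (t [^] m)" by (rule pZ[OF tm[OF t]])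
    finally show ?thesis using tm[OF t] by simp
  qed
  then show ?thesis using \<tau> pZ unfolding m_def C_def by blast
qed

text \<open>
  The quotient of \<open>L\<close> by the kernel of \<open>\<xi>\<close> has order \<open>1\<close> or \<open>p\<close>, and the automorphism group of a
  group of order \<open>p\<close> is abelian of exponent \<open>p - 1\<close>.
\<close>
lemma pow_comm_acts_trivially:
  assumes p: "prime p" and L: "L \<lhd> G" and \<xi>: "char_mod p L \<xi>" and K: "{a\<in>L. int p dvd \<xi> a} \<lhd> G"
    and n: "n \<in> pow_comm (p - 1)" and l: "l \<in> L"
  shows "[\<xi> (conj_by n l) = \<xi> l] (mod int p)"
proof (cases "\<forall>a\<in>L. int p dvd \<xi> a")
  case True
  have "n \<in> carrier G" using n pow_comm_subgroup subgroup.mem_carrier by fast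
  then have "int p dvd \<xi> (conj_by n l)" "int p dvd \<xi> l" using True l conj_by_normal[OF L] by auto
  then show ?thesis by (simp add: cong_iff_dvd_diff)
next
  case False
  interpret L: normal L G by fact
  let ?K = "{a\<in>L. int p dvd \<xi> a}"
  obtain a where a: "a \<in> L" "\<not> int p dvd \<xi> a" using False by blast
  obtain u where u: "\<And>l. l \<in> L \<Longrightarrow> \<exists>k::nat. [int k = u * \<xi> l] (mod int p) \<and> l \<otimes> inv (a [^] k) \<in> ?K"
    using char_mod_generator[OF p \<xi> L.is_subgroup a] by blast
  have eig: "\<exists>\<mu>. \<not> int p dvd \<mu> \<and> (\<forall>l\<in>L. [\<xi> (conj_by g l) = \<mu> * \<xi> l] (mod int p))" if g: "g \<in> carrier G" for g
  proof -
    define \<mu> where "\<mu> = u * \<xi> (conj_by g a)"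
    have \<mu>: "[\<xi> (conj_by g l) = \<mu> * \<xi> l] (mod int p)" if l: "l \<in> L" for l
    proof -
      obtain k :: nat where kk: "[int k = u * \<xi> l] (mod int p)" and k: "l \<otimes> inv (a [^] k) \<in> ?K"
        using u[OF l] by blast
      have ak: "a [^] k \<in> L" by (rule subgroup_nat_pow_closed[OF L.is_subgroup a(1)])
      define b where "b = l \<otimes> inv (a [^] k)"
      have b: "b \<in> L" "l = b \<otimes> a [^] k" using ak l by (simp_all add: b_def group_normalize)
      have "b \<in> ?K" using k by (simp add: b_def)
      then have cb: "int p dvd \<xi> (conj_by g b)" using conj_by_normal[OF K g] by blast
      have cl: "conj_by g (a [^] k) = (conj_by g a) [^] k"
      proof -
        have "conj_by g \<in> hom G G" using g by (intro homI) (auto simp: conj_by_mult)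
        from hom_nat_pow[OF this, of a k] show ?thesis using a(1) by (simp add: is_group)
      qed
      have "[\<xi> (conj_by g l) = \<xi> (conj_by g b) + \<xi> (conj_by g (a [^] k))] (mod int p)"
        using char_modD[OF \<xi> conj_by_normal[OF L g b(1)] conj_by_normal[OF L g ak]] b g ak
        by (simp add: conj_by_mult)
      also have "[\<xi> (conj_by g b) + \<xi> (conj_by g (a [^] k)) = 0 + int k * \<xi> (conj_by g a)] (mod int p)"
        unfolding cl using cb conj_by_normal[OF L g a(1)]
        by (intro cong_add char_mod_pow[OF \<xi> L.is_subgroup]) (auto simp: cong_0_iff)
      also have "[0 + int k * \<xi> (conj_by g a) = 0 + u * \<xi> l * \<xi> (conj_by g a)] (mod int p)"
        by (intro cong_add cong_refl cong_mult kk)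
      finally show ?thesis by (simp add: \<mu>_def ac_simps)
    qed
    have "\<not> int p dvd \<mu>"
    proof
      assume d: "int p dvd \<mu>"
      have "conj_by (inv g) a \<in> L" using conj_by_normal[OF L _ a(1)] g by blast
      moreover have "conj_by g (conj_by (inv g) a) = a" using g a(1) by (simp add: conj_by_conj_by conj_by_one)
      ultimately have "[\<xi> a = \<mu> * \<xi> (conj_by (inv g) a)] (mod int p)" using \<mu> by metis
      then show False using a(2) d by (simp add: cong_dvd_iff)
    qed
    then show ?thesis using \<mu> by blast
  qed
  define M where "M = {h\<in>carrier G. \<forall>l\<in>L. [\<xi> (conj_by h l) = \<xi> l] (mod int p)}"
  have sM: "subgroup M G"
  proof (rule subgroupI)
    show "M \<subseteq> carrier G" "M \<noteq> {}" by (auto simp: M_def conj_by_one intro!: exI[of _ "\<one>"])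
    fix g assume g: "g \<in> M"
    then have gG: "g \<in> carrier G" by (simp add: M_def)
    have "[\<xi> (conj_by (inv g) l) = \<xi> l] (mod int p)" if l: "l \<in> L" for l
    proof -
      have "[\<xi> (conj_by g (conj_by (inv g) l)) = \<xi> (conj_by (inv g) l)] (mod int p)"
        using g conj_by_normal[OF L inv_closed[OF gG] l] unfolding M_def by blast
      moreover have "conj_by g (conj_by (inv g) l) = l" using gG l by (simp add: conj_by_conj_by conj_by_one)
      ultimately show ?thesis by (metis cong_sym)
    qed
    then show "inv g \<in> M" using gG by (simp add: M_def)
    fix h assume h: "h \<in> M"
    then have hG: "h \<in> carrier G" by (simp add: M_def)
    have "[\<xi> (conj_by (g \<otimes> h) l) = \<xi> l] (mod int p)" if l: "l \<in> L" for l
    proof -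
      have "[\<xi> (conj_by g (conj_by h l)) = \<xi> (conj_by h l)] (mod int p)"
        using g conj_by_normal[OF L hG l] unfolding M_def by blast
      also have "[\<xi> (conj_by h l) = \<xi> l] (mod int p)" using h l by (simp add: M_def)
      finally show ?thesis using gG hG l by (simp add: conj_by_conj_by)
    qed
    then show "g \<otimes> h \<in> M" using gG hG by (simp add: M_def)
  qed
  have "pow_comm (p - 1) \<subseteq> M"
    unfolding pow_comm_def
  proof (rule generate_subgroup_incl[OF subsetI sM])
    fix h assume gen: "h \<in> {x [^] (p - 1) | x. x \<in> carrier G} \<union>
     {a \<otimes> b \<otimes> inv a \<otimes> inv b | a b. a \<in> carrier G \<and> b \<in> carrier G}"
    show "h \<in> M" using gen
    proof (elim UnE)
      assume "h \<in> {x [^] (p - 1) | x. x \<in> carrier G}"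
      then obtain x where x: "x \<in> carrier G" "h = x [^] (p - 1)" by blast
      obtain \<mu> where \<mu>: "\<not> int p dvd \<mu>" "\<forall>l\<in>L. [\<xi> (conj_by x l) = \<mu> * \<xi> l] (mod int p)" using eig[OF x(1)] by blast
      have pow: "[\<xi> (conj_by (x [^] (k::nat)) l) = \<mu> ^ k * \<xi> l] (mod int p)" if l: "l \<in> L" for l k
        using l
      proof (induction k arbitrary: l)
        case (Suc k)
        have "[\<xi> (conj_by (x [^] k) (conj_by x l)) = \<mu> ^ k * \<xi> (conj_by x l)] (mod int p)"
          by (rule Suc.IH[OF conj_by_normal[OF L x(1) Suc.prems]])
        also have "[\<mu> ^ k * \<xi> (conj_by x l) = \<mu> ^ k * (\<mu> * \<xi> l)] (mod int p)"
          using \<mu>(2) Suc.prems by (intro cong_mult cong_refl) blast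
        finally show ?case using x Suc.prems by (simp add: conj_by_conj_by ac_simps)
      qed (simp add: conj_by_one)
      define k where "k = nat (\<mu> mod int p)"
      have kk: "[int k = \<mu>] (mod int p)" using prime_gt_0_nat[OF p] by (simp add: k_def)
      then have "\<not> p dvd k" using \<mu>(1) by (metis cong_dvd_iff int_dvd_int_iff)
      then have "[k ^ (p - 1) = 1] (mod p)" by (rule fermat_theorem[OF p])
      then have "[int k ^ (p - 1) = 1] (mod int p)" by (metis cong_int_iff of_nat_1 of_nat_power)
      then have "[\<mu> ^ (p - 1) = 1] (mod int p)" using cong_pow[OF kk] by (meson cong_sym cong_trans)
      then have "[\<mu> ^ (p - 1) * \<xi> l = 1 * \<xi> l] (mod int p)" for l by (intro cong_mult cong_refl)
      then have "[\<xi> (conj_by h l) = \<xi> l] (mod int p)" if "l \<in> L" for l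
        using pow[OF that, of "p - 1"] unfolding x(2) by (metis cong_trans mult_1)
      then show ?thesis using x by (simp add: M_def)
    next
      assume "h \<in> {a \<otimes> b \<otimes> inv a \<otimes> inv b | a b. a \<in> carrier G \<and> b \<in> carrier G}"
      then obtain a b where ab: "a \<in> carrier G" "b \<in> carrier G" "h = a \<otimes> b \<otimes> inv a \<otimes> inv b" by blast
      obtain \<mu> where \<mu>: "\<And>l. l \<in> L \<Longrightarrow> [\<xi> (conj_by a l) = \<mu> * \<xi> l] (mod int p)" using eig[OF ab(1)] by blast
      obtain \<nu> where \<nu>: "\<And>l. l \<in> L \<Longrightarrow> [\<xi> (conj_by b l) = \<nu> * \<xi> l] (mod int p)" using eig[OF ab(2)] by blast
      have "[\<xi> (conj_by h l) = \<xi> l] (mod int p)" if l: "l \<in> L" for l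
      proof -
        define l' where "l' = conj_by (inv (b \<otimes> a)) l"
        have l': "l' \<in> L" unfolding l'_def by (rule conj_by_normal[OF L _ l]) (use ab in simp)
        have e1: "conj_by h l = conj_by a (conj_by b l')" and e2: "l = conj_by b (conj_by a l')"
          using ab l by (simp_all add: l'_def conj_by_def group_normalize)
        have "[\<xi> (conj_by a (conj_by b l')) = \<mu> * \<xi> (conj_by b l')] (mod int p)"
          by (rule \<mu>[OF conj_by_normal[OF L ab(2) l']])
        also have "[\<mu> * \<xi> (conj_by b l') = \<mu> * (\<nu> * \<xi> l')] (mod int p)" by (intro cong_mult cong_refl \<nu> l')
        also have "\<mu> * (\<nu> * \<xi> l') = \<nu> * (\<mu> * \<xi> l')" by simp
        also have "[\<nu> * (\<mu> * \<xi> l') = \<nu> * \<xi> (conj_by a l')] (mod int p)"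
          by (intro cong_mult cong_refl cong_sym[OF \<mu>[OF l']])
        also have "[\<nu> * \<xi> (conj_by a l') = \<xi> (conj_by b (conj_by a l'))] (mod int p)"
          by (rule cong_sym[OF \<nu>[OF conj_by_normal[OF L ab(1) l']]])
        finally show ?thesis by (simp only: e1[symmetric] e2[symmetric])
      qed
      then show ?thesis using ab by (simp add: M_def)
    qed
  qed
  then have "n \<in> M" using n by blast
  then show ?thesis using l by (simp add: M_def)
qed

text \<open>
  The image of \<open>T\<close> in the quotient by \<open>K\<close> is a normal \<open>p\<close>-complement of the image of
  \<open>pow_comm (p - 1)\<close>.  In the induction step for a factor of order \<open>p\<close> the kernel of the transfer
  replaces the previous complement.
\<close>
lemma su_open_prime_to_p_kernel:
  assumes p: "prime p" and K: "su_open K"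
    and S: "finite S" "S \<subseteq> carrier G" "generate G S = carrier G"
  shows "\<exists>T. T \<lhd> G \<and> p_open p (pow_comm (p - 1)) T \<and> K \<inter> pow_comm (p - 1) \<subseteq> T \<and>
    \<not> p dvd card ((#>) K ` T)"
  using K
proof (induction rule: su_open.induct)
  let ?N = "pow_comm (p - 1)"
  have p1: "p > 1" using prime_gt_1_nat[OF p] .
  interpret N: normal ?N G by (rule pow_comm_normal)
  {
    case base
    have "carrier G #> x = carrier G" if "x \<in> ?N" for x
      using rcos_eq_self_iff[OF subgroup_self, of x] that by simp
    then have "(#>) (carrier G) ` ?N = {carrier G}" using N.one_closed by blast
    then have "card ((#>) (carrier G) ` ?N) = 1" by simp
    then show ?case using p1 by (intro exI[of _ ?N]) (auto simp: pow_comm_normal p_open.base)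
  }
  case (step L q \<xi>)
  define K where "K = {a\<in>L. int q dvd \<xi> a}"
  have su_openK: "su_open K" unfolding K_def by (rule su_open.step[OF step.hyps])
  have K: "K \<lhd> G" using step.hyps(4) by (simp add: K_def)
  have L: "L \<lhd> G" by (rule su_open_normal[OF step.hyps(1)])
  interpret K: normal K G by (rule K)
  interpret L: normal L G by (rule L)
  have KL: "K \<subseteq> L" by (auto simp: K_def)
  have finK: "finite ((#>) K ` carrier G)"
    using finite_factor[OF K su_open_fin_index[OF su_openK]] by (simp add: carrier_FactGroup)
  have finL: "finite ((#>) L ` carrier G)"
    using finite_factor[OF L su_open_fin_index[OF step.hyps(1)]] by (simp add: carrier_FactGroup)
  obtain T1 where T1: "T1 \<lhd> G" "p_open p ?N T1" "L \<inter> ?N \<subseteq> T1" "\<not> p dvd card ((#>) L ` T1)"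
    using step.IH by blast
  interpret T1: normal T1 G by (rule T1(1))
  have T1N: "T1 \<subseteq> ?N" by (rule p_open_subset[OF T1(2)])
  show ?case unfolding K_def[symmetric]
  proof (cases "q = p")
    case False
    have sM: "subgroup (T1 \<inter> L) G"
      by (rule subgroups_Inter_pair[OF T1.is_subgroup L.is_subgroup])
    have "card ((#>) K ` (T1 \<inter> L)) \<in> {1, q}"
      by (rule card_coset_image_char_mod[OF step.hyps(2) sM char_mod_mono[OF step.hyps(3)] K.is_subgroup])
        (auto simp: K_def)
    then have "\<not> p dvd card ((#>) K ` (T1 \<inter> L))"
      using primes_dvd_imp_eq[OF p step.hyps(2)] False p1 by auto
    then have "\<not> p dvd card ((#>) K ` T1)"
      using card_coset_image_mult[OF K L KL T1.is_subgroup] T1(4) p by (simp add: prime_dvd_mult_iff)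
    then show "\<exists>T. T \<lhd> G \<and> p_open p ?N T \<and> K \<inter> ?N \<subseteq> T \<and> \<not> p dvd card ((#>) K ` T)"
      using T1 KL by blast
  next
    case True
    define Z where "Z = L \<inter> ?N"
    have Z: "Z \<lhd> G" unfolding Z_def by (rule normal_subgroup_intersect[OF L pow_comm_normal])
    interpret Z: normal Z G by (rule Z)
    have \<xi>: "char_mod p Z \<xi>"
      using step.hyps(3) True char_mod_mono[of q L \<xi> Z] by (auto simp: Z_def)
    have ZT: "Z \<subseteq> T1" using T1(3) by (simp add: Z_def)
    have triv: "[\<xi> (conj_by t z) = \<xi> z] (mod int p)" if "t \<in> T1" "z \<in> Z" for t z
      using pow_comm_acts_trivially[OF p L, of \<xi> t z] step.hyps(3,4) True that T1N by (auto simp: Z_def)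
    have card: "card ((#>) Z ` T1) = card ((#>) L ` T1)"
    proof (rule card_image_same_kernel)
      fix a b assume ab: "a \<in> T1" "b \<in> T1"
      then have "a \<otimes> inv b \<in> Z \<longleftrightarrow> a \<otimes> inv b \<in> L" using T1N by (auto simp: Z_def)
      then show "Z #> a = Z #> b \<longleftrightarrow> L #> a = L #> b"
        using rcos_eq_iff[OF Z.is_subgroup, of a b] rcos_eq_iff[OF L.is_subgroup, of a b] ab by simp
    qed
    define m where "m = card ((#>) Z ` T1)"
    have pm: "\<not> p dvd m" using T1(4) card by (simp add: m_def)
    have "m \<noteq> 0" using pm by (metis dvd_0_right)
    then have finZ: "finite ((#>) Z ` T1)" unfolding m_def by (metis card.infinite)
    obtain \<tau> where \<tau>: "char_mod p T1 \<tau>" "\<And>z. z \<in> Z \<Longrightarrow> int p dvd \<tau> z \<longleftrightarrow> int p dvd \<xi> z"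
      "\<And>t. t \<in> T1 \<Longrightarrow> int p dvd \<tau> t \<longleftrightarrow> t [^] m \<in> {z\<in>Z. int p dvd \<xi> z}"
      using transfer[OF p Z T1.is_subgroup ZT \<xi> triv finZ] pm unfolding m_def by blast
    have KZ: "{z\<in>Z. int p dvd \<xi> z} = K \<inter> ?N" using True by (auto simp: Z_def K_def)
    define T where "T = {t\<in>T1. int p dvd \<tau> t}"
    \<comment> \<open>a description of \<open>T\<close> that is visibly invariant under conjugation\<close>
    have T_alt: "T = {t\<in>T1. t [^] m \<in> K \<inter> ?N}" using \<tau>(3) by (auto simp: T_def KZ)
    have sT: "subgroup T G" unfolding T_def by (rule subgroup_ker_mod[OF \<tau>(1) T1.is_subgroup])
    have Tn: "T \<lhd> G"
    proof (rule normal_conj_byI[OF sT])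
      fix g t assume g: "g \<in> carrier G" and t: "t \<in> T"
      then have tT: "t \<in> T1" "t \<in> carrier G" by (auto simp: T_def)
      have "conj_by g \<in> hom G G" using g by (intro homI) (auto simp: conj_by_mult)
      from hom_nat_pow[OF this tT(2) is_group is_group, of m]
      have "(conj_by g t) [^] m = conj_by g (t [^] m)" by simp
      moreover have "conj_by g (t [^] m) \<in> K \<inter> ?N"
        using t conj_by_normal[OF K g] conj_by_normal[OF pow_comm_normal g] by (auto simp: T_alt)
      ultimately show "conj_by g t \<in> T" using conj_by_normal[OF T1(1) g tT(1)] by (simp add: T_alt)
    qed
    have po: "p_open p ?N T" unfolding T_def by (rule p_open.step[OF T1(2) \<tau>(1)])
    have KT: "K \<inter> ?N \<subseteq> T"
    proof
      fix z assume z: "z \<in> K \<inter> ?N"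
      then have "z \<in> {z\<in>Z. int p dvd \<xi> z}" unfolding KZ .
      then have "z \<in> Z" "int p dvd \<xi> z" by blast+
      then show "z \<in> T" using \<tau>(2) ZT by (auto simp: T_def)
    qed
    have TL: "T \<inter> L \<subseteq> K"
    proof
      fix t assume t: "t \<in> T \<inter> L"
      then have "t \<in> Z" using T1N by (auto simp: T_def Z_def)
      moreover have "int p dvd \<tau> t" using t by (simp add: T_def)
      ultimately have "t \<in> {z\<in>Z. int p dvd \<xi> z}" using \<tau>(2) by simp
      then show "t \<in> K" unfolding KZ by simp
    qed
    have "(#>) K ` (T \<inter> L) = {K}"
    proof -
      have "K #> t = K" if "t \<in> T \<inter> L" for t
        using rcos_eq_self_iff[OF K.is_subgroup, of t] TL that by auto
      moreover have "\<one> \<in> T \<inter> L" using subgroup.one_closed[OF sT] by simp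
      ultimately show ?thesis by blast
    qed
    then have "card ((#>) K ` T) = card ((#>) L ` T)"
      using card_coset_image_mult[OF K L KL sT] by simp
    moreover have "card ((#>) L ` T) dvd card ((#>) L ` T1)"
      by (rule card_coset_image_dvd[OF L sT T1.is_subgroup])
        (auto simp: T_def intro: finite_subset[OF image_mono[OF T1.subset] finL])
    ultimately have "\<not> p dvd card ((#>) K ` T)" using T1(4) dvd_trans by metis
    then show "\<exists>T. T \<lhd> G \<and> p_open p ?N T \<and> K \<inter> ?N \<subseteq> T \<and> \<not> p dvd card ((#>) K ` T)"
      using Tn po KT by blast
  qed
qed

lemma normal_set_mult_is_subgroup:
  assumes "subgroup H G" "T \<lhd> G"
  shows "subgroup (H <#> T) G"
proof -
  have "T <#> H = H <#> T"
    using commut_normal[OF assms] by simp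
  moreover have "subgroup (T <#> H) G"
    using second_isomorphism_grp.normal_set_mult_subgroup[of T G H] assms
    by (simp add: second_isomorphism_grp_def second_isomorphism_grp_axioms_def)
  ultimately show ?thesis by simp
qed

text \<open>
  If \<open>Y\<close> is generated by \<open>H\<close> and \<open>x\<close>, then \<open>Y \<le> H T\<close> and so the index of \<open>H\<close> in \<open>Y\<close> divides the
  order of a subgroup of \<open>T\<close>.  As \<open>T\<close> may be chosen of order prime to any given prime, the index
  is \<open>1\<close>.
\<close>
lemma finite_subgroup_eq_of_prime_to_p:
  assumes fin: "finite (carrier G)" and H: "subgroup H G"
    and T: "\<And>p::nat. prime p \<Longrightarrow> \<exists>T. T \<lhd> G \<and> \<not> p dvd card T \<and> x \<in> H <#> T" and x: "x \<in> carrier G"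
  shows "x \<in> H"
proof -
  interpret H: subgroup H G by fact
  obtain T where T: "\<And>p::nat. prime p \<Longrightarrow> T p \<lhd> G \<and> \<not> p dvd card (T p) \<and> x \<in> H <#> T p"
    using T by metis
  define Y where "Y = generate G (insert x H)"
  have Y: "subgroup Y G" unfolding Y_def by (rule generate_is_subgroup) (use x H.subset in auto)
  interpret Y: subgroup Y G by fact
  have HY: "H \<subseteq> Y" and xY: "x \<in> Y" unfolding Y_def by (auto intro: generate.incl)
  have YT: "Y \<subseteq> H <#> T p" if p: "prime p" for p :: nat
    unfolding Y_def
  proof (rule generate_subgroup_incl)
    have sT: "subgroup (T p) G" using T[OF p] normal_imp_subgroup by blast
    show "subgroup (H <#> T p) G" using T[OF p] by (intro normal_set_mult_is_subgroup H) simp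
    have "H \<subseteq> H <#> T p"
    proof
      fix h assume "h \<in> H"
      then have "h \<otimes> \<one> \<in> H <#> T p" using subgroup.one_closed[OF sT] unfolding set_mult_def by blast
      then show "h \<in> H <#> T p" using \<open>h \<in> H\<close> by simp
    qed
    then show "insert x H \<subseteq> H <#> T p" using T[OF p] by simp
  qed
  have finY: "finite Y" using fin Y.subset finite_subset by blast
  have cardY: "card ((#>) H ` Y) * card H = card Y" by (rule card_cosets_mult[OF H Y HY finY])
  have "card ((#>) H ` Y) = 1"
  proof (rule ccontr)
    assume "card ((#>) H ` Y) \<noteq> 1"
    then obtain p where p: "prime p" "p dvd card ((#>) H ` Y)" using prime_factor_nat by blast
    have Tp: "T p \<lhd> G" using T[OF p(1)] by simp
    interpret Tp: normal "T p" G by fact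
    have sI: "subgroup (Y \<inter> T p) G" by (rule subgroups_Inter_pair[OF Y Tp.is_subgroup])
    have "(#>) H ` Y = (#>) H ` (Y \<inter> T p)"
    proof (intro equalityI subsetI)
      fix c assume "c \<in> (#>) H ` Y"
      then obtain y where y: "y \<in> Y" "c = H #> y" by blast
      then obtain h t where ht: "h \<in> H" "t \<in> T p" "y = h \<otimes> t"
        using YT[OF p(1)] unfolding set_mult_def by blast
      have "t = inv h \<otimes> y" using ht by (simp add: group_normalize)
      moreover have "inv h \<otimes> y \<in> Y" using ht(1) y(1) HY by (intro Y.m_closed Y.m_inv_closed) auto
      ultimately have "t \<in> Y" by (simp only:)
      have "y \<otimes> inv t = h" using ht by (simp add: group_normalize)
      then have "H #> y = H #> t" using rcos_eq_iff[OF H, of y t] ht y by simp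
      then show "c \<in> (#>) H ` (Y \<inter> T p)" using \<open>t \<in> Y\<close> ht y by blast
    qed blast
    also have "card ((#>) H ` (Y \<inter> T p)) = card ((#>) (H \<inter> T p) ` (Y \<inter> T p))"
    proof (rule card_image_same_kernel)
      fix a b assume ab: "a \<in> Y \<inter> T p" "b \<in> Y \<inter> T p"
      have sHT: "subgroup (H \<inter> T p) G" by (rule subgroups_Inter_pair[OF H Tp.is_subgroup])
      show "H #> a = H #> b \<longleftrightarrow> H \<inter> T p #> a = H \<inter> T p #> b"
        using rcos_eq_iff[OF H, of a b] rcos_eq_iff[OF sHT, of a b] ab by simp
    qed
    finally have eq: "card ((#>) H ` Y) = card ((#>) (H \<inter> T p) ` (Y \<inter> T p))" .
    have "card ((#>) (H \<inter> T p) ` (Y \<inter> T p)) * card (H \<inter> T p) = card (Y \<inter> T p)"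
      by (rule card_cosets_mult[OF subgroups_Inter_pair[OF H Tp.is_subgroup] sI])
        (use HY finY in auto)
    then have "p dvd card (Y \<inter> T p)" using p(2) eq by (metis dvd_mult2)
    also have "card (Y \<inter> T p) dvd card (T p)"
      using card_cosets_mult[OF sI Tp.is_subgroup] finite_subset[OF Tp.subset fin]
      by (metis dvd_triv_right inf_le2)
    finally show False using T[OF p(1)] by blast
  qed
  then have "card H = card Y" using cardY by simp
  then have "H = Y" using HY finY by (intro card_subset_eq)
  then show ?thesis using xY by simp
qed

lemma su_open_closure_from_primes:
  assumes K: "su_open K" and H: "subgroup H G" and x: "x \<in> carrier G"
    and S: "finite S" "S \<subseteq> carrier G" "generate G S = carrier G"
    and all: "\<And>p T. prime p \<Longrightarrow> T \<lhd> G \<Longrightarrow> p_open p (pow_comm (p - 1)) T \<Longrightarrow> x \<in> H <#> T"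
  shows "x \<in> H <#> K"
proof -
  interpret K: normal K G by (rule su_open_normal[OF K])
  interpret H: subgroup H G by fact
  interpret Q: group "G Mod K" by (rule K.factorgroup_is_group)
  interpret \<pi>: group_hom G "G Mod K" "(#>) K"
    using K.r_coset_hom_Mod by unfold_locales
  have "K #> x \<in> (#>) K ` H"
  proof (rule Q.finite_subgroup_eq_of_prime_to_p)
    show "finite (carrier (G Mod K))"
      using finite_factor[OF K.normal_axioms su_open_fin_index[OF K]] .
    show "subgroup ((#>) K ` H) (G Mod K)" by (rule \<pi>.subgroup_img_is_subgroup[OF H])
    show "K #> x \<in> carrier (G Mod K)" using x by (auto simp: carrier_FactGroup)
    fix p :: nat assume p: "prime p"
    obtain T where T: "T \<lhd> G" "p_open p (pow_comm (p - 1)) T" "\<not> p dvd card ((#>) K ` T)"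
      using su_open_prime_to_p_kernel[OF p K S] by blast
    have "(#>) K ` T \<lhd> (G Mod K)"
      by (rule normal.surj_hom_normal_subgroup[OF T(1) \<pi>.group_hom_axioms]) (simp add: carrier_FactGroup)
    moreover have "K #> x \<in> (#>) K ` H <#>\<^bsub>G Mod K\<^esub> (#>) K ` T"
    proof -
      obtain h t where ht: "h \<in> H" "t \<in> T" "x = h \<otimes> t"
        using all[OF p T(1,2)] unfolding set_mult_def by blast
      have "t \<in> carrier G" using ht(2) subgroup.mem_carrier[OF normal_imp_subgroup[OF T(1)]] by simp
      then have "K #> x = (K #> h) \<otimes>\<^bsub>G Mod K\<^esub> (K #> t)"
        using ht(1) unfolding ht(3) by (intro \<pi>.hom_mult) auto
      then show ?thesis using ht unfolding set_mult_def by blast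
    qed
    ultimately show "\<exists>T. T \<lhd> (G Mod K) \<and> \<not> p dvd card T \<and> K #> x \<in> (#>) K ` H <#>\<^bsub>G Mod K\<^esub> T"
      using T(3) by blast
  qed
  then obtain h where h: "h \<in> H" "K #> x = K #> h" by blast
  then have "x \<otimes> inv h \<in> K" using rcos_eq_iff[OF K.is_subgroup x, of h] by simp
  then have "conj_by (inv h) (x \<otimes> inv h) \<in> K" using h by (intro conj_by_normal[OF K.normal_axioms]) auto
  moreover have "x = h \<otimes> conj_by (inv h) (x \<otimes> inv h)" using h x by (simp add: conj_by_def group_normalize)
  ultimately show ?thesis using h(1) unfolding set_mult_def by blast
qed

end

section \<open>Words, cocycles on Schreier graphs, and residual finiteness\<close>

text \<open>
  The free reduction of a word.
\<close>
primrec free_reduce :: "('a \<times> bool) list \<Rightarrow> ('a \<times> bool) list" where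
  "free_reduce [] = []"
| "free_reduce (l # w) = (case free_reduce w of [] \<Rightarrow> [l]
     | m # u \<Rightarrow> if fst l = fst m \<and> snd l \<noteq> snd m then u else l # m # u)"

lemma free_reduce_reduced:
  "fst ` set w \<subseteq> X \<Longrightarrow> free_reduce w \<in> reduced_words X"
proof (induction w)
  case (Cons l w)
  show ?case
  proof (cases "free_reduce w")
    case Nil
    then show ?thesis using Cons by (simp add: reduced_words_def)
  next
    case m: (Cons m u)
    then have "m # u \<in> reduced_words X" using Cons by simp
    then show ?thesis using m Cons.prems
      by (cases u) (auto simp: reduced_words_def)
  qed
qed (simp add: reduced_words_def)

lemma reduced_words_over: "w \<in> reduced_words X \<Longrightarrow> fst ` set w \<subseteq> X"
  by (simp add: reduced_words_def)

text \<open>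
  A label \<open>\<rho> c x\<close> in the group \<open>A\<close> is given for every edge from \<open>c\<close> to \<open>c x\<close>.  The value of a word
  is the product of the labels along the path that it describes from the vertex \<open>c\<close>; an edge
  traversed backwards contributes the inverse of its label.  The vertices are arbitrary subsets
  of \<open>G\<close>; only cosets are used.
\<close>
primrec path_val :: "('a, 'b) monoid_scheme \<Rightarrow> ('c, 'd) monoid_scheme \<Rightarrow> ('a set \<Rightarrow> 'a \<Rightarrow> 'c) \<Rightarrow>
    ('a \<times> bool) list \<Rightarrow> 'a set \<Rightarrow> 'c" where
  "path_val G A \<rho> [] c = \<one>\<^bsub>A\<^esub>"
| "path_val G A \<rho> (l # w) c =
     (if snd l then \<rho> c (fst l) else inv\<^bsub>A\<^esub> (\<rho> (c #>\<^bsub>G\<^esub> inv\<^bsub>G\<^esub> (fst l)) (fst l)))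
       \<otimes>\<^bsub>A\<^esub> path_val G A \<rho> w (c #>\<^bsub>G\<^esub> letter_val G l)"

text \<open>
  The elements \<open>g v\<close>, where \<open>v\<close> runs through the values of the prefixes of the word.
\<close>
primrec prefix_vals :: "('a, 'b) monoid_scheme \<Rightarrow> ('a \<times> bool) list \<Rightarrow> 'a \<Rightarrow> 'a set" where
  "prefix_vals G [] g = {g}"
| "prefix_vals G (l # w) g = insert g (prefix_vals G w (g \<otimes>\<^bsub>G\<^esub> letter_val G l))"

lemma prefix_vals_start: "g \<in> prefix_vals G w g"
  by (cases w) auto

context group
begin

lemma prefix_vals_append:
  assumes "g \<in> carrier G" "fst ` set v \<subseteq> carrier G" "fst ` set w \<subseteq> carrier G"
  shows "prefix_vals G (v @ w) g = prefix_vals G v g \<union> prefix_vals G w (g \<otimes> word_val G v)"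
  using assms
proof (induction v arbitrary: g)
  case Nil
  then show ?case using prefix_vals_start[of g G w] by auto
next
  case (Cons l v)
  then show ?case by (simp add: letter_val_closed word_val_closed m_assoc)
qed

lemma letter_val_opposite:
  assumes "fst l \<in> carrier G" "fst m = fst l" "snd m \<noteq> snd l"
  shows "letter_val G m = inv (letter_val G l)"
  using assms by (auto simp: letter_val_def)

lemma free_reduce_val:
  assumes "fst ` set w \<subseteq> carrier G"
  shows "word_val G (free_reduce w) = word_val G w"
  using assms
proof (induction w)
  case (Cons l w)
  have over: "fst ` set (free_reduce w) \<subseteq> carrier G"
    using free_reduce_reduced[of w "carrier G"] Cons.prems reduced_words_over by auto
  show ?case
  proof (cases "free_reduce w")
    case Nil
    then show ?thesis using Cons by simp
  next
    case m: (Cons m u)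
    then have "word_val G w = letter_val G m \<otimes> word_val G u" using Cons by simp
    then show ?thesis using m Cons.prems over
      by (auto simp: letter_val_cancel word_val_closed)
  qed
qed simp

lemma prefix_vals_free_reduce:
  assumes "fst ` set w \<subseteq> carrier G" "g \<in> carrier G"
  shows "prefix_vals G (free_reduce w) g \<subseteq> prefix_vals G w g"
  using assms
proof (induction w arbitrary: g)
  case (Cons l w)
  have IH: "prefix_vals G (free_reduce w) (g \<otimes> letter_val G l) \<subseteq> prefix_vals G w (g \<otimes> letter_val G l)"
    using Cons by (simp add: letter_val_closed)
  have over: "fst ` set (free_reduce w) \<subseteq> carrier G"
    using free_reduce_reduced[of w "carrier G"] Cons.prems reduced_words_over by auto
  show ?case
  proof (cases "free_reduce w")
    case Nil
    then show ?thesis using IH by auto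
  next
    case m: (Cons m u)
    show ?thesis
    proof (cases "fst l = fst m \<and> snd l \<noteq> snd m")
      case True
      have "letter_val G m = inv (letter_val G l)"
        using True Cons.prems by (intro letter_val_opposite) auto
      then have "g \<otimes> letter_val G l \<otimes> letter_val G m = g"
        using Cons.prems by (simp add: letter_val_closed group_normalize)
      then show ?thesis using IH m True by auto
    next
      case False
      have "free_reduce (l # w) = l # free_reduce w" using False m by simp
      then have "prefix_vals G (free_reduce (l # w)) g
          = insert g (prefix_vals G (free_reduce w) (g \<otimes> letter_val G l))"
        by (simp only: prefix_vals.simps)
      then show ?thesis using IH by auto
    qed
  qed
qed simp

lemma path_val_closed:
  assumes A: "group A" and \<rho>: "\<And>c x. c \<subseteq> carrier G \<Longrightarrow> x \<in> X \<Longrightarrow> \<rho> c x \<in> carrier A"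
    and "X \<subseteq> carrier G" "fst ` set w \<subseteq> X" "c \<subseteq> carrier G"
  shows "path_val G A \<rho> w c \<in> carrier A"
  using assms(4,5)
proof (induction w arbitrary: c)
  case Nil
  then show ?case using group.is_monoid[OF A] by (simp add: monoid.one_closed)
next
  case (Cons l w)
  interpret A: group A by fact
  have l: "fst l \<in> X" "fst l \<in> carrier G" using Cons.prems assms(3) by auto
  have sub: "c #> letter_val G l \<subseteq> carrier G" "c #> inv (fst l) \<subseteq> carrier G"
    using Cons.prems l by (simp_all add: r_coset_subset_G letter_val_closed)
  show ?case using Cons.IH[OF _ sub(1)] Cons.prems \<rho> l sub by auto
qed

lemma path_val_append:
  assumes A: "group A" and \<rho>: "\<And>c x. c \<subseteq> carrier G \<Longrightarrow> x \<in> X \<Longrightarrow> \<rho> c x \<in> carrier A"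
    and X: "X \<subseteq> carrier G" and "fst ` set v \<subseteq> X" "fst ` set w \<subseteq> X" "c \<subseteq> carrier G"
  shows "path_val G A \<rho> (v @ w) c = path_val G A \<rho> v c \<otimes>\<^bsub>A\<^esub> path_val G A \<rho> w (c #> word_val G v)"
  using assms(4,6)
proof (induction v arbitrary: c)
  case Nil
  interpret A: group A by fact
  show ?case using path_val_closed[where \<rho> = \<rho>, OF A \<rho> X assms(5) Nil(2)] Nil by simp
next
  case (Cons l v)
  interpret A: group A by fact
  have l: "fst l \<in> X" "fst l \<in> carrier G" using Cons.prems X by auto
  have lG: "letter_val G l \<in> carrier G" using l letter_val_closed by blast
  have v: "fst ` set v \<subseteq> X" "fst ` set v \<subseteq> carrier G" using Cons.prems X by auto
  have sub: "c #> letter_val G l \<subseteq> carrier G" "c #> inv (fst l) \<subseteq> carrier G"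
    using Cons.prems l lG by (simp_all add: r_coset_subset_G)
  have vG: "word_val G v \<in> carrier G" using v by (simp add: word_val_closed)
  have "c #> letter_val G l #> word_val G v \<subseteq> carrier G" using sub(1) vG by (rule r_coset_subset_G)
  then have cl: "path_val G A \<rho> v (c #> letter_val G l) \<in> carrier A"
    "path_val G A \<rho> w (c #> letter_val G l #> word_val G v) \<in> carrier A"
    using path_val_closed[where \<rho> = \<rho>, OF A \<rho> X] v(1) assms(5) sub by auto
  have eq: "c #> (letter_val G l \<otimes> word_val G v) = c #> letter_val G l #> word_val G v"
    using coset_mult_assoc[OF Cons.prems(2) lG vG] by simp
  show ?case using Cons.IH[OF v(1) sub(1)] cl \<rho> l sub Cons.prems(2)
    by (auto simp: eq A.m_assoc)
qed

lemma path_val_free_reduce: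
  assumes A: "group A" and \<rho>: "\<And>c x. c \<subseteq> carrier G \<Longrightarrow> x \<in> X \<Longrightarrow> \<rho> c x \<in> carrier A"
    and X: "X \<subseteq> carrier G" and "fst ` set w \<subseteq> X" "c \<subseteq> carrier G"
  shows "path_val G A \<rho> (free_reduce w) c = path_val G A \<rho> w c"
  using assms(4,5)
proof (induction w arbitrary: c)
  case (Cons l w)
  interpret A: group A by fact
  have l: "fst l \<in> X" "fst l \<in> carrier G" using Cons.prems X by auto
  have lG: "letter_val G l \<in> carrier G" using l letter_val_closed by blast
  have sub: "c #> letter_val G l \<subseteq> carrier G" "c #> inv (fst l) \<subseteq> carrier G"
    using Cons.prems l lG by (simp_all add: r_coset_subset_G)
  have IH: "path_val G A \<rho> (free_reduce w) (c #> letter_val G l) = path_val G A \<rho> w (c #> letter_val G l)"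
    using Cons.IH Cons.prems sub by auto
  show ?case
  proof (cases "free_reduce w")
    case Nil
    then show ?thesis using IH by simp
  next
    case m: (Cons m u)
    have u: "fst ` set u \<subseteq> X"
      using free_reduce_reduced[of w X] Cons.prems m by (auto simp: reduced_words_def)
    show ?thesis
    proof (cases "fst l = fst m \<and> snd l \<noteq> snd m")
      case True
      have lm: "letter_val G m = inv (letter_val G l)"
        using True l by (intro letter_val_opposite) auto
      have c: "c #> letter_val G l #> letter_val G m = c"
        using lG Cons.prems(2) by (simp add: lm coset_mult_assoc)
      have cu: "path_val G A \<rho> u c \<in> carrier A"
        using path_val_closed[where \<rho> = \<rho>, OF A \<rho> X u Cons.prems(2)] by simp
      have r1: "\<rho> c (fst l) \<in> carrier A" "\<rho> (c #> inv (fst l)) (fst l) \<in> carrier A"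
        using \<rho> Cons.prems(2) l sub by auto
      have "path_val G A \<rho> (l # w) c = path_val G A \<rho> (l # m # u) c" using IH m by simp
      also have "\<dots> = path_val G A \<rho> u c"
      proof (cases "snd l")
        case sl: True
        have "c #> fst l #> inv (fst l) = c" using Cons.prems(2) l by (simp add: coset_mult_assoc)
        then show ?thesis using True sl c cu r1 by (simp add: letter_val_def A.inv_cancel_left)
      next
        case sl: False
        then show ?thesis using True c cu r1 by (simp add: letter_val_def A.inv_cancel_left')
      qed
      finally have "path_val G A \<rho> (l # w) c = path_val G A \<rho> u c" .
      then show ?thesis using m True by simp
    next
      case False
      have "free_reduce (l # w) = l # free_reduce w" using False m by simp
      then show ?thesis using IH by (simp only: path_val.simps)
    qed
  qed
qed simp

end

text \<open>
  A free group with a distinguished basis \<open>X\<close>.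
\<close>
locale based_free_group = group G for G (structure) +
  fixes X
  assumes basis: "free_basis G X"
begin

lemma X_carrier: "X \<subseteq> carrier G"
  using basis by (simp add: free_basis_def)

text \<open>
  The reduced word over \<open>X\<close> that represents \<open>g\<close>.
\<close>
definition nf :: "'a \<Rightarrow> ('a \<times> bool) list" where
  "nf = inv_into (reduced_words X) (word_val G)"

lemma nf_reduced: "g \<in> carrier G \<Longrightarrow> nf g \<in> reduced_words X"
  and nf_val: "g \<in> carrier G \<Longrightarrow> word_val G (nf g) = g"
  using basis unfolding nf_def free_basis_def bij_betw_def
  by (auto intro: inv_into_into f_inv_into_f)

lemma nf_over: "g \<in> carrier G \<Longrightarrow> fst ` set (nf g) \<subseteq> X"
  by (rule reduced_words_over[OF nf_reduced])

lemma nf_over_carrier: "g \<in> carrier G \<Longrightarrow> fst ` set (nf g) \<subseteq> carrier G"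
  using nf_over X_carrier by blast

lemma free_reduce_eq_nf:
  assumes "fst ` set w \<subseteq> X"
  shows "free_reduce w = nf (word_val G w)"
proof -
  have w: "fst ` set w \<subseteq> carrier G" using assms X_carrier by blast
  have "inj_on (word_val G) (reduced_words X)" using basis by (simp add: free_basis_def bij_betw_def)
  then show ?thesis
    by (rule inj_onD) (use free_reduce_reduced[OF assms] nf_reduced nf_val word_val_closed[OF w]
        free_reduce_val[OF w] in auto)
qed

text \<open>
  Since the group is free on \<open>X\<close>, every labelling of the edges extends to a cocycle.  Restricted
  to the stabilizer of a vertex it is a homomorphism.
\<close>
lemma cocycle_exists:
  assumes A: "group A" and \<rho>: "\<And>c x. c \<subseteq> carrier G \<Longrightarrow> x \<in> X \<Longrightarrow> \<rho> c x \<in> carrier A"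
  obtains R where
    "\<And>c g. c \<subseteq> carrier G \<Longrightarrow> g \<in> carrier G \<Longrightarrow> R c g \<in> carrier A"
    "\<And>c g h. c \<subseteq> carrier G \<Longrightarrow> g \<in> carrier G \<Longrightarrow> h \<in> carrier G \<Longrightarrow>
       R c (g \<otimes> h) = R c g \<otimes>\<^bsub>A\<^esub> R (c #> g) h"
    "\<And>c x. c \<subseteq> carrier G \<Longrightarrow> x \<in> X \<Longrightarrow> R c x = \<rho> c x"
proof
  interpret A: group A by fact
  define R where "R c g = path_val G A \<rho> (nf g) c" for c g
  note closed = path_val_closed[where \<rho> = \<rho>, OF A \<rho> X_carrier]
  have val: "R c (word_val G w) = path_val G A \<rho> w c" if "fst ` set w \<subseteq> X" "c \<subseteq> carrier G" for w c
    using path_val_free_reduce[where \<rho> = \<rho>, OF A \<rho> X_carrier that] free_reduce_eq_nf[OF that(1)]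
    by (simp add: R_def)
  show "R c g \<in> carrier A" if "c \<subseteq> carrier G" "g \<in> carrier G" for c g
    unfolding R_def using closed nf_over[OF that(2)] that(1) by simp
  show "R c (g \<otimes> h) = R c g \<otimes>\<^bsub>A\<^esub> R (c #> g) h"
    if c: "c \<subseteq> carrier G" and g: "g \<in> carrier G" and h: "h \<in> carrier G" for c g h
  proof -
    have "word_val G (nf g @ nf h) = g \<otimes> h"
      using nf_over_carrier[OF g] nf_over_carrier[OF h] nf_val[OF g] nf_val[OF h]
      by (simp add: word_val_append)
    then have "R c (g \<otimes> h) = path_val G A \<rho> (nf g @ nf h) c"
      using val[of "nf g @ nf h" c] nf_over[OF g] nf_over[OF h] c by (simp add: image_Un)
    also have "\<dots> = path_val G A \<rho> (nf g) c \<otimes>\<^bsub>A\<^esub> path_val G A \<rho> (nf h) (c #> word_val G (nf g))"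
      by (rule path_val_append[where \<rho> = \<rho>, OF A \<rho> X_carrier nf_over[OF g] nf_over[OF h] c])
    finally show ?thesis using nf_val[OF g] by (simp add: R_def)
  qed
  show "R c x = \<rho> c x" if c: "c \<subseteq> carrier G" and x: "x \<in> X" for c x
    using val[of "[(x, True)]" c] c x X_carrier \<rho>[OF c x] by (auto simp: letter_val_def)
qed

text \<open>
  Free groups are residually finite \<open>p\<close>-groups.  Consider the path of the reduced word of \<open>w\<close> in
  the Schreier graph of \<open>D\<close>.  If it visits some vertex twice, take such a pair of times at
  minimal distance.  The loop between them crosses its first edge only once, so the character of
  \<open>D\<close> that counts crossings of this edge is \<open>1\<close> or \<open>-1\<close> on the loop, and its kernel separates the
  two visits.  Eventually all vertices of the path are different, and \<open>w\<close> is not in \<open>D\<close>.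
\<close>
lemma separate_by_p_open:
  assumes p: "prime p" and w: "w \<in> carrier G" "w \<noteq> \<one>"
  shows "\<exists>D. p_open p (carrier G) D \<and> w \<notin> D"
proof -
  define n where "n = length (nf w)"
  define v where "v i = word_val G (take i (nf w))" for i
  define l where "l i = nf w ! i" for i
  have lX: "fst (l i) \<in> X" if "i < n" for i
    using that nf_over[OF w(1)] by (auto simp: l_def n_def)
  have take_over: "fst ` set (take i (nf w)) \<subseteq> carrier G" for i
    using nf_over_carrier[OF w(1)] set_take_subset by fast
  have vG: "v i \<in> carrier G" for i unfolding v_def by (rule word_val_closed[OF take_over])
  have v0: "v 0 = \<one>" by (simp add: v_def)
  have vn: "v n = w" using nf_val[OF w(1)] by (simp add: v_def n_def)
  have lG: "fst (l i) \<in> carrier G" if "i < n" for i using lX[OF that] X_carrier by blast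
  have vS: "v (Suc i) = v i \<otimes> letter_val G (l i)" if "i < n" for i
  proof -
    have "take (Suc i) (nf w) = take i (nf w) @ [l i]"
      using that by (simp add: l_def n_def take_Suc_conv_app_nth)
    then show ?thesis using take_over[of i] lG[OF that]
      by (simp add: v_def word_val_append letter_val_closed)
  qed
  have red: "\<not> (fst (l i) = fst (l (Suc i)) \<and> snd (l i) \<noteq> snd (l (Suc i)))" if "Suc i < n" for i
    using nf_reduced[OF w(1)] that by (simp add: reduced_words_def successively_conv_nth l_def n_def)
  \<comment> \<open>pairs of times at which the path is at the same vertex\<close>
  define coin where "coin D = {(i,j). i < j \<and> j \<le> n \<and> v i \<otimes> inv (v j) \<in> D}" for D
  have fin: "finite (coin D)" for D
    by (rule finite_subset[of _ "{..n} \<times> {..n}"]) (auto simp: coin_def)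
  have "\<exists>D'. p_open p (carrier G) D' \<and> coin D' = {}" if "p_open p (carrier G) D" for D
    using that
  proof (induction "card (coin D)" arbitrary: D rule: less_induct)
    case less
    show ?case
    proof (cases "coin D = {}")
      case True
      then show ?thesis using less.prems by blast
    next
      case False
      have sD: "subgroup D G" by (rule p_open_subgroup[OF less.prems subgroup_self])
      interpret D: subgroup D G by fact
      obtain i j where ij: "(i, j) \<in> coin D" and min: "\<And>i' j'. (i', j') \<in> coin D \<Longrightarrow> j - i \<le> j' - i'"
      proof -
        obtain e where "e \<in> coin D" "\<And>e'. e' \<in> coin D \<Longrightarrow> snd e - fst e \<le> snd e' - fst e'"
          using ex_has_least_nat[of "\<lambda>e. e \<in> coin D" _ "\<lambda>e. snd e - fst e"] False by blast
        then show ?thesis using that[of "fst e" "snd e"] by fastforce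
      qed
      have i: "i < j" "j \<le> n" "i < n" using ij by (auto simp: coin_def)
      have eqD: "D #> v a = D #> v b \<longleftrightarrow> v a \<otimes> inv (v b) \<in> D" for a b
        by (rule rcos_eq_iff[OF sD vG vG])
      have nocoin: "D #> v a \<noteq> D #> v b" if "a < b" "b \<le> n" "b - a < j - i" for a b
        using min[of a b] that by (auto simp: eqD coin_def)
      \<comment> \<open>the start of the edge traversed at time \<open>k\<close>, in its positive direction\<close>
      define st where "st k = D #> (if snd (l k) then v k else v (Suc k))" for k
      define \<rho> where "\<rho> c x = (if c = st i \<and> x = fst (l i) then 1 else 0 :: int)" for c x
      obtain R where
        R: "\<And>c g h. c \<subseteq> carrier G \<Longrightarrow> g \<in> carrier G \<Longrightarrow> h \<in> carrier G \<Longrightarrow>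
          R c (g \<otimes> h) = R c g + R (c #> g) h"
        and R\<rho>: "\<And>c x. c \<subseteq> carrier G \<Longrightarrow> x \<in> X \<Longrightarrow> R c x = \<rho> c x"
        using cocycle_exists[of integer_group \<rho>] by auto
      have DG: "D #> g \<subseteq> carrier G" if "g \<in> carrier G" for g by (rule r_coset_subset_G[OF D.subset that])
      have R1: "R c \<one> = 0" if "c \<subseteq> carrier G" for c using R[OF that, of \<one> \<one>] that by simp
      \<comment> \<open>the contribution of time \<open>k\<close> to the number of crossings\<close>
      define \<epsilon> where "\<epsilon> k = R (D #> v k) (letter_val G (l k))" for k
      have \<epsilon>: "\<epsilon> k = (if snd (l k) then 1 else - 1) * \<rho> (st k) (fst (l k))" if k: "k < n" for k
      proof (cases "snd (l k)")
        case True
        then show ?thesis using R\<rho>[OF DG[OF vG] lX[OF k], of k] by (simp add: \<epsilon>_def letter_val_def st_def)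
      next
        case False
        define x where "x = fst (l k)"
        have x: "x \<in> X" "x \<in> carrier G" using lX[OF k] lG[OF k] by (simp_all add: x_def)
        have "D #> v (Suc k) = D #> v k #> inv x"
          using False vS[OF k] x coset_mult_assoc[OF D.subset vG, of "inv x" k] by (simp add: letter_val_def x_def)
        then have "R (D #> v k) (inv x \<otimes> x) = R (D #> v k) (inv x) + R (D #> v (Suc k)) x"
          using R[OF DG[OF vG], of "inv x" x k] x by simp
        then have "R (D #> v k) (inv x) = - R (D #> v (Suc k)) x"
          using R1[OF DG[OF vG]] x by simp
        then show ?thesis using False R\<rho>[OF DG[OF vG] x(1)] by (simp add: \<epsilon>_def letter_val_def st_def x_def)
      qed
      have \<epsilon>0: "\<epsilon> k = 0" if k: "i < k" "k < j" for k
      proof (rule ccontr)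
        assume "\<epsilon> k \<noteq> 0"
        then have same: "st k = st i" "fst (l k) = fst (l i)"
          using \<epsilon>[of k] k i by (auto simp: \<rho>_def split: if_splits)
        have kn: "k < n" using k i by simp
        define x where "x = fst (l i)"
        have x: "x \<in> carrier G" using lG[OF i(3)] by (simp add: x_def)
        have sx: "D #> v (Suc a) = D #> v a #> letter_val G (l a)" if "a < n" for a
          using vS[OF that] coset_mult_assoc[OF D.subset vG, of "letter_val G (l a)" a] lG[OF that]
          by (simp add: letter_val_closed)
        consider "snd (l k) = snd (l i)" | "snd (l k) \<noteq> snd (l i)" by blast
        then show False
        proof cases
          case 1
          then have "D #> v i = D #> v k \<or> D #> v (Suc i) = D #> v (Suc k)"
            using same by (auto simp: st_def split: if_splits)
          then show False using nocoin[of i k] nocoin[of "Suc i" "Suc k"] k i by auto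
        next
          case 2
          have "D #> v (Suc i) = D #> v k"
          proof (cases "snd (l i)")
            case True
            then have e: "D #> v (Suc k) = D #> v i" using same 2 by (simp add: st_def)
            have "D #> v (Suc k) = D #> v k #> inv x"
              using sx[OF kn] True 2 same(2) by (simp add: letter_val_def x_def)
            then have "D #> v k = D #> v i #> x"
              using e coset_mult_assoc[OF DG[OF vG], of "inv x" x k] x DG[OF vG, of k] by simp
            then show ?thesis using sx[OF i(3)] True by (simp add: letter_val_def x_def)
          next
            case False
            then show ?thesis using same 2 by (simp add: st_def)
          qed
          moreover have "k - Suc i < j - i" using k by linarith
          ultimately have "\<not> Suc i < k" using nocoin[of "Suc i" k] k i by auto
          then have "k = Suc i" using k by simp
          then show False using red[of i] 2 same(2) kn by auto
        qed
      qed
      have \<epsilon>i: "\<epsilon> i = 1 \<or> \<epsilon> i = - 1" using \<epsilon>[OF i(3)] by (auto simp: \<rho>_def)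
      have Rv: "R D (v k) = R D (v i) + \<epsilon> i" if "i < k" "k \<le> j" for k
        using that
      proof (induction k)
        case (Suc k)
        have k: "k < n" using Suc.prems i by simp
        have step: "R D (v (Suc k)) = R D (v k) + \<epsilon> k"
          using R[OF D.subset vG, of "letter_val G (l k)" k] vS[OF k] lG[OF k]
          by (simp add: letter_val_closed \<epsilon>_def)
        show ?case
        proof (cases "k = i")
          case False
          then show ?thesis using Suc step \<epsilon>0[of k] by simp
        qed (use step in simp)
      qed simp
      define D' where "D' = {d\<in>D. int p dvd R D d}"
      have "char_mod p D (R D)"
        unfolding char_mod_def
      proof (intro ballI)
        fix a b assume ab: "a \<in> D" "b \<in> D"
        have "D #> a = D" using rcos_eq_self_iff[OF sD] ab by simp
        then show "[R D (a \<otimes> b) = R D a + R D b] (mod int p)" using R[OF D.subset, of a b] ab by simp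
      qed
      then have po: "p_open p (carrier G) D'" unfolding D'_def by (rule p_open.step[OF less.prems])
      have "coin D' \<subset> coin D"
      proof
        show "coin D' \<subseteq> coin D" by (auto simp: coin_def D'_def)
        have dD: "v i \<otimes> inv (v j) \<in> D" using ij by (simp add: coin_def)
        have "D #> (v i \<otimes> inv (v j)) = D" using rcos_eq_self_iff[OF sD] dD by simp
        then have "R D (v i \<otimes> inv (v j) \<otimes> v j) = R D (v i \<otimes> inv (v j)) + R D (v j)"
          using R[OF D.subset, of "v i \<otimes> inv (v j)" "v j"] vG by simp
        moreover have "v i \<otimes> inv (v j) \<otimes> v j = v i" using vG by (simp add: group_normalize)
        ultimately have "R D (v i \<otimes> inv (v j)) = - \<epsilon> i" using Rv[of j] i by simp
        then have "\<not> int p dvd R D (v i \<otimes> inv (v j))"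
          using \<epsilon>i prime_gt_1_nat[OF p] by (auto simp: zdvd_not_zless)
        then have "(i, j) \<notin> coin D'" by (simp add: coin_def D'_def)
        then show "coin D' \<noteq> coin D" using ij by blast
      qed
      then have "card (coin D') < card (coin D)" using fin by (rule psubset_card_mono[rotated])
      then show ?thesis using less.hyps po by blast
    qed
  qed
  from this[OF p_open.base] obtain D where D: "p_open p (carrier G) D" "coin D = {}" by blast
  have "n > 0"
  proof (rule ccontr)
    assume "\<not> n > 0"
    then show False using vn v0 w(2) by simp
  qed
  then have "v 0 \<otimes> inv (v n) \<notin> D" using D(2) by (auto simp: coin_def)
  then have "inv w \<notin> D" using v0 vn w by simp
  then have "w \<notin> D" using p_open_subgroup[OF D(1) subgroup_self] subgroup.m_inv_closed by metis
  then show ?thesis using D(1) by blast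
qed

end

section \<open>Retractions onto subgroups generated inside a ball\<close>

context based_free_group
begin

text \<open>
  The ball of radius \<open>n\<close> around \<open>\<one>\<close> in the Cayley graph.
\<close>
definition word_ball :: "nat \<Rightarrow> 'a set" where
  "word_ball n = {word_val G w | w. fst ` set w \<subseteq> X \<and> length w \<le> n}"

lemma word_ball_carrier: "word_ball n \<subseteq> carrier G"
  using X_carrier word_val_closed by (fastforce simp: word_ball_def)

lemma one_in_word_ball: "\<one> \<in> word_ball n"
  unfolding word_ball_def by (rule CollectI, rule exI[of _ "[]"]) simp

lemma finite_word_ball:
  assumes "finite X"
  shows "finite (word_ball n)"
proof -
  have "{w :: ('a \<times> bool) list. fst ` set w \<subseteq> X \<and> length w \<le> n} \<subseteq> {w. set w \<subseteq> X \<times> UNIV \<and> length w \<le> n}" by force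
  then have "finite {w :: ('a \<times> bool) list. fst ` set w \<subseteq> X \<and> length w \<le> n}"
    by (rule finite_subset) (use finite_lists_length_le[of "X \<times> (UNIV :: bool set)" n] assms in simp)
  moreover have "word_ball n = word_val G ` {w. fst ` set w \<subseteq> X \<and> length w \<le> n}" by (auto simp: word_ball_def)
  ultimately show ?thesis by simp
qed

lemma finite_subset_word_ball:
  assumes "finite S" "S \<subseteq> carrier G"
  shows "\<exists>n. S \<subseteq> word_ball n"
proof -
  have "S \<subseteq> word_ball (Max (insert 0 ((\<lambda>s. length (nf s)) ` S)))"
  proof
    fix s assume s: "s \<in> S"
    then have "s \<in> carrier G" using assms(2) by blast
    then have "word_val G (nf s) = s" "fst ` set (nf s) \<subseteq> X" using nf_val nf_over by auto
    moreover have "length (nf s) \<le> Max (insert 0 ((\<lambda>s. length (nf s)) ` S))"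
      using assms(1) s by (intro Max_ge) auto
    ultimately show "s \<in> word_ball (Max (insert 0 ((\<lambda>s. length (nf s)) ` S)))"
      unfolding word_ball_def by (intro CollectI exI[of _ "nf s"]) simp
  qed
  then show ?thesis by blast
qed

text \<open>
  The Schreier generator of an edge \<open>(c, x)\<close> of the coset graph of \<open>U\<close> is \<open>t(c) x t(c x)\<inverse>\<close>.  The
  edge is labelled by this element if it lies in \<open>A\<close>, and otherwise by an element of \<open>A\<close> congruent
  to it modulo \<open>T\<close>.  The resulting homomorphism is the identity on the generators of \<open>A\<close>, because
  the paths of elements of the ball run through edges of the first kind only.
\<close>
lemma retraction_exists:
  fixes n :: nat
  assumes U: "subgroup U G" and T: "T \<lhd> G" and TU: "T \<subseteq> U"
    and A_def: "A = generate G {a \<otimes> inv b | a b. a \<in> word_ball n \<and> b \<in> word_ball n \<and> a \<otimes> inv b \<in> U}"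
    and UA: "U \<subseteq> A <#> T"
  shows "\<exists>r. (\<forall>u\<in>U. r u \<in> A) \<and> (\<forall>u\<in>U. \<forall>v\<in>U. r (u \<otimes> v) = r u \<otimes> r v) \<and>
    (\<forall>a\<in>A. r a = a) \<and> (\<forall>u\<in>U. inv u \<otimes> r u \<in> T)"
proof -
  interpret U: subgroup U G by fact
  interpret T: normal T G by fact
  have gens: "{a \<otimes> inv b | a b. a \<in> word_ball n \<and> b \<in> word_ball n \<and> a \<otimes> inv b \<in> U} \<subseteq> carrier G"
    using word_ball_carrier by blast
  have sA: "subgroup A G" unfolding A_def by (rule generate_is_subgroup[OF gens])
  interpret A: subgroup A G by fact
  have AU: "A \<subseteq> U" unfolding A_def by (rule generate_subgroup_incl[OF _ U]) blast
  have genA: "a \<otimes> inv b \<in> A" if "a \<in> word_ball n" "b \<in> word_ball n" "U #> a = U #> b" for a b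
  proof -
    have "a \<in> carrier G" "b \<in> carrier G" using that word_ball_carrier by blast+
    then have "a \<otimes> inv b \<in> U" using rcos_eq_iff[OF U] that(3) by blast
    then show ?thesis unfolding A_def using that by (intro generate.incl) blast
  qed
  \<comment> \<open>coset representatives, chosen in the ball whenever possible\<close>
  define C where "C = (#>) U ` carrier G"
  define t where "t c = (if c = U then \<one> else if c \<in> (#>) U ` word_ball n
      then (SOME g. g \<in> word_ball n \<and> U #> g = c) else (SOME g. g \<in> carrier G \<and> U #> g = c))" for c
  have t1: "t U = \<one>" by (simp add: t_def)
  have tb: "t c \<in> word_ball n \<and> U #> t c = c" if "c \<in> (#>) U ` word_ball n" for c
  proof (cases "c = U")
    case True
    then show ?thesis using one_in_word_ball U.subset by (simp add: t_def)
  next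
    case False
    have "(SOME g. g \<in> word_ball n \<and> U #> g = c) \<in> word_ball n \<and> U #> (SOME g. g \<in> word_ball n \<and> U #> g = c) = c"
      by (rule someI_ex) (use that in auto)
    then show ?thesis using False that by (simp add: t_def)
  qed
  have tC: "t c \<in> carrier G \<and> U #> t c = c" if "c \<in> C" for c
  proof (cases "c = U \<or> c \<in> (#>) U ` word_ball n")
    case True
    then show ?thesis using tb[of c] word_ball_carrier t1 U.subset by auto
  next
    case False
    have "(SOME g. g \<in> carrier G \<and> U #> g = c) \<in> carrier G \<and> U #> (SOME g. g \<in> carrier G \<and> U #> g = c) = c"
      by (rule someI_ex) (use that in \<open>auto simp: C_def\<close>)
    then show ?thesis using False by (simp add: t_def)
  qed
  have tG: "t c \<in> carrier G" if "c \<in> C" for c using tC[OF that] by simp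
  have UC: "U \<in> C" using U.subset by (auto simp: C_def intro!: image_eqI[of _ _ "\<one>"])
  have CG: "c \<subseteq> carrier G" if "c \<in> C" for c
    using tC[OF that] r_coset_subset_G[OF U.subset] by metis
  have act: "c #> g \<in> C" if c: "c \<in> C" and g: "g \<in> carrier G" for c g
  proof -
    have "c #> g = U #> (t c \<otimes> g)" using coset_mult_assoc[OF U.subset tG[OF c] g] tC[OF c] by simp
    then show ?thesis using tG[OF c] g by (auto simp: C_def)
  qed
  define s where "s c g = t c \<otimes> g \<otimes> inv (t (c #> g))" for c g
  have sU: "s c g \<in> U" if c: "c \<in> C" and g: "g \<in> carrier G" for c g
  proof -
    have "U #> (t c \<otimes> g) = U #> t (c #> g)"
      using coset_mult_assoc[OF U.subset tG[OF c] g] tC[OF c] tC[OF act[OF c g]] by simp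
    then show ?thesis unfolding s_def
      using rcos_eq_iff[OF U, of "t c \<otimes> g" "t (c #> g)"] tG[OF c] tG[OF act[OF c g]] g by simp
  qed
  have s_mult: "s c (g \<otimes> h) = s c g \<otimes> s (c #> g) h"
    if c: "c \<in> C" and g: "g \<in> carrier G" and h: "h \<in> carrier G" for c g h
    using tG[OF c] tG[OF act[OF c g]] tG[OF act[OF act[OF c g] h]] g h coset_mult_assoc[OF CG[OF c] g h]
    by (simp add: s_def group_normalize)
  define \<rho> where "\<rho> c x = (if s c x \<in> A then s c x else if \<exists>a\<in>A. inv (s c x) \<otimes> a \<in> T
      then (SOME a. a \<in> A \<and> inv (s c x) \<otimes> a \<in> T) else \<one>)" for c x
  have \<rho>: "\<rho> c x \<in> A \<and> inv (s c x) \<otimes> \<rho> c x \<in> T" if c: "c \<in> C" and x: "x \<in> carrier G" for c x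
  proof (cases "s c x \<in> A")
    case True
    then show ?thesis by (simp add: \<rho>_def)
  next
    case False
    obtain a w where aw: "a \<in> A" "w \<in> T" "s c x = a \<otimes> w"
      using sU[OF c x] UA unfolding set_mult_def by blast
    then have "inv (s c x) \<otimes> a = inv w" by (simp add: group_normalize)
    then have ex: "\<exists>a. a \<in> A \<and> inv (s c x) \<otimes> a \<in> T" using aw by auto
    have "(SOME a. a \<in> A \<and> inv (s c x) \<otimes> a \<in> T) \<in> A \<and> inv (s c x) \<otimes> (SOME a. a \<in> A \<and> inv (s c x) \<otimes> a \<in> T) \<in> T"
      by (rule someI_ex[OF ex])
    then show ?thesis using False ex by (auto simp: \<rho>_def)
  qed
  have \<rho>A: "\<rho> c x \<in> A" for c x
  proof (cases "\<exists>a\<in>A. inv (s c x) \<otimes> a \<in> T")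
    case True
    then have "(SOME a. a \<in> A \<and> inv (s c x) \<otimes> a \<in> T) \<in> A"
      by (metis (mono_tags, lifting) someI_ex)
    then show ?thesis using True by (simp add: \<rho>_def)
  qed (simp add: \<rho>_def)
  have grA: "group (G\<lparr>carrier := A\<rparr>)" by (rule subgroup_imp_group[OF sA])
  obtain R where RA: "\<And>c g. c \<subseteq> carrier G \<Longrightarrow> g \<in> carrier G \<Longrightarrow> R c g \<in> A"
    and R: "\<And>c g h. c \<subseteq> carrier G \<Longrightarrow> g \<in> carrier G \<Longrightarrow> h \<in> carrier G \<Longrightarrow>
       R c (g \<otimes> h) = R c g \<otimes> R (c #> g) h"
    and R\<rho>: "\<And>c x. c \<subseteq> carrier G \<Longrightarrow> x \<in> X \<Longrightarrow> R c x = \<rho> c x"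
    using cocycle_exists[OF grA, of \<rho>] \<rho>A by auto
  have RG: "R c g \<in> carrier G" if "c \<subseteq> carrier G" "g \<in> carrier G" for c g using RA[OF that] by simp
  have R1: "R c \<one> = \<one>" if "c \<subseteq> carrier G" for c
    using R[OF that, of \<one> \<one>] RG[OF that one_closed] that by simp
  have s1: "s c \<one> = \<one>" if "c \<in> C" for c using tG[OF that] CG[OF that] by (simp add: s_def)
  have ret: "c #> inv x #> x = c" if "c \<in> C" "x \<in> carrier G" for c x
    using coset_mult_assoc[OF CG[OF that(1)], of "inv x" x] that CG by simp
  have R_inv: "R c (inv x) = inv (R (c #> inv x) x)" if c: "c \<in> C" and x: "x \<in> carrier G" for c x
  proof -
    have "R c (inv x \<otimes> x) = R c (inv x) \<otimes> R (c #> inv x) x" by (rule R[OF CG[OF c]]) (use x in auto)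
    then have "R c (inv x) \<otimes> R (c #> inv x) x = \<one>" using R1[OF CG[OF c]] x by simp
    then show ?thesis
      by (rule inv_equality[symmetric])
        (use RG[OF CG[OF c], of "inv x"] RG[OF CG[OF act[OF c inv_closed[OF x]]] x] x in auto)
  qed
  have s_inv: "s c (inv x) = inv (s (c #> inv x) x)" if c: "c \<in> C" and x: "x \<in> carrier G" for c x
    using tG[OF c] tG[OF act[OF c inv_closed[OF x]]] x ret[OF c x] by (simp add: s_def group_normalize)
  have letter: "inv (s c (letter_val G l)) \<otimes> R c (letter_val G l) \<in> T"
    if c: "c \<in> C" and l: "fst l \<in> X" for c l
  proof (cases "snd l")
    case True
    then show ?thesis using \<rho>[OF c] R\<rho>[OF CG[OF c] l] l X_carrier by (auto simp: letter_val_def)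
  next
    case False
    define x where "x = fst l"
    have x: "x \<in> X" "x \<in> carrier G" using l X_carrier by (auto simp: x_def)
    define c' where "c' = c #> inv x"
    have c': "c' \<in> C" unfolding c'_def using act[OF c] x by simp
    define \<sigma> where "\<sigma> = s c' x"
    define \<tau> where "\<tau> = inv \<sigma> \<otimes> R c' x"
    have \<tau>: "\<tau> \<in> T" unfolding \<tau>_def \<sigma>_def using \<rho>[OF c' x(2)] R\<rho>[OF CG[OF c'] x(1)] by simp
    have \<sigma>G: "\<sigma> \<in> carrier G" unfolding \<sigma>_def using sU[OF c' x(2)] by simp
    have Re: "R c' x = \<sigma> \<otimes> \<tau>" unfolding \<tau>_def using \<sigma>G RG[OF CG[OF c'] x(2)] by (simp add: group_normalize)
    have "inv (s c (inv x)) \<otimes> R c (inv x) = \<sigma> \<otimes> inv \<tau> \<otimes> inv \<sigma>"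
      unfolding R_inv[OF c x(2)] s_inv[OF c x(2)] c'_def[symmetric] Re \<sigma>_def[symmetric]
      using \<sigma>G \<tau> by (simp add: group_normalize)
    also have "\<dots> \<in> T" using \<sigma>G \<tau> by (intro T.inv_op_closed2) auto
    finally show ?thesis using False by (simp add: letter_val_def x_def)
  qed
  have cong_word: "inv (s c (word_val G w)) \<otimes> R c (word_val G w) \<in> T"
    if "fst ` set w \<subseteq> X" "c \<in> C" for w c
    using that
  proof (induction w arbitrary: c)
    case Nil
    then show ?case using s1 R1[OF CG] by simp
  next
    case (Cons l w)
    define g where "g = letter_val G l"
    define h where "h = word_val G w"
    have g: "g \<in> carrier G" unfolding g_def using Cons.prems X_carrier by (intro letter_val_closed) auto
    have h: "h \<in> carrier G" unfolding h_def using Cons.prems X_carrier by (intro word_val_closed) auto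
    have cg: "c #> g \<in> C" by (rule act[OF Cons.prems(2) g])
    define a where "a = s c g"
    define b where "b = s (c #> g) h"
    define u where "u = R c g"
    define v where "v = R (c #> g) h"
    have car: "a \<in> carrier G" "b \<in> carrier G" "u \<in> carrier G" "v \<in> carrier G"
      using sU[OF Cons.prems(2) g] sU[OF cg h] RG[OF CG[OF Cons.prems(2)] g] RG[OF CG[OF cg] h]
      by (auto simp: a_def b_def u_def v_def)
    have 1: "inv a \<otimes> u \<in> T" unfolding a_def u_def g_def using letter Cons.prems by auto
    have 2: "inv b \<otimes> v \<in> T" unfolding b_def v_def h_def using Cons.IH[OF _ cg] Cons.prems by auto
    have "inv (a \<otimes> b) \<otimes> (u \<otimes> v) = (inv b \<otimes> (inv a \<otimes> u) \<otimes> b) \<otimes> (inv b \<otimes> v)"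
      using car by (simp add: group_normalize)
    also have "\<dots> \<in> T" by (rule T.m_closed[OF T.inv_op_closed1[OF car(2) 1] 2])
    finally show ?case
      using s_mult[OF Cons.prems(2) g h] R[OF CG[OF Cons.prems(2)] g h]
      by (simp add: a_def b_def u_def v_def g_def h_def)
  qed
  have U_act: "U #> u = U" if "u \<in> U" for u using rcos_eq_self_iff[OF U] that by simp
  define r where "r u = R U u" for u
  have r_A: "r u \<in> A" if "u \<in> U" for u unfolding r_def using RA[OF U.subset] that by simp
  have r_hom: "r (u \<otimes> v) = r u \<otimes> r v" if "u \<in> U" "v \<in> U" for u v
    unfolding r_def using R[OF U.subset, of u v] U_act[OF that(1)] that by simp
  have r_T: "inv u \<otimes> r u \<in> T" if u: "u \<in> U" for u
  proof -
    have "s U u = u" using U_act[OF u] u by (simp add: s_def t1)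
    then show ?thesis using cong_word[OF nf_over UC, of u] nf_val[of u] u by (simp add: r_def)
  qed
  \<comment> \<open>inside the ball the labels are the Schreier generators themselves\<close>
  have ball_edge: "s (U #> q) x \<in> A" if q: "q \<in> word_ball n" "q \<otimes> x \<in> word_ball n" "x \<in> carrier G" for q x
  proof -
    have qG: "q \<in> carrier G" using q word_ball_carrier by blast
    have Uqx: "U #> q #> x = U #> (q \<otimes> x)" by (rule coset_mult_assoc[OF U.subset qG q(3)])
    have a: "t (U #> q) \<in> word_ball n \<and> U #> t (U #> q) = U #> q" using q by (intro tb) blast
    have b: "t (U #> (q \<otimes> x)) \<in> word_ball n \<and> U #> t (U #> (q \<otimes> x)) = U #> (q \<otimes> x)" using q by (intro tb) blast
    have "(t (U #> q) \<otimes> inv q) \<otimes> ((q \<otimes> x) \<otimes> inv (t (U #> (q \<otimes> x)))) \<in> A"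
      using genA[of "t (U #> q)" q] genA[of "q \<otimes> x" "t (U #> (q \<otimes> x))"] a b q by simp
    moreover have "t (U #> q) \<in> carrier G" "t (U #> (q \<otimes> x)) \<in> carrier G"
      using a b word_ball_carrier by blast+
    ultimately show ?thesis using qG q(3) by (simp add: s_def Uqx group_normalize)
  qed
  have exact_letter: "R (U #> q) (letter_val G l) = s (U #> q) (letter_val G l)"
    if q: "q \<in> word_ball n" "q \<otimes> letter_val G l \<in> word_ball n" and l: "fst l \<in> X" for q l
  proof -
    have x: "fst l \<in> carrier G" using l X_carrier by blast
    have qG: "q \<in> carrier G" using q word_ball_carrier by blast
    have c: "U #> q \<in> C" using qG by (simp add: C_def)
    show ?thesis
    proof (cases "snd l")
      case True
      then have "s (U #> q) (fst l) \<in> A" using ball_edge[OF q(1) _ x] q(2) by (simp add: letter_val_def)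
      then show ?thesis using True R\<rho>[OF CG[OF c] l] by (simp add: \<rho>_def letter_val_def)
    next
      case False
      define q' where "q' = q \<otimes> inv (fst l)"
      have q': "q' \<in> word_ball n" "q' \<otimes> fst l = q"
        using q(2) False qG x by (simp_all add: q'_def letter_val_def group_normalize)
      have Uq': "U #> q #> inv (fst l) = U #> q'"
        unfolding q'_def by (rule coset_mult_assoc[OF U.subset qG]) (use x in simp)
      have c': "U #> q' \<in> C" using q' word_ball_carrier by (auto simp: C_def)
      have "s (U #> q') (fst l) \<in> A" using ball_edge[OF q'(1) _ x] q'(2) q(1) by simp
      then have "R (U #> q') (fst l) = s (U #> q') (fst l)"
        using R\<rho>[OF CG[OF c'] l] by (simp add: \<rho>_def)
      then show ?thesis using False R_inv[OF c x] s_inv[OF c x] Uq' by (simp add: letter_val_def)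
    qed
  qed
  have exact: "R U (word_val G w) = word_val G w \<otimes> inv (t (U #> word_val G w))"
    if "fst ` set w \<subseteq> X" "length w \<le> n" for w
    using that
  proof (induction w rule: rev_induct)
    case Nil
    then show ?case using R1[OF U.subset] t1 U.subset by simp
  next
    case (snoc l w)
    define q where "q = word_val G w"
    define y where "y = letter_val G l"
    have l: "fst l \<in> X" "fst l \<in> carrier G" using snoc.prems X_carrier by auto
    have wX: "fst ` set w \<subseteq> X" using snoc.prems by auto
    then have wG: "fst ` set w \<subseteq> carrier G" using X_carrier by blast
    have yG: "y \<in> carrier G" unfolding y_def by (rule letter_val_closed[OF l(2)])
    have val: "word_val G (w @ [l]) = q \<otimes> y"
      using wG l yG by (simp add: word_val_append q_def y_def)
    have q: "q \<in> word_ball n" unfolding q_def word_ball_def using snoc.prems wX by fastforce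
    have qy: "q \<otimes> y \<in> word_ball n" unfolding val[symmetric] word_ball_def using snoc.prems by blast
    have qG: "q \<in> carrier G" using q word_ball_carrier by blast
    have c: "U #> q \<in> C" using qG by (simp add: C_def)
    have c2: "U #> (q \<otimes> y) \<in> C" using qG yG by (simp add: C_def)
    have "R U (q \<otimes> y) = R U q \<otimes> R (U #> q) y" by (rule R[OF U.subset qG yG])
    also have "R U q = q \<otimes> inv (t (U #> q))" unfolding q_def using snoc by auto
    also have "R (U #> q) y = t (U #> q) \<otimes> y \<otimes> inv (t (U #> (q \<otimes> y)))"
      using exact_letter[OF q _ l(1)] qy coset_mult_assoc[OF U.subset qG yG]
      unfolding y_def[symmetric] by (simp add: s_def)
    also have "q \<otimes> inv (t (U #> q)) \<otimes> (t (U #> q) \<otimes> y \<otimes> inv (t (U #> (q \<otimes> y))))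
        = q \<otimes> y \<otimes> inv (t (U #> (q \<otimes> y)))"
      using qG yG tG[OF c] tG[OF c2] by (simp add: group_normalize)
    finally show ?case unfolding val .
  qed
  have r_one: "r \<one> = \<one>" unfolding r_def by (rule R1[OF U.subset])
  have r_inv: "r (inv u) = inv (r u)" if u: "u \<in> U" for u
  proof -
    have "r (inv u) \<otimes> r u = \<one>" using r_hom[of "inv u" u] u r_one by simp
    then show ?thesis
      by (rule inv_equality[symmetric]) (use r_A[of "inv u"] r_A[OF u] u in auto)
  qed
  have r_gen: "r h = h" if h: "h \<in> {a \<otimes> inv b | a b. a \<in> word_ball n \<and> b \<in> word_ball n \<and> a \<otimes> inv b \<in> U}" for h
  proof -
    obtain a b where ab: "h = a \<otimes> inv b" "a \<in> word_ball n" "b \<in> word_ball n" "a \<otimes> inv b \<in> U" using h by blast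
    have car: "a \<in> carrier G" "b \<in> carrier G" using ab word_ball_carrier by blast+
    have eq: "U #> a = U #> b" using rcos_eq_iff[OF U car] ab(4) by simp
    have Ra: "R U a = a \<otimes> inv (t (U #> a))" and Rb: "R U b = b \<otimes> inv (t (U #> a))"
      using exact ab(2,3) eq unfolding word_ball_def by auto
    have tc: "t (U #> a) \<in> carrier G" by (rule tG) (use car in \<open>simp add: C_def\<close>)
    have "R U (h \<otimes> b) = R U h \<otimes> R (U #> h) b"
      by (rule R[OF U.subset]) (use ab car in auto)
    then have "a \<otimes> inv (t (U #> a)) = r h \<otimes> (b \<otimes> inv (t (U #> a)))"
      using U_act ab car Ra Rb by (simp add: r_def group_normalize)
    then have "a \<otimes> inv (t (U #> a)) \<otimes> (t (U #> a) \<otimes> inv b) = r h \<otimes> (b \<otimes> inv (t (U #> a))) \<otimes> (t (U #> a) \<otimes> inv b)"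
      by simp
    moreover have "r h \<in> carrier G" using r_A[of h] ab by simp
    ultimately show ?thesis using car tc by (simp add: ab(1) group_normalize)
  qed
  have r_id: "r a = a" if "a \<in> A" for a
    using that unfolding A_def
  proof (induction rule: generate.induct)
    case one
    show ?case by (rule r_one)
  next
    case (incl h)
    then show ?case by (rule r_gen)
  next
    case (inv h)
    then have "h \<in> U" "r h = h" using r_gen by blast+
    then show ?case using r_inv by simp
  next
    case (eng g h)
    then have "g \<in> U" "h \<in> U" using AU unfolding A_def by blast+
    then show ?case using r_hom eng.IH by simp
  qed
  show ?thesis using r_A r_hom r_id r_T by blast
qed

end

context group
begin

text \<open>
  The closure of \<open>H\<close> in the topology of quotients that are \<open>p\<close>-groups by abelian groups of
  exponent dividing \<open>p - 1\<close>.
\<close>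
definition prime_closure :: "nat \<Rightarrow> 'a set \<Rightarrow> 'a set" where
  "prime_closure p H = {x\<in>carrier G. \<forall>T. T \<lhd> G \<longrightarrow> p_open p (pow_comm (p - 1)) T \<longrightarrow> x \<in> H <#> T}"

lemma subset_set_mult_subgroup:
  assumes "H \<subseteq> carrier G" "subgroup T G"
  shows "H \<subseteq> H <#> T"
proof
  fix h assume h: "h \<in> H"
  then have "h \<otimes> \<one> \<in> H <#> T" using subgroup.one_closed[OF assms(2)] unfolding set_mult_def by blast
  then show "h \<in> H <#> T" using h assms(1) by auto
qed

lemma subgroup_set_mult_subset:
  assumes "subgroup H G" "T \<subseteq> carrier G"
  shows "T \<subseteq> H <#> T"
proof
  fix t assume t: "t \<in> T"
  then have "\<one> \<otimes> t \<in> H <#> T" using subgroup.one_closed[OF assms(1)] unfolding set_mult_def by blast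
  then show "t \<in> H <#> T" using t assms(2) by auto
qed

lemma subset_prime_closure:
  assumes "H \<subseteq> carrier G"
  shows "H \<subseteq> prime_closure p H"
  using assms subset_set_mult_subgroup[OF assms normal_imp_subgroup] by (auto simp: prime_closure_def)

lemma prime_closure_subgroup:
  assumes "subgroup H G"
  shows "subgroup (prime_closure p H) G"
proof (rule subgroupI)
  show "prime_closure p H \<subseteq> carrier G" by (auto simp: prime_closure_def)
  show "prime_closure p H \<noteq> {}"
    using subset_prime_closure[OF subgroup.subset[OF assms], of p] subgroup.one_closed[OF assms] by blast
  fix a assume a: "a \<in> prime_closure p H"
  show "inv a \<in> prime_closure p H"
    using a subgroup.m_inv_closed[OF normal_set_mult_is_subgroup[OF assms]]
    by (auto simp: prime_closure_def)
  fix b assume b: "b \<in> prime_closure p H"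
  show "a \<otimes> b \<in> prime_closure p H"
    using a b subgroup.m_closed[OF normal_set_mult_is_subgroup[OF assms]]
    by (auto simp: prime_closure_def)
qed

lemma prime_closure_finite_avoid:
  assumes "finite B" "B \<subseteq> carrier G" "B \<inter> prime_closure p H = {}"
  shows "\<exists>T. T \<lhd> G \<and> p_open p (pow_comm (p - 1)) T \<and> B \<inter> (H <#> T) = {}"
  using assms
proof (induction B rule: finite_induct)
  case empty
  then show ?case using pow_comm_normal p_open.base by blast
next
  case (insert b B)
  then obtain T where T: "T \<lhd> G" "p_open p (pow_comm (p - 1)) T" "B \<inter> (H <#> T) = {}" by auto
  obtain T' where T': "T' \<lhd> G" "p_open p (pow_comm (p - 1)) T'" "b \<notin> H <#> T'"
    using insert.prems unfolding prime_closure_def by blast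
  have "H <#> (T \<inter> T') \<subseteq> H <#> T" "H <#> (T \<inter> T') \<subseteq> H <#> T'"
    using mono_set_mult[of H H "T \<inter> T'" T G] mono_set_mult[of H H "T \<inter> T'" T' G] by simp_all
  then have "insert b B \<inter> (H <#> (T \<inter> T')) = {}" using T(3) T'(3) by blast
  then show ?case
    using normal_subgroup_intersect[OF T(1) T'(1)] p_open_Int[OF T(2) T'(2)] by blast
qed

end

context based_free_group
begin

text \<open>
  If \<open>D\<close> separates \<open>y = x\<inverse> r(x)\<close> from \<open>\<one>\<close>, then \<open>x\<close> is not in \<open>A E\<close> for
  \<open>E = {t \<in> T \<inter> D. r(t) \<in> D}\<close>: from \<open>x = a e\<close> it would follow that \<open>y = e\<inverse> r(e) \<in> D\<close>.
\<close>
lemma retract_closed: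
  assumes p: "prime p" and S: "finite S" "S \<subseteq> carrier G" "generate G S = carrier G"
    and T: "T \<lhd> G" "p_open p (pow_comm (p - 1)) T" and TU: "T \<subseteq> U"
    and rA: "\<And>u. u \<in> U \<Longrightarrow> r u \<in> A" and r_hom: "\<And>u v. u \<in> U \<Longrightarrow> v \<in> U \<Longrightarrow> r (u \<otimes> v) = r u \<otimes> r v"
    and r_id: "\<And>a. a \<in> A \<Longrightarrow> r a = a" and r_T: "\<And>u. u \<in> U \<Longrightarrow> inv u \<otimes> r u \<in> T"
    and A: "subgroup A G" and AU: "A \<subseteq> U" and U: "subgroup U G" and x: "x \<in> U" "x \<notin> A"
  shows "\<exists>T'. T' \<lhd> G \<and> p_open p (pow_comm (p - 1)) T' \<and> x \<notin> A <#> T'"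
proof -
  let ?N = "pow_comm (p - 1)"
  interpret T: normal T G by fact
  interpret A: subgroup A G by fact
  interpret U: subgroup U G by fact
  have p1: "p > 1" using prime_gt_1_nat[OF p] .
  define y where "y = inv x \<otimes> r x"
  have rx: "r x \<in> A" by (rule rA[OF x(1)])
  have y: "y \<in> carrier G" "y \<noteq> \<one>"
  proof -
    show "y \<in> carrier G" unfolding y_def using x rx by simp
    have "x = r x" if "y = \<one>"
      using that x(1) rx unfolding y_def by (metis A.mem_carrier U.mem_carrier inv_closed inv_equality inv_inv)
    then show "y \<noteq> \<one>" using rx x(2) by auto
  qed
  obtain D where D: "p_open p (carrier G) D" "y \<notin> D" using separate_by_p_open[OF p y] by blast
  have sD: "subgroup D G" by (rule p_open_subgroup[OF D(1) subgroup_self])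
  have E1: "p_open p T (T \<inter> D)" by (rule p_open_restrict[OF D(1) T.subset])
  have E2: "p_open p T {t\<in>T. r t \<in> T \<inter> D}"
  proof (rule p_open_vimage[OF E1])
    show "r ` T \<subseteq> T"
    proof
      fix z assume "z \<in> r ` T"
      then obtain t where t: "t \<in> T" "z = r t" by blast
      have tU: "t \<in> U" using t TU by blast
      have "t \<otimes> (inv t \<otimes> r t) \<in> T" using t r_T[OF tU] by simp
      then show "z \<in> T" using t rA[OF tU] by (simp add: group_normalize)
    qed
    show "r (a \<otimes> b) = r a \<otimes> r b" if "a \<in> T" "b \<in> T" for a b
      using r_hom[of a b] that TU by blast
  qed
  define E where "E = (T \<inter> D) \<inter> {t\<in>T. r t \<in> T \<inter> D}"
  have po: "p_open p ?N E" unfolding E_def by (rule p_open_trans[OF p_open_Int[OF E1 E2] T(2)])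
  have "fin_index E"
    by (rule fin_index_p_open[OF po pow_comm_subgroup su_open_fin_index[OF su_open_pow_comm[OF S]]]) (use p1 in auto)
  from p_open_core[OF po pow_comm_normal this]
  obtain T' where T': "T' \<lhd> G" "p_open p ?N T'" "T' \<subseteq> E" by blast
  have "x \<notin> A <#> T'"
  proof
    assume "x \<in> A <#> T'"
    then obtain a e where ae: "a \<in> A" "e \<in> E" "x = a \<otimes> e" using T'(3) unfolding set_mult_def by blast
    have e: "e \<in> T" "e \<in> D" "r e \<in> D" "e \<in> U" using ae(2) TU by (auto simp: E_def)
    have aU: "a \<in> U" using ae(1) AU by blast
    have "r x = a \<otimes> r e" using r_hom[OF aU e(4)] r_id[OF ae(1)] ae(3) by simp
    then have "y = inv e \<otimes> r e"
      unfolding y_def using ae(1,3) e rA[OF e(4)] by (simp add: group_normalize)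
    moreover have "inv e \<otimes> r e \<in> D" using e sD by (simp add: subgroup.m_closed subgroup.m_inv_closed)
    ultimately show False using D(2) by simp
  qed
  then show ?thesis using T' by blast
qed

text \<open>
  A subgroup generated by part of the finite set \<open>{a b\<inverse>. a, b \<in> P}\<close>, where \<open>P\<close> is the ball of
  radius \<open>n\<close>; the bound \<open>n\<close> does not depend on \<open>p\<close>.
\<close>
theorem prime_closure_eq_generate:
  assumes p: "prime p" and X: "finite X"
    and S: "finite S" "S \<subseteq> carrier G" "generate G S = carrier G"
    and H: "subgroup H G" "generate G B = H" "B \<subseteq> word_ball n"
  shows "prime_closure p H = generate G (prime_closure p H \<inter> {a \<otimes> inv b | a b. a \<in> word_ball n \<and> b \<in> word_ball n})"
proof
  let ?N = "pow_comm (p - 1)"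
  let ?Q = "{a \<otimes> inv b | a b. a \<in> word_ball n \<and> b \<in> word_ball n}"
  let ?C = "prime_closure p H"
  interpret H: subgroup H G by (rule H(1))
  have sC: "subgroup ?C G" by (rule prime_closure_subgroup[OF H(1)])
  define A where "A = generate G (?C \<inter> ?Q)"
  have QG: "?Q \<subseteq> carrier G" using word_ball_carrier by blast
  show "generate G (?C \<inter> ?Q) \<subseteq> ?C" by (rule generate_subgroup_incl[OF _ sC]) blast
  have "finite ?Q"
  proof -
    have "?Q = (\<lambda>(a, b). a \<otimes> inv b) ` (word_ball n \<times> word_ball n)" by auto
    then show ?thesis using finite_word_ball[OF X] by simp
  qed
  then have "finite (?Q - ?C)" by simp
  then obtain T where T: "T \<lhd> G" "p_open p ?N T" "(?Q - ?C) \<inter> (H <#> T) = {}"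
    using prime_closure_finite_avoid[of "?Q - ?C" p H] QG by blast
  interpret T: normal T G by (rule T(1))
  define U where "U = H <#> T"
  have sU: "subgroup U G" unfolding U_def by (rule normal_set_mult_is_subgroup[OF H(1) T(1)])
  have CU: "?C \<subseteq> U" using T(1,2) unfolding U_def prime_closure_def by blast
  have TU: "T \<subseteq> U" unfolding U_def by (rule subgroup_set_mult_subset[OF H(1) T.subset])
  have QU: "?Q \<inter> U = ?C \<inter> ?Q" using T(3) CU unfolding U_def by blast
  have A_alt: "A = generate G {a \<otimes> inv b | a b. a \<in> word_ball n \<and> b \<in> word_ball n \<and> a \<otimes> inv b \<in> U}"
  proof -
    have "{a \<otimes> inv b | a b. a \<in> word_ball n \<and> b \<in> word_ball n \<and> a \<otimes> inv b \<in> U} = ?Q \<inter> U" by blast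
    then show ?thesis unfolding A_def QU by simp
  qed
  have sA: "subgroup A G" unfolding A_def by (rule generate_is_subgroup) (use QG in blast)
  have AU: "A \<subseteq> U"
    unfolding A_def by (rule generate_subgroup_incl[OF _ sU]) (use CU in blast)
  have HA: "H \<subseteq> A"
    unfolding H(2)[symmetric]
  proof (rule generate_subgroup_incl[OF _ sA])
    show "B \<subseteq> A"
    proof
      fix b assume b: "b \<in> B"
      have bG: "b \<in> carrier G" using b H(3) word_ball_carrier by blast
      have "b \<otimes> inv \<one> \<in> ?Q" using b H(3) one_in_word_ball by blast
      then have bQ: "b \<in> ?Q" using bG by simp
      have "b \<in> H" using b H(2) generate.incl by fast
      then have "b \<in> ?C" using subset_prime_closure[OF H.subset] by blast
      then show "b \<in> A" unfolding A_def using bQ by (intro generate.incl) blast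
    qed
  qed
  have UA: "U \<subseteq> A <#> T" unfolding U_def by (rule mono_set_mult[OF HA order_refl])
  obtain r where r: "\<And>u. u \<in> U \<Longrightarrow> r u \<in> A" "\<And>u v. u \<in> U \<Longrightarrow> v \<in> U \<Longrightarrow> r (u \<otimes> v) = r u \<otimes> r v"
    "\<And>a. a \<in> A \<Longrightarrow> r a = a" "\<And>u. u \<in> U \<Longrightarrow> inv u \<otimes> r u \<in> T"
    using retraction_exists[OF sU T(1) TU A_alt UA] by blast
  show "?C \<subseteq> generate G (?C \<inter> ?Q)"
  proof
    fix x assume x: "x \<in> ?C"
    show "x \<in> generate G (?C \<inter> ?Q)"
    proof (rule ccontr)
      assume "x \<notin> generate G (?C \<inter> ?Q)"
      then have xA: "x \<notin> A" by (simp add: A_def)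
      have xU: "x \<in> U" using x CU by blast
      obtain T' where T': "T' \<lhd> G" "p_open p ?N T'" "x \<notin> A <#> T'"
        using retract_closed[OF p S T(1,2) TU r sA AU sU xU xA] by blast
      have "x \<in> H <#> T'" using x T'(1,2) unfolding prime_closure_def by blast
      then show False using T'(3) mono_set_mult[OF HA order_refl[of T'], of G] by blast
    qed
  qed
qed

end

section \<open>Intersections of finitely generated subgroups\<close>

lemma finite_image_same_kernel:
  assumes "finite (f ` A)" "\<And>a b. a \<in> A \<Longrightarrow> b \<in> A \<Longrightarrow> f a = f b \<Longrightarrow> g a = g b"
  shows "finite (g ` A)"
proof -
  have "g ` A \<subseteq> (\<lambda>y. g (inv_into A f y)) ` f ` A"
  proof
    fix y assume "y \<in> g ` A"
    then obtain a where a: "a \<in> A" "y = g a" by blast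
    then have "g (inv_into A f (f a)) = g a"
      using assms(2)[of "inv_into A f (f a)" a] by (simp add: f_inv_into_f inv_into_into)
    then show "y \<in> (\<lambda>y. g (inv_into A f y)) ` f ` A" using a by (metis image_eqI)
  qed
  then show ?thesis using assms(1) finite_subset by blast
qed

context group
begin

lemma prefix_vals_shift:
  assumes "g \<in> carrier G" "h \<in> carrier G" "fst ` set w \<subseteq> carrier G"
  shows "prefix_vals G w (g \<otimes> h) = (\<otimes>) g ` prefix_vals G w h"
  using assms
proof (induction w arbitrary: h)
  case (Cons l w)
  then show ?case by (simp add: letter_val_closed m_assoc)
qed simp

lemma prefix_vals_end:
  assumes "g \<in> carrier G" "fst ` set w \<subseteq> carrier G"
  shows "g \<otimes> word_val G w \<in> prefix_vals G w g"
  using assms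
proof (induction w arbitrary: g)
  case (Cons l w)
  then have "g \<otimes> letter_val G l \<otimes> word_val G w \<in> prefix_vals G w (g \<otimes> letter_val G l)"
    by (simp add: letter_val_closed)
  then show ?case using Cons.prems by (simp add: letter_val_closed word_val_closed m_assoc)
qed simp

lemma prefix_vals_closed:
  assumes "g \<in> carrier G" "fst ` set w \<subseteq> carrier G"
  shows "prefix_vals G w g \<subseteq> carrier G"
  using assms
proof (induction w arbitrary: g)
  case (Cons l w)
  then show ?case by (simp add: letter_val_closed)
qed simp

end

context based_free_group
begin

lemma prefix_vals_word_ball:
  assumes "fst ` set u \<subseteq> X" "fst ` set w \<subseteq> X" "length u + length w \<le> n"
  shows "prefix_vals G w (word_val G u) \<subseteq> word_ball n"
  using assms
proof (induction w arbitrary: u)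
  case Nil
  then show ?case by (auto simp: word_ball_def)
next
  case (Cons l w)
  have u: "fst ` set u \<subseteq> carrier G" "fst l \<in> carrier G" using Cons.prems X_carrier by auto
  have "word_val G (u @ [l]) = word_val G u \<otimes> letter_val G l"
    using u by (simp add: word_val_append letter_val_closed)
  moreover have "prefix_vals G w (word_val G (u @ [l])) \<subseteq> word_ball n"
    by (rule Cons.IH) (use Cons.prems in auto)
  moreover have "word_val G u \<in> word_ball n" using Cons.prems unfolding word_ball_def by fastforce
  ultimately show ?case by simp
qed

text \<open>
  The values of the prefixes of the reduced words of elements of \<open>A\<close>.  Their \<open>A\<close>-cosets are the
  vertices of the core of the Schreier graph of \<open>A\<close>; the subgroup is finitely generated if and
  only if the core is finite (lemmas \<open>finite_core\<close> and \<open>fin_gen_of_finite_core\<close>).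
\<close>
definition prefixes :: "'a set \<Rightarrow> 'a set" where
  "prefixes A = (\<Union>a\<in>A. prefix_vals G (nf a) \<one>)"

lemma prefixes_closed: "A \<subseteq> carrier G \<Longrightarrow> prefixes A \<subseteq> carrier G"
  unfolding prefixes_def
  by (intro UN_least prefix_vals_closed one_closed nf_over_carrier) (rule subsetD)

text \<open>
  An element of \<open>A\<close> is represented by a concatenation of reduced words of generators and their
  inverses, whose prefixes stay in the cosets of a ball.  Free reduction creates no new prefix
  values.
\<close>
lemma finite_core:
  assumes X: "finite X" and A: "fin_gen_subgroup A G"
  shows "finite ((#>) A ` prefixes A)"
proof -
  obtain S where S: "finite S" "S \<subseteq> A" "generate G S = A" and sA: "subgroup A G"
    using A unfolding fin_gen_subgroup_def by blast
  interpret A: subgroup A G by fact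
  have SG: "S \<subseteq> carrier G" using S(2) A.subset by blast
  define S' where "S' = S \<union> (\<lambda>s. inv s) ` S"
  have "finite S'" "S' \<subseteq> carrier G" using S(1) SG by (auto simp: S'_def)
  define n where "n = Max (insert 0 ((\<lambda>s. length (nf s)) ` S'))"
  have n: "length (nf s) \<le> n" if "s \<in> S'" for s
    unfolding n_def using \<open>finite S'\<close> that by (intro Max_ge) auto
  have short: "prefix_vals G (nf s) \<one> \<subseteq> word_ball n" if "s \<in> S'" for s
    using prefix_vals_word_ball[of "[]" "nf s" n] n[OF that] nf_over that \<open>S' \<subseteq> carrier G\<close> by auto
  have "\<exists>w. fst ` set w \<subseteq> X \<and> word_val G w = a \<and> (\<forall>v\<in>prefix_vals G w \<one>. A #> v \<in> (#>) A ` word_ball n)"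
    if "a \<in> generate G S" for a
    using that
  proof (induction rule: generate.induct)
    case one
    show ?case using one_in_word_ball by (intro exI[of _ "[]"]) auto
  next
    case (incl s)
    then have "s \<in> S'" "s \<in> carrier G" using SG by (auto simp: S'_def)
    then show ?case using short[of s] nf_over nf_val by (intro exI[of _ "nf s"]) blast
  next
    case (inv s)
    then have "inv s \<in> S'" "inv s \<in> carrier G" using SG by (auto simp: S'_def)
    then show ?case using short[of "inv s"] nf_over nf_val by (intro exI[of _ "nf (inv s)"]) blast
  next
    case (eng a b)
    obtain u where u: "fst ` set u \<subseteq> X" "word_val G u = a" "\<forall>v\<in>prefix_vals G u \<one>. A #> v \<in> (#>) A ` word_ball n"
      using eng.IH(1) by blast
    obtain w where w: "fst ` set w \<subseteq> X" "word_val G w = b" "\<forall>v\<in>prefix_vals G w \<one>. A #> v \<in> (#>) A ` word_ball n"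
      using eng.IH(2) by blast
    have over: "fst ` set u \<subseteq> carrier G" "fst ` set w \<subseteq> carrier G" using u w X_carrier by blast+
    have aA: "a \<in> A" using eng.hyps S(3) by simp
    have "prefix_vals G (u @ w) \<one> = prefix_vals G u \<one> \<union> (\<otimes>) a ` prefix_vals G w \<one>"
      using prefix_vals_append[OF one_closed over] prefix_vals_shift[OF _ one_closed over(2), of a] u(2) aA
      by simp
    moreover have "A #> (a \<otimes> v) \<in> (#>) A ` word_ball n" if v: "v \<in> prefix_vals G w \<one>" for v
    proof -
      have vG: "v \<in> carrier G" using prefix_vals_closed[OF one_closed over(2)] v by blast
      have "A #> (a \<otimes> v) = A #> a #> v" using coset_mult_assoc[OF A.subset _ vG, of a] aA by simp
      also have "A #> a = A" using rcos_eq_self_iff[OF sA] aA by simp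
      finally show ?thesis using w(3) v by simp
    qed
    ultimately have "\<forall>v\<in>prefix_vals G (u @ w) \<one>. A #> v \<in> (#>) A ` word_ball n" using u(3) by auto
    moreover have "word_val G (u @ w) = a \<otimes> b" using word_val_append[OF over] u(2) w(2) by simp
    ultimately show ?case using u(1) w(1) by (intro exI[of _ "u @ w"]) auto
  qed
  then have *: "\<exists>w. fst ` set w \<subseteq> X \<and> word_val G w = a \<and> (\<forall>v\<in>prefix_vals G w \<one>. A #> v \<in> (#>) A ` word_ball n)"
    if "a \<in> A" for a using that S(3) by blast
  have "(#>) A ` prefixes A \<subseteq> (#>) A ` word_ball n"
  proof
    fix c assume "c \<in> (#>) A ` prefixes A"
    then obtain a v where av: "a \<in> A" "v \<in> prefix_vals G (nf a) \<one>" "c = A #> v"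
      unfolding prefixes_def by blast
    obtain w where w: "fst ` set w \<subseteq> X" "word_val G w = a" "\<forall>v\<in>prefix_vals G w \<one>. A #> v \<in> (#>) A ` word_ball n"
      using *[OF av(1)] by blast
    have "prefix_vals G (nf a) \<one> \<subseteq> prefix_vals G w \<one>"
      using prefix_vals_free_reduce[of w \<one>] free_reduce_eq_nf[OF w(1)] w X_carrier by auto
    then show "c \<in> (#>) A ` word_ball n" using w(3) av by blast
  qed
  then show ?thesis using finite_word_ball[OF X, of n] finite_subset by blast
qed

text \<open>
  The generators are the Schreier generators of the edges between vertices of the core.
\<close>
lemma fin_gen_of_finite_core:
  assumes X: "finite X" and sA: "subgroup A G" and fin: "finite ((#>) A ` prefixes A)"
  shows "fin_gen_subgroup A G"
proof -
  interpret A: subgroup A G by fact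
  define V where "V = prefixes A"
  have VG: "V \<subseteq> carrier G" unfolding V_def by (rule prefixes_closed[OF A.subset])
  define C where "C = (#>) A ` V"
  define t where "t c = (if c = A then \<one> else (SOME g. g \<in> carrier G \<and> A #> g = c))" for c
  have t: "t c \<in> carrier G \<and> A #> t c = c" if "c \<in> C" for c
  proof (cases "c = A")
    case False
    have "(SOME g. g \<in> carrier G \<and> A #> g = c) \<in> carrier G \<and> A #> (SOME g. g \<in> carrier G \<and> A #> g = c) = c"
      by (rule someI_ex) (use that VG in \<open>auto simp: C_def\<close>)
    then show ?thesis using False by (simp add: t_def)
  qed (simp add: t_def A.subset)
  define Y where "Y = letter_val G ` (X \<times> UNIV)"
  have "finite Y" unfolding Y_def using X by simp
  define S where "S = A \<inter> (\<lambda>(c, y, d). t c \<otimes> y \<otimes> inv (t d)) ` (C \<times> Y \<times> C)"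
  have finS: "finite S" unfolding S_def using fin \<open>finite Y\<close> by (simp add: C_def V_def)
  have SG: "S \<subseteq> carrier G" using A.subset by (auto simp: S_def)
  have key: "t (A #> g) \<otimes> word_val G w \<otimes> inv (t (A #> (g \<otimes> word_val G w))) \<in> generate G S"
    if "g \<in> carrier G" "fst ` set w \<subseteq> X" "prefix_vals G w g \<subseteq> V" for g w
    using that
  proof (induction w arbitrary: g)
    case Nil
    then have "A #> g \<in> C" by (simp add: C_def)
    then show ?case using t Nil by (simp add: generate.one)
  next
    case (Cons l w)
    define y where "y = letter_val G l"
    define h where "h = word_val G w"
    have l: "fst l \<in> X" "fst l \<in> carrier G" using Cons.prems X_carrier by auto
    have yG: "y \<in> carrier G" unfolding y_def by (rule letter_val_closed[OF l(2)])
    have hG: "h \<in> carrier G" unfolding h_def using Cons.prems X_carrier by (intro word_val_closed) auto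
    have gG: "g \<in> carrier G" by (rule Cons.prems(1))
    have sub: "prefix_vals G w (g \<otimes> y) \<subseteq> V" "g \<in> V" using Cons.prems(3) by (auto simp: y_def)
    have IH: "t (A #> (g \<otimes> y)) \<otimes> h \<otimes> inv (t (A #> (g \<otimes> y \<otimes> h))) \<in> generate G S"
      unfolding h_def using Cons.IH[OF _ _ sub(1)] Cons.prems gG yG by auto
    have gyV: "g \<otimes> y \<in> V" using sub(1) prefix_vals_start by fast
    have "fst ` set w \<subseteq> carrier G" using Cons.prems X_carrier by auto
    then have end_V: "g \<otimes> y \<otimes> h \<in> V"
      unfolding h_def using prefix_vals_end[of "g \<otimes> y" w] sub(1) gG yG by auto
    have c: "A #> g \<in> C" "A #> (g \<otimes> y) \<in> C" "A #> (g \<otimes> y \<otimes> h) \<in> C"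
      using sub gyV end_V by (auto simp: C_def)
    define a where "a = t (A #> g) \<otimes> y \<otimes> inv (t (A #> (g \<otimes> y)))"
    have "A #> (t (A #> g) \<otimes> y) = A #> t (A #> (g \<otimes> y))"
      using t[OF c(1)] t[OF c(2)] coset_mult_assoc[OF A.subset _ yG, of "t (A #> g)"]
        coset_mult_assoc[OF A.subset gG yG] by simp
    then have "a \<in> A" unfolding a_def
      using rcos_eq_iff[OF sA, of "t (A #> g) \<otimes> y" "t (A #> (g \<otimes> y))"] t[OF c(1)] t[OF c(2)] yG by simp
    moreover have "y \<in> Y" unfolding Y_def y_def using l by (cases l) auto
    moreover from calculation(2) have "a \<in> (\<lambda>(c, y, d). t c \<otimes> y \<otimes> inv (t d)) ` (C \<times> Y \<times> C)"
      by (intro image_eqI[of _ _ "(A #> g, y, A #> (g \<otimes> y))"]) (use c in \<open>simp_all add: a_def\<close>)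
    ultimately have "a \<in> S" unfolding S_def by simp
    then have "a \<otimes> (t (A #> (g \<otimes> y)) \<otimes> h \<otimes> inv (t (A #> (g \<otimes> y \<otimes> h)))) \<in> generate G S"
      by (rule generate.eng[OF generate.incl IH])
    then show ?case
      using t[OF c(1)] t[OF c(2)] t[OF c(3)] gG yG hG
      by (simp add: a_def y_def[symmetric] h_def[symmetric] group_normalize)
  qed
  have "A \<subseteq> generate G S"
  proof
    fix a assume a: "a \<in> A"
    then have aG: "a \<in> carrier G" by simp
    have "prefix_vals G (nf a) \<one> \<subseteq> V" unfolding V_def prefixes_def using a by blast
    then have "t (A #> \<one>) \<otimes> a \<otimes> inv (t (A #> (\<one> \<otimes> a))) \<in> generate G S"
      using key[OF one_closed nf_over[OF aG]] nf_val[OF aG] by simp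
    moreover have "A #> a = A" using rcos_eq_self_iff[OF sA aG] a by simp
    moreover have "t A = \<one>" by (simp add: t_def)
    ultimately show "a \<in> generate G S" using aG A.subset by simp
  qed
  moreover have "generate G S \<subseteq> A" by (rule generate_subgroup_incl[OF _ sA]) (auto simp: S_def)
  ultimately have "generate G S = A" by blast
  then show ?thesis unfolding fin_gen_subgroup_def using sA finS by (auto simp: S_def)
qed

text \<open>
  A vertex of the core of \<open>A \<inter> B\<close> is determined by a vertex of the core of \<open>A\<close> and one of the
  core of \<open>B\<close>.
\<close>
theorem howson:
  assumes X: "finite X" and A: "fin_gen_subgroup A G" and B: "fin_gen_subgroup B G"
  shows "fin_gen_subgroup (A \<inter> B) G"
proof (rule fin_gen_of_finite_core[OF X])
  have sA: "subgroup A G" and sB: "subgroup B G" using A B by (auto simp: fin_gen_subgroup_def)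
  show sAB: "subgroup (A \<inter> B) G" by (rule subgroups_Inter_pair[OF sA sB])
  let ?P = "prefixes (A \<inter> B)"
  have P: "?P \<subseteq> prefixes A" "?P \<subseteq> prefixes B" by (auto simp: prefixes_def)
  have PG: "?P \<subseteq> carrier G" using subgroup.subset[OF sAB] by (rule prefixes_closed)
  have "finite ((\<lambda>v. (A #> v, B #> v)) ` ?P)"
  proof (rule finite_subset)
    show "(\<lambda>v. (A #> v, B #> v)) ` ?P \<subseteq> (#>) A ` prefixes A \<times> (#>) B ` prefixes B" using P by blast
    show "finite ((#>) A ` prefixes A \<times> (#>) B ` prefixes B)"
      using finite_core[OF X A] finite_core[OF X B] by simp
  qed
  then show "finite ((#>) (A \<inter> B) ` ?P)"
  proof (rule finite_image_same_kernel)
    fix u v assume uv: "u \<in> ?P" "v \<in> ?P" "(A #> u, B #> u) = (A #> v, B #> v)"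
    have car: "u \<in> carrier G" "v \<in> carrier G" using uv PG by blast+
    show "A \<inter> B #> u = A \<inter> B #> v"
      using uv(3) rcos_eq_iff[OF sA car] rcos_eq_iff[OF sB car] rcos_eq_iff[OF sAB car] by simp
  qed
qed

lemma fin_gen_carrier:
  assumes "finite X"
  shows "fin_gen_subgroup (carrier G) G"
  unfolding fin_gen_subgroup_def
proof (intro conjI exI[of _ X] subgroup_self assms X_carrier)
  have "word_val G w \<in> generate G X" if "fst ` set w \<subseteq> X" for w
    using that by (induction w) (auto simp: letter_val_def intro: generate.intros)
  then have "carrier G \<subseteq> generate G X" using nf_over nf_val by (metis subsetI)
  then show "generate G X = carrier G" using generate_incl[OF X_carrier] by blast
qed

lemma fin_gen_Inter:
  assumes X: "finite X" and "finite \<A>" and "\<And>A. A \<in> \<A> \<Longrightarrow> fin_gen_subgroup A G"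
  shows "fin_gen_subgroup (carrier G \<inter> \<Inter>\<A>) G"
  using assms(2,3)
proof (induction \<A> rule: finite_induct)
  case empty
  then show ?case using fin_gen_carrier[OF X] by simp
next
  case (insert A \<A>)
  have "fin_gen_subgroup (A \<inter> (carrier G \<inter> \<Inter>\<A>)) G"
    by (rule howson[OF X insert.prems insert.IH[OF insert.prems]]) simp_all
  then show ?case by (simp add: ac_simps)
qed

lemma finite_basis:
  assumes "fin_gen_group G"
  shows "finite X"
proof -
  obtain S where S: "finite S" "S \<subseteq> carrier G" "generate G S = carrier G"
    using assms unfolding fin_gen_group_def fin_gen_subgroup_def by blast
  define X0 where "X0 = (\<Union>s\<in>S. fst ` set (nf s) \<union> fst ` set (nf (inv s)))"
  have fin: "finite X0" using S(1) by (simp add: X0_def)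
  have X0X: "X0 \<subseteq> X"
    unfolding X0_def using S(2) by (intro UN_least Un_least nf_over inv_closed) auto
  have gen: "\<exists>w. fst ` set w \<subseteq> X0 \<and> word_val G w = g" if "g \<in> generate G S" for g
    using that
  proof (induction rule: generate.induct)
    case one
    show ?case by (rule exI[of _ "[]"]) simp
  next
    case (incl s)
    then show ?case using S(2) nf_val by (intro exI[of _ "nf s"]) (auto simp: X0_def)
  next
    case (inv s)
    then show ?case using S(2) nf_val by (intro exI[of _ "nf (inv s)"]) (auto simp: X0_def)
  next
    case (eng g h)
    then obtain u w where uw: "fst ` set u \<subseteq> X0" "word_val G u = g" "fst ` set w \<subseteq> X0" "word_val G w = h"
      by blast
    then have "word_val G (u @ w) = g \<otimes> h" using word_val_append[of u w] X0X X_carrier by auto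
    then show ?case using uw by (intro exI[of _ "u @ w"]) auto
  qed
  have "X \<subseteq> X0"
  proof
    fix x assume x: "x \<in> X"
    then have xG: "x \<in> carrier G" using X_carrier by blast
    then obtain w where w: "fst ` set w \<subseteq> X0" "word_val G w = x" using gen S(3) by blast
    have val: "word_val G [(x, True)] = x" using xG by (simp add: letter_val_def)
    have "free_reduce w = nf x" using free_reduce_eq_nf[of w] w X0X by auto
    moreover have "[(x, True)] = nf x" using free_reduce_eq_nf[of "[(x, True)]", unfolded val] x by simp
    ultimately have "free_reduce w = [(x, True)]" by simp
    moreover have "free_reduce w \<in> reduced_words X0" by (rule free_reduce_reduced[OF w(1)])
    ultimately show "x \<in> X0" by (simp add: reduced_words_def)
  qed
  then show ?thesis using fin finite_subset by blast
qed

end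

section \<open>The closure in the pro-supersolvable topology\<close>

context group
begin

text \<open>
  The cosets, defined as a subbasis, form a basis.
\<close>
lemma pro_Su_open_imp_coset:
  assumes "openin (pro_topology Su G) W" "x \<in> W" "x \<in> carrier G"
  shows "\<exists>K. su_open K \<and> K #> x \<subseteq> W"
proof -
  have "generate_topology_on {K #> x | K x. K \<lhd> G \<and> Su (G Mod K) \<and> x \<in> carrier G} W"
    using assms(1) unfolding pro_topology_def openin_topology_generated_by_iff .
  then show ?thesis using assms(2)
  proof (induction rule: generate_topology_on.induct)
    case Empty
    then show ?case by simp
  next
    case (Int a b)
    then obtain K M where KM: "su_open K" "K #> x \<subseteq> a" "su_open M" "M #> x \<subseteq> b" by blast
    have "K \<inter> M #> x \<subseteq> a \<inter> b" using KM(2,4) unfolding r_coset_def by blast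
    then show ?case using su_open_Int[OF KM(1,3)] by blast
  next
    case (UN \<W>)
    then obtain w where w: "w \<in> \<W>" "x \<in> w" by blast
    then obtain K where "su_open K" "K #> x \<subseteq> w" using UN.IH by blast
    then show ?case using w(1) by blast
  next
    case (Basis s)
    then obtain K y where K: "s = K #> y" "K \<lhd> G" "Su (G Mod K)" "y \<in> carrier G" by blast
    have "K #> y = K #> x"
      using repr_independence[of x K y] Basis.prems K normal_imp_subgroup by blast
    then show ?case using K Su_Mod_iff[OF K(2)] by auto
  qed
qed

lemma Cl_Su_eq:
  assumes H: "subgroup H G"
  shows "Cl Su G H = {x\<in>carrier G. \<forall>K. su_open K \<longrightarrow> x \<in> H <#> K}"
proof -
  interpret H: subgroup H G by fact
  have meets: "(\<exists>y\<in>H. y \<in> K #> x) \<longleftrightarrow> x \<in> H <#> K" if K: "K \<lhd> G" and x: "x \<in> carrier G" for K x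
  proof -
    interpret K: normal K G by fact
    have "y \<in> K #> x \<longleftrightarrow> inv y \<otimes> x \<in> K" if "y \<in> H" for y
    proof -
      have "y \<in> K #> x \<longleftrightarrow> y \<otimes> inv x \<in> K" using K.rcos_module[OF is_group x, of y] that by simp
      also have "\<dots> \<longleftrightarrow> inv (y \<otimes> inv x) \<in> K"
        using K.m_inv_closed[of "inv (y \<otimes> inv x)"] K.m_inv_closed[of "y \<otimes> inv x"] that x by auto
      also have "inv (y \<otimes> inv x) = x \<otimes> inv y" using that x by (simp add: group_normalize)
      also have "x \<otimes> inv y \<in> K \<longleftrightarrow> inv y \<otimes> x \<in> K"
      proof
        assume "x \<otimes> inv y \<in> K"
        then have "inv y \<otimes> (x \<otimes> inv y) \<otimes> y \<in> K" using that by (intro K.inv_op_closed1) auto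
        then show "inv y \<otimes> x \<in> K" using that x by (simp add: group_normalize)
      next
        assume "inv y \<otimes> x \<in> K"
        then have "y \<otimes> (inv y \<otimes> x) \<otimes> inv y \<in> K" using that by (intro K.inv_op_closed2) auto
        then show "x \<otimes> inv y \<in> K" using that x by (simp add: group_normalize)
      qed
      finally show ?thesis .
    qed
    moreover have "x \<in> H <#> K \<longleftrightarrow> (\<exists>y\<in>H. inv y \<otimes> x \<in> K)"
    proof
      assume "x \<in> H <#> K"
      then obtain y k where yk: "y \<in> H" "k \<in> K" "x = y \<otimes> k" unfolding set_mult_def by blast
      then have "inv y \<otimes> x = k" by (simp add: group_normalize)
      then show "\<exists>y\<in>H. inv y \<otimes> x \<in> K" using yk(1,2) by (intro bexI[of _ y]) simp_all
    next
      assume "\<exists>y\<in>H. inv y \<otimes> x \<in> K"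
      then obtain y where y: "y \<in> H" "inv y \<otimes> x \<in> K" by blast
      then have "x = y \<otimes> (inv y \<otimes> x)" using x by (simp add: group_normalize)
      then show "x \<in> H <#> K" using y unfolding set_mult_def by blast
    qed
    ultimately show ?thesis by blast
  qed
  let ?B = "{K #> x | K x. K \<lhd> G \<and> Su (G Mod K) \<and> x \<in> carrier G}"
  have basis_open: "openin (pro_topology Su G) (K #> x)" if "su_open K" "x \<in> carrier G" for K x
    unfolding pro_topology_def
    by (rule topology_generated_by_Basis) (use that su_open_normal Su_Mod_iff in blast)
  have top: "topspace (pro_topology Su G) = carrier G"
  proof
    show "topspace (pro_topology Su G) \<subseteq> carrier G"
      unfolding pro_topology_def topology_generated_by_topspace
    proof (rule Union_least)
      fix c assume "c \<in> ?B"
      then obtain K y where K: "c = K #> y" "K \<lhd> G" "y \<in> carrier G" by blast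
      then show "c \<subseteq> carrier G"
        using r_coset_subset_G[OF subgroup.subset[OF normal_imp_subgroup[OF K(2)]]] by simp
    qed
    have "carrier G #> \<one> = carrier G" by simp
    then have "openin (pro_topology Su G) (carrier G)" using basis_open[OF su_open.base one_closed] by simp
    then show "carrier G \<subseteq> topspace (pro_topology Su G)" by (rule openin_subset)
  qed
  show ?thesis
    unfolding Cl_def closure_of_def top
  proof (intro Collect_cong conj_cong refl)
    fix x assume x: "x \<in> carrier G"
    show "(\<forall>W. x \<in> W \<and> openin (pro_topology Su G) W \<longrightarrow> (\<exists>y\<in>H. y \<in> W)) \<longleftrightarrow> (\<forall>K. su_open K \<longrightarrow> x \<in> H <#> K)"
    proof (intro iffI allI impI)
      fix K assume all: "\<forall>W. x \<in> W \<and> openin (pro_topology Su G) W \<longrightarrow> (\<exists>y\<in>H. y \<in> W)" and K: "su_open K"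
      have "x \<in> K #> x" by (rule rcos_self[OF x normal_imp_subgroup[OF su_open_normal[OF K]]])
      then have "\<exists>y\<in>H. y \<in> K #> x" using all basis_open[OF K x] by blast
      then show "x \<in> H <#> K" using meets[OF su_open_normal[OF K] x] by blast
    next
      fix W assume all: "\<forall>K. su_open K \<longrightarrow> x \<in> H <#> K" and W: "x \<in> W \<and> openin (pro_topology Su G) W"
      obtain K where K: "su_open K" "K #> x \<subseteq> W" using pro_Su_open_imp_coset[of W x] W x by blast
      then have "\<exists>y\<in>H. y \<in> K #> x" using all meets[OF su_open_normal[OF K(1)] x] by blast
      then show "\<exists>y\<in>H. y \<in> W" using K(2) by blast
    qed
  qed
qed

end

theorem mainTheorem1:
  fixes F :: "('a, 'b) monoid_scheme" and H :: "'a set"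
  assumes "free_group F" and "fin_gen_group F"
    and "fin_gen_subgroup H F"
  shows "fin_gen_subgroup (Cl Su F H) F"
proof -
  interpret group F using assms(1) by (simp add: free_group_def)
  obtain X where "free_basis F X" using assms(1) by (auto simp: free_group_def)
  then interpret based_free_group F X by unfold_locales
  have X: "finite X" by (rule finite_basis[OF assms(2)])
  obtain S where S: "finite S" "S \<subseteq> carrier F" "generate F S = carrier F"
    using assms(2) unfolding fin_gen_group_def fin_gen_subgroup_def by blast
  obtain B where B: "finite B" "B \<subseteq> H" "generate F B = H" and H: "subgroup H F"
    using assms(3) unfolding fin_gen_subgroup_def by blast
  interpret H: subgroup H F by fact
  obtain n where n: "B \<subseteq> word_ball n"
    using finite_subset_word_ball[OF B(1)] B(2) H.subset by blast
  define Q where "Q = {a \<otimes>\<^bsub>F\<^esub> inv\<^bsub>F\<^esub> b | a b. a \<in> word_ball n \<and> b \<in> word_ball n}"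
  have QF: "Q \<subseteq> carrier F" unfolding Q_def using word_ball_carrier by blast
  have finQ: "finite Q"
  proof -
    have "Q = (\<lambda>(a, b). a \<otimes>\<^bsub>F\<^esub> inv\<^bsub>F\<^esub> b) ` (word_ball n \<times> word_ball n)" by (auto simp: Q_def)
    then show ?thesis using finite_word_ball[OF X] by simp
  qed
  define \<A> where "\<A> = {prime_closure p H | p. prime p}"
  have A_gen: "\<A> \<subseteq> generate F ` Pow Q"
  proof
    fix A assume "A \<in> \<A>"
    then obtain p where p: "prime p" "A = prime_closure p H" by (auto simp: \<A>_def)
    have "A = generate F (prime_closure p H \<inter> Q)"
      unfolding Q_def p(2) by (rule prime_closure_eq_generate[OF p(1) X S H B(3) n])
    then show "A \<in> generate F ` Pow Q" by blast
  qed
  have finA: "finite \<A>" by (rule finite_subset[OF A_gen]) (simp add: finQ)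
  have fgA: "fin_gen_subgroup A F" if "A \<in> \<A>" for A
  proof -
    have "A \<in> generate F ` Pow Q" by (rule subsetD[OF A_gen that])
    then obtain Q' where Q': "Q' \<subseteq> Q" "A = generate F Q'" by auto
    have "subgroup A F" unfolding Q'(2) by (rule generate_is_subgroup) (use Q'(1) QF in blast)
    moreover have "Q' \<subseteq> A" unfolding Q'(2) by (auto intro: generate.incl)
    ultimately show ?thesis
      unfolding fin_gen_subgroup_def
      by (intro conjI exI[of _ Q'] finite_subset[OF Q'(1) finQ] Q'(2)[symmetric])
  qed
  have "Cl Su F H = carrier F \<inter> \<Inter>\<A>"
  proof (intro equalityI subsetI)
    fix x assume "x \<in> Cl Su F H"
    then have x: "x \<in> carrier F" "\<And>K. su_open K \<Longrightarrow> x \<in> H <#>\<^bsub>F\<^esub> K" by (auto simp: Cl_Su_eq[OF H])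
    have "x \<in> prime_closure p H" if "prime p" for p
      using x p_open_normal_imp_su_open[OF that _ _ S] by (auto simp: prime_closure_def)
    then show "x \<in> carrier F \<inter> \<Inter>\<A>" using x(1) by (auto simp: \<A>_def)
  next
    fix x assume x: "x \<in> carrier F \<inter> \<Inter>\<A>"
    have "x \<in> H <#>\<^bsub>F\<^esub> K" if K: "su_open K" for K
    proof (rule su_open_closure_from_primes[OF K H _ S])
      fix p T assume "prime (p::nat)" "T \<lhd> F" "p_open p (pow_comm (p - 1)) T"
      then show "x \<in> H <#>\<^bsub>F\<^esub> T" using x by (auto simp: \<A>_def prime_closure_def)
    qed (use x in simp)
    then show "x \<in> Cl Su F H" using x by (simp add: Cl_Su_eq[OF H])
  qed
  then show ?thesis using fin_gen_Inter[OF X finA fgA] by simp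
qed

end
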